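(* Let $\mathfrak H$ be an infinite-dimensional Hilbert space, $\mathbf L:\mathfrak D(\mathbf L)\subseteq\mathfrak H\to\mathfrak H$ the generator of a strongly continuous semigroup $\mathbf S$, $B\subset\mathbb{R}^n$ nonempty compact, and $\beta\mapsto\mathbf L'_\beta$ a continuous map from $B$ into $\mathfrak L(\mathfrak H)$ with each $\mathbf L'_\beta$ compact. Let $\mathbf S_\beta$ be the semigroup generated by $\mathbf L_\beta=\mathbf L+\mathbf L'_\beta$ (domain $\mathfrak D(\mathbf L)$). Fix $\omega_0>\omega(\mathbf S)$ and let $\mathbf P_\beta$ be the total projection defined below. Then there exist $\omega<\omega_0$ and $M_\omega\ge1$ with $$\|\mathbf S_\beta(\tau)(\mathbf I-\mathbf P_\beta)\|_{\mathfrak L(\mathfrak H)}\le M_\omega e^{\omega\tau}\|\mathbf I-\mathbf P_\beta\|_{\mathfrak L(\mathfrak H)}\quad\text{for all }\tau\ge0,\ \beta\in B,$$ if and only if there is $C_{\omega_0}>0$ such that $\|(z\mathbf I-\mathbf L_\beta)^{-1}(\mathbf I-\mathbf P_\beta)\|_{\mathfrak L(\mathfrak H)}\le C_{\omega_0}$ for all $z\in\mathbb{C}$ with $\operatorname{Re}z\ge\omega_0$ and all $\beta\in B$ (here $z\mapsto(z\mathbf I-\mathbf L_\beta)^{-1}(\mathbf I-\mathbf P_\beta)$ is understood as its analytic extension to $\varrho(\mathbf L_\beta)\cup\{\operatorname{Re} z\ge \omega_0\}$, i.e. the resolvent of $\mathbf L_\beta$ restricted to $\operatorname{ran}(\mathbf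 I-\mathbf P_\beta)$, composed with $\mathbf I-\mathbf P_\beta$).
   Context: $\omega(\mathbf S)=\inf\{\omega\in\mathbb{R}:\exists M\ge1,\ \|\mathbf S(\tau)\|\le Me^{\omega\tau}\ \forall\tau\ge0\}$ is the growth bound. For $\beta\in B$, the set $\Sigma_\beta=\sigma(\mathbf L_\beta)\cap\{z:\operatorname{Re}z\ge\omega_0\}$ is finite and consists of isolated eigenvalues of finite algebraic multiplicity (a known consequence of compactness of $\mathbf L'_\beta$); $\mathbf P_{\lambda,\beta}=\frac1{2\pi i}\int_{\partial\mathbb{D}_{r}(\lambda)}(z\mathbf I-\mathbf L_\beta)^{-1}dz$ is the Riesz projection of $\lambda\in\Sigma_\beta$ (with $r>0$ such that the closed disks are disjoint and contained in $\varrho(\mathbf L_\beta)$ except for their centers), and $\mathbf P_\beta=\sum_{\lambda\in\Sigma_\beta}\mathbf P_{\lambda,\beta}$. *)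

theory Defs
  imports "HOL-Complex_Analysis.Complex_Analysis"
begin

text \<open>A complex Hilbert space is modelled as a real Hilbert space (type class
  real_inner + complete_space) together with a complex structure J
  (multiplication by i): J real-linear, J (J x) = -x, J orthogonal.
  Complex scalar multiplication is then z x = Re z x + Im z (J x).\<close>

definition complex_structure :: "('a::real_inner \<Rightarrow> 'a) \<Rightarrow> bool" where
  "complex_structure J \<longleftrightarrow> linear J \<and> (\<forall>x. J (J x) = - x) \<and> (\<forall>x y. inner (J x) (J y) = inner x y)"

definition cmul :: "('a::real_vector \<Rightarrow> 'a) \<Rightarrow> complex \<Rightarrow> 'a \<Rightarrow> 'a" where
  "cmul J z x = Re z *\<^sub>R x + Im z *\<^sub>R J x"

definition infinite_dim_C :: "('a::real_vector \<Rightarrow> 'a) \<Rightarrow> bool" where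
  "infinite_dim_C J \<longleftrightarrow> (\<forall>F. finite F \<longrightarrow> (\<exists>x. \<forall>c. x \<noteq> (\<Sum>f\<in>F. cmul J (c f) f)))"

definition cbounded :: "('a::real_normed_vector \<Rightarrow> 'a) \<Rightarrow> ('a \<Rightarrow> 'a) \<Rightarrow> bool" where
  "cbounded J A \<longleftrightarrow> bounded_linear A \<and> (\<forall>x. A (J x) = J (A x))"

definition compact_operator :: "('a::real_normed_vector \<Rightarrow> 'a) \<Rightarrow> bool" where
  "compact_operator A \<longleftrightarrow> compact (closure (A ` ball 0 1))"

definition C0_semigroup :: "('a::real_normed_vector \<Rightarrow> 'a) \<Rightarrow> (real \<Rightarrow> 'a \<Rightarrow> 'a) \<Rightarrow> bool" where
  "C0_semigroup J S \<longleftrightarrow>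
     (\<forall>t\<ge>0. cbounded J (S t)) \<and> S 0 = id \<and>
     (\<forall>t s. t \<ge> 0 \<longrightarrow> s \<ge> 0 \<longrightarrow> S (t + s) = S t \<circ> S s) \<and>
     (\<forall>x. ((\<lambda>t. S t x) \<longlongrightarrow> x) (at_right 0))"

definition generator :: "(real \<Rightarrow> 'a \<Rightarrow> 'a) \<Rightarrow> 'a set \<Rightarrow> ('a::real_normed_vector \<Rightarrow> 'a) \<Rightarrow> bool" where
  "generator S D L \<longleftrightarrow>
     D = {x. \<exists>y. ((\<lambda>t. (1 / t) *\<^sub>R (S t x - x)) \<longlongrightarrow> y) (at_right 0)} \<and>
     (\<forall>x\<in>D. ((\<lambda>t. (1 / t) *\<^sub>R (S t x - x)) \<longlongrightarrow> L x) (at_right 0))"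

definition growth_bound :: "(real \<Rightarrow> 'a \<Rightarrow> 'a::real_normed_vector) \<Rightarrow> ereal" where
  "growth_bound S = Inf {ereal w | w. \<exists>M\<ge>1. \<forall>t\<ge>0. onorm (S t) \<le> M * exp (w * t)}"

definition resolvent_set :: "('a::real_normed_vector \<Rightarrow> 'a) \<Rightarrow> 'a set \<Rightarrow> ('a \<Rightarrow> 'a) \<Rightarrow> complex set" where
  "resolvent_set J D A = {z. bij_betw (\<lambda>x. cmul J z x - A x) D UNIV \<and>
                             bounded_linear (the_inv_into D (\<lambda>x. cmul J z x - A x))}"

definition resolvent :: "('a::real_normed_vector \<Rightarrow> 'a) \<Rightarrow> 'a set \<Rightarrow> ('a \<Rightarrow> 'a) \<Rightarrow> complex \<Rightarrow> 'a \<Rightarrow> 'a" where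
  "resolvent J D A z = the_inv_into D (\<lambda>x. cmul J z x - A x)"

definition spectrum_op :: "('a::real_normed_vector \<Rightarrow> 'a) \<Rightarrow> 'a set \<Rightarrow> ('a \<Rightarrow> 'a) \<Rightarrow> complex set" where
  "spectrum_op J D A = - resolvent_set J D A"

definition Sigma_set :: "('a::real_normed_vector \<Rightarrow> 'a) \<Rightarrow> 'a set \<Rightarrow> ('a \<Rightarrow> 'a) \<Rightarrow> real \<Rightarrow> complex set" where
  "Sigma_set J D A w0 = spectrum_op J D A \<inter> {z. Re z \<ge> w0}"

definition riesz_radius :: "('a::real_normed_vector \<Rightarrow> 'a) \<Rightarrow> 'a set \<Rightarrow> ('a \<Rightarrow> 'a) \<Rightarrow> real \<Rightarrow> real" where
  "riesz_radius J D A w0 = (SOME r. r > 0 \<and>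
     (\<forall>l\<in>Sigma_set J D A w0. cball l r - {l} \<subseteq> resolvent_set J D A) \<and>
     (\<forall>l\<in>Sigma_set J D A w0. \<forall>\<mu>\<in>Sigma_set J D A w0. l \<noteq> \<mu> \<longrightarrow> cball l r \<inter> cball \<mu> r = {}))"

definition riesz_proj :: "('a::real_normed_vector \<Rightarrow> 'a) \<Rightarrow> 'a set \<Rightarrow> ('a \<Rightarrow> 'a) \<Rightarrow> complex \<Rightarrow> real \<Rightarrow> 'a \<Rightarrow> 'a" where
  "riesz_proj J D A l r x =
     integral {0..1} (\<lambda>t. cmul J (vector_derivative (circlepath l r) (at t within {0..1}) / (2 * pi * \<i>))
                                 (resolvent J D A (circlepath l r t) x))"

definition total_proj :: "('a::real_normed_vector \<Rightarrow> 'a) \<Rightarrow> 'a set \<Rightarrow> ('a \<Rightarrow> 'a) \<Rightarrow> real \<Rightarrow> 'a \<Rightarrow> 'a" where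
  "total_proj J D A w0 x = (\<Sum>l\<in>Sigma_set J D A w0. riesz_proj J D A l (riesz_radius J D A w0) x)"

text \<open>(zI - A)^{-1}(I - P): the resolvent of A restricted to ran(I - P), composed with I - P.
  For z in the resolvent set this coincides with the resolvent composed with I - P.\<close>
definition reduced_resolvent :: "('a::real_normed_vector \<Rightarrow> 'a) \<Rightarrow> 'a set \<Rightarrow> ('a \<Rightarrow> 'a) \<Rightarrow> ('a \<Rightarrow> 'a) \<Rightarrow> complex \<Rightarrow> 'a \<Rightarrow> 'a" where
  "reduced_resolvent J D A P z x =
     (THE y. y \<in> D \<and> y \<in> range (\<lambda>u. u - P u) \<and> cmul J z y - A y = x - P x)"

end

theory Submission
  imports Defs
begin

text \<open>Write \<open>R\<close> for the resolvent of L and K for the compact perturbations. Approximate eigenvectors u with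
  (z - L - K) u close to 0 satisfy u close to R(z) K u; by compactness of K, uniformly in the parameter,
  they converge along a subsequence to a true eigenvector, and their eigenvalue parameters z stay
  bounded because R(z) tends to 0 strongly. Together with the discreteness of the spectrum this
  controls all the operators L + K at once.

  If the decay estimate holds at a rate below the threshold, no eigenvalue can lie in the
  vertical strip in between. A single circle through this strip therefore encloses the unstable spectrum for
  all parameters, so the projections are uniformly bounded, and the Laplace transform of the
  decaying semigroup represents the reduced resolvent.

  Conversely, a bound on the reduced resolvent in the half-plane gives, through Fourier series of the
  orbits multiplied by a periodic cutoff, weighted energy estimates whose constants depend only on that
  bound and on the growth of the semigroups, which is uniform by Duhamel and Gronwall. Datko's argument
  turns the energy estimates into exponential decay with uniform constants.\<close>


section \<open>Uniform boundedness, complex structures and semigroups\<close>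

text \<open>The statement compares bounds that hold for all parameters at once, so every constant
  must be traceable. A closed graph argument, which would turn square-integrable orbits into a
  bounded energy, is therefore replaced by the explicit \<open>energy_const\<close>,
  \<open>growth_const\<close> and \<open>decay_time\<close>, which involve only m, a and C. The norm
  of \<open>I - P\<close> stands on the right of the decay estimate but not on the right of the
  resolvent bound. Going from decay to the resolvent thus needs a uniform bound on the projections,
  whereas the other direction only tests vectors u in the kernel of P, where u is itself the reduced
  solution for the datum \<open>z u - A u\<close>. The spectral gap left of the threshold is first
  found for each parameter separately and becomes uniform only as a consequence of decay.\<close>

text \<open>Gliding hump: the n-th step has length at most 1/3 to the n, against an operator of norm
  above 4 to the n.\<close>

lemma uniform_boundedness:
  fixes F :: "('a::banach \<Rightarrow> 'b::real_normed_vector) set"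
  assumes lin: "\<And>f. f \<in> F \<Longrightarrow> bounded_linear f"
    and pt: "\<And>x. \<exists>c. \<forall>f\<in>F. norm (f x) \<le> c"
  shows "\<exists>M. \<forall>f\<in>F. onorm f \<le> M"
proof (rule ccontr)
  assume "\<not> ?thesis"
  then have "\<forall>n::nat. \<exists>f\<in>F. onorm f > 4 ^ n" by (meson not_le)
  then obtain f where f: "\<And>n. f n \<in> F" "\<And>n. onorm (f n) > 4 ^ n" by metis
  \<comment> \<open>One of \<open>x + w\<close> and \<open>x - w\<close> works, since their images
    under g differ by twice \<open>g w\<close>. The factor 2/3 leaves room because the operator norm
    need not be attained.\<close>
  have step: "\<exists>y. norm (y - x) \<le> r \<and> norm (g y) \<ge> (2/3) * r * onorm g"
    if "bounded_linear g" "r > 0" "onorm g > 0" for g :: "'a \<Rightarrow> 'b" and x r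
  proof -
    interpret g: bounded_linear g by fact
    have "\<exists>u. norm (g u) > (2/3) * onorm g * norm u"
    proof (rule ccontr)
      assume "\<not> ?thesis"
      then have "onorm g \<le> (2/3) * onorm g"
        using onorm_bound[of "(2/3) * onorm g" g] that(3) by (auto simp: not_less)
      then show False using that(3) by simp
    qed
    then obtain u where u: "norm (g u) > (2/3) * onorm g * norm u" by blast
    have u0: "norm u > 0" using u g.zero by (cases "u = 0") auto
    define w where "w = (r / norm u) *\<^sub>R u"
    have nw: "norm w = r" using u0 that(2) by (simp add: w_def)
    have gw: "norm (g w) \<ge> (2/3) * r * onorm g"
    proof -
      have "norm (g w) = (r / norm u) * norm (g u)" using that(2) by (simp add: w_def g.scaleR)
      also have "\<dots> \<ge> (r / norm u) * ((2/3) * onorm g * norm u)"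
        using u that(2) by (intro mult_left_mono) auto
      finally show ?thesis using u0 by (simp add: mult_ac)
    qed
    have "2 * norm (g w) = norm (g (x + w) - g (x - w))"
      by (simp add: g.add g.diff scaleR_2[symmetric] algebra_simps)
    also have "\<dots> \<le> norm (g (x + w)) + norm (g (x - w))" by (rule norm_triangle_ineq4)
    finally have "norm (g w) \<le> norm (g (x + w)) \<or> norm (g w) \<le> norm (g (x - w))" by linarith
    then show ?thesis
    proof
      assume "norm (g w) \<le> norm (g (x + w))"
      then show ?thesis using nw gw by (intro exI[of _ "x + w"]) auto
    next
      assume "norm (g w) \<le> norm (g (x - w))"
      then show ?thesis using nw gw by (intro exI[of _ "x - w"]) auto
    qed
  qed
  have pos: "onorm (f n) > 0" for n using f(2)[of n] by (meson less_trans zero_less_power zero_less_numeral)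
  have "\<forall>n x. \<exists>y. norm (y - x) \<le> (1/3) ^ n \<and> norm (f n y) \<ge> (2/3) * (1/3) ^ n * onorm (f n)"
    using step[OF lin[OF f(1)] _ pos] by simp
  then obtain h where "\<forall>n x. norm (h n x - x) \<le> (1/3) ^ n \<and> norm (f n (h n x)) \<ge> (2/3) * (1/3) ^ n * onorm (f n)"
    by metis
  then have h: "\<And>n x. norm (h n x - x) \<le> (1/3) ^ n"
    "\<And>n x. norm (f n (h n x)) \<ge> (2/3) * (1/3) ^ n * onorm (f n)" by auto
  define X where "X = rec_nat 0 h"
  have X: "norm (X (Suc n) - X n) \<le> (1/3) ^ n" "norm (f n (X (Suc n))) \<ge> (2/3) * (1/3) ^ n * onorm (f n)" for n
    using h by (simp_all add: X_def)
  have dist: "norm (X (n + k) - X n) \<le> (3/2) * (1/3) ^ n * (1 - (1/3) ^ k)" for n k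
  proof (induction k)
    case 0 then show ?case by simp
  next
    case (Suc k)
    have "norm (X (n + Suc k) - X n) \<le> norm (X (Suc (n + k)) - X (n + k)) + norm (X (n + k) - X n)"
      using norm_triangle_ineq[of "X (Suc (n + k)) - X (n + k)" "X (n + k) - X n"] by simp
    also have "\<dots> \<le> (1/3) ^ (n + k) + (3/2) * (1/3) ^ n * (1 - (1/3) ^ k)"
      using X(1) Suc by (intro add_mono)
    also have "\<dots> = (3/2) * (1/3) ^ n * (1 - (1/3) ^ Suc k)"
      by (simp add: power_add diff_divide_distrib algebra_simps)
    finally show ?case .
  qed
  have dist': "norm (X m - X n) \<le> (3/2) * (1/3) ^ n" if "n \<le> m" for m n
  proof -
    have "norm (X m - X n) \<le> (3/2) * (1/3) ^ n * (1 - (1/3) ^ (m - n))"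
      using dist[of n "m - n"] that by simp
    also have "\<dots> \<le> (3/2) * (1/3) ^ n * 1" by (intro mult_left_mono) auto
    finally show ?thesis by simp
  qed
  have lim0: "(\<lambda>n. (3/2) * (1/3::real) ^ n) \<longlonglongrightarrow> 0"
    by (intro tendsto_mult_right_zero LIMSEQ_power_zero) auto
  have "Cauchy X"
  proof (rule CauchyI)
    fix e :: real assume "e > 0"
    then obtain N where N: "(3/2) * (1/3::real) ^ N < e / 2"
      using order_tendstoD(2)[OF lim0, of "e/2"] by (auto simp: eventually_sequentially)
    show "\<exists>M. \<forall>m\<ge>M. \<forall>n\<ge>M. norm (X m - X n) < e"
    proof (intro exI[of _ N] allI impI)
      fix m n assume "m \<ge> N" "n \<ge> N"
      then show "norm (X m - X n) < e"
        using dist'[of N m] dist'[of N n] N norm_triangle_ineq4[of "X m - X N" "X n - X N"] by simp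
    qed
  qed
  then obtain x where x: "X \<longlonglongrightarrow> x" using convergent_eq_Cauchy[of X] by blast
  have xd: "norm (x - X n) \<le> (3/2) * (1/3) ^ n" for n
  proof (rule tendsto_upperbound)
    show "(\<lambda>m. norm (X m - X n)) \<longlonglongrightarrow> norm (x - X n)" using x by (intro tendsto_intros)
    show "\<forall>\<^sub>F m in sequentially. norm (X m - X n) \<le> (3/2) * (1/3) ^ n"
      using dist' by (auto simp: eventually_sequentially)
  qed auto
  obtain c where c: "\<And>g. g \<in> F \<Longrightarrow> norm (g x) \<le> c" using pt by blast
  \<comment> \<open>The constant is 1/6 = 2/3 - 1/2: \<open>X (Suc n)\<close> is within half of
    (1/3)^n of x, so passing to x costs at most that multiple of \<open>onorm (f n)\<close>.\<close>
  have low: "(1/6) * (4/3) ^ n \<le> c" for n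
  proof -
    interpret g: bounded_linear "f n" by (rule lin[OF f(1)])
    have "norm (f n (X (Suc n))) \<le> norm (f n x) + norm (f n (x - X (Suc n)))"
      using norm_triangle_ineq4[of "f n x" "f n (x - X (Suc n))"] by (simp add: g.diff)
    also have "norm (f n (x - X (Suc n))) \<le> onorm (f n) * norm (x - X (Suc n))"
      by (rule onorm[OF g.bounded_linear_axioms])
    also have "\<dots> \<le> onorm (f n) * ((3/2) * (1/3) ^ Suc n)"
      using xd[of "Suc n"] pos[of n] by (intro mult_left_mono) auto
    finally have "norm (f n x) \<ge> (1/6) * (1/3) ^ n * onorm (f n)"
      using X(2)[of n] by (simp add: algebra_simps)
    moreover have "(1/6) * (1/3) ^ n * onorm (f n) \<ge> (1/6) * (1/3) ^ n * 4 ^ n"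
      using f(2)[of n] by (intro mult_left_mono) auto
    ultimately show ?thesis using c[OF f(1)[of n]] by (simp add: power_divide)
  qed
  obtain n where "(4/3::real) ^ n > 6 * c" using real_arch_pow[of "4/3" "6 * c"] by auto
  then show False using low[of n] by simp
qed

section \<open>Hilbert spaces with a complex structure\<close>

locale cstruct =
  fixes J :: "'a::{banach,real_inner} \<Rightarrow> 'a"
  assumes cs: "complex_structure J"
begin

abbreviation cm :: "complex \<Rightarrow> 'a \<Rightarrow> 'a" (infixr "\<odot>" 75) where "z \<odot> x \<equiv> cmul J z x"

lemma J_linear: "linear J" and JJ [simp]: "J (J x) = - x" and J_inner [simp]: "inner (J x) (J y) = inner x y"
  using cs by (auto simp: complex_structure_def)

lemma J_norm [simp]: "norm (J x) = norm x" by (simp add: norm_eq_sqrt_inner)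

sublocale J: bounded_linear J
proof -
  interpret linear J by (rule J_linear)
  show "bounded_linear J" by unfold_locales (auto intro!: exI[of _ 1])
qed

lemma inner_J_right: "inner x (J y) = - inner (J x) y"
  using J_inner[of x "J y"] by (simp add: inner_minus_right)

lemma inner_J_self [simp]: "inner x (J x) = 0" "inner (J x) x = 0"
  using inner_J_right[of x x] by (auto simp: inner_commute)

lemma cm_norm [simp]: "norm (z \<odot> x) = cmod z * norm x"
proof -
  have "inner (z \<odot> x) (z \<odot> x) = ((Re z)\<^sup>2 + (Im z)\<^sup>2) * inner x x"
    by (simp add: cmul_def inner_add_left inner_add_right power2_eq_square algebra_simps)
  then show ?thesis
    unfolding norm_eq_sqrt_inner[of "z \<odot> x"] norm_eq_sqrt_inner[of x] cmod_def by (simp add: real_sqrt_mult)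
qed

lemma cm_add_left: "(z + w) \<odot> x = z \<odot> x + w \<odot> x"
  and cm_add_right: "z \<odot> (x + y) = z \<odot> x + z \<odot> y"
  and cm_diff_left: "(z - w) \<odot> x = z \<odot> x - w \<odot> x"
  and cm_diff_right: "z \<odot> (x - y) = z \<odot> x - z \<odot> y"
  and cm_minus_left: "(- z) \<odot> x = - (z \<odot> x)"
  and cm_scaleR_left: "(r *\<^sub>R z) \<odot> x = r *\<^sub>R (z \<odot> x)"
  and cm_scaleR_right: "z \<odot> (r *\<^sub>R x) = r *\<^sub>R (z \<odot> x)"
  and cm_zero_left [simp]: "0 \<odot> x = 0" and cm_zero_right [simp]: "z \<odot> 0 = 0"
  and cm_one [simp]: "1 \<odot> x = x" and cm_of_real: "complex_of_real r \<odot> x = r *\<^sub>R x"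
  and cm_cm [simp]: "z \<odot> w \<odot> x = (z * w) \<odot> x"
  and cm_J: "z \<odot> J x = J (z \<odot> x)" and cm_ii: "\<i> \<odot> x = J x"
  by (simp_all add: cmul_def J.add J.diff J.neg J.scaleR J.zero algebra_simps)

sublocale cm: bounded_bilinear "cmul J"
  by unfold_locales (auto simp: cm_add_left cm_add_right cm_scaleR_left cm_scaleR_right intro!: exI[of _ 1])

lemmas cm_tendsto [tendsto_intros] = cm.tendsto
lemmas cm_continuous_on [continuous_intros] = cm.continuous_on

lemma cm_right_inject: "z \<noteq> 0 \<Longrightarrow> z \<odot> x = z \<odot> y \<longleftrightarrow> x = y"
  using cm_norm[of z "x - y"] by (auto simp: cm_diff_right)

lemma cboundedD: assumes "cbounded J A"
  shows "bounded_linear A" "A (J x) = J (A x)" "A (z \<odot> x) = z \<odot> A x"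
proof -
  show b: "bounded_linear A" and j: "A (J x) = J (A x)" for x using assms by (auto simp: cbounded_def)
  interpret A: bounded_linear A by (rule b)
  show "A (z \<odot> x) = z \<odot> A x" by (simp add: cmul_def A.add A.scaleR j)
qed

end

section \<open>Strongly continuous semigroups and their generators\<close>

locale c0 = cstruct J for J :: "'a::{banach,real_inner} \<Rightarrow> 'a" +
  fixes T :: "real \<Rightarrow> 'a \<Rightarrow> 'a" and D :: "'a set" and A :: "'a \<Rightarrow> 'a"
  assumes semi: "C0_semigroup J T" and gen: "generator T D A"
begin

lemma T_cb: "t \<ge> 0 \<Longrightarrow> cbounded J (T t)" and T0 [simp]: "T 0 x = x"
  and T_add: "t \<ge> 0 \<Longrightarrow> s \<ge> 0 \<Longrightarrow> T (t + s) x = T t (T s x)"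
  and T_right: "((\<lambda>t. T t x) \<longlongrightarrow> x) (at_right 0)"
  using semi unfolding C0_semigroup_def by auto

lemma T_bl: "t \<ge> 0 \<Longrightarrow> bounded_linear (T t)" using cboundedD(1)[OF T_cb] .

lemma T_lin:
  assumes "t \<ge> 0"
  shows "T t (x + y) = T t x + T t y" "T t (x - y) = T t x - T t y" "T t (- x) = - T t x" "T t 0 = 0"
    "T t (r *\<^sub>R x) = r *\<^sub>R T t x" "T t (z \<odot> x) = z \<odot> T t x" "T t (J x) = J (T t x)"
proof -
  interpret bounded_linear "T t" using T_bl[OF assms] .
  show "T t (x + y) = T t x + T t y" "T t (x - y) = T t x - T t y" "T t (- x) = - T t x" "T t 0 = 0"
    "T t (r *\<^sub>R x) = r *\<^sub>R T t x" by (simp_all add: add diff neg zero scaleR)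
  show "T t (z \<odot> x) = z \<odot> T t x" "T t (J x) = J (T t x)" using cboundedD[OF T_cb[OF assms]] by auto
qed

lemma D_iff: "x \<in> D \<longleftrightarrow> (\<exists>y. ((\<lambda>t. (1 / t) *\<^sub>R (T t x - x)) \<longlongrightarrow> y) (at_right 0))"
  and A_lim: "x \<in> D \<Longrightarrow> ((\<lambda>t. (1 / t) *\<^sub>R (T t x - x)) \<longlongrightarrow> A x) (at_right 0)"
  using gen unfolding generator_def by auto

lemma DI: assumes "((\<lambda>t. (1 / t) *\<^sub>R (T t x - x)) \<longlongrightarrow> y) (at_right 0)"
  shows "x \<in> D" "A x = y"
proof -
  show "x \<in> D" using assms D_iff by blast
  then show "A x = y" using tendsto_unique[OF _ A_lim assms] trivial_limit_at_right_real by blast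
qed

text \<open>Otherwise operators of norm above n occur at times at most 1/(n+1). Right continuity at
  0 bounds every orbit along these times, and uniform boundedness contradicts the growth of the
  norms.\<close>

lemma local_bound: "\<exists>\<delta>>0. \<exists>M. \<forall>t\<in>{0..\<delta>}. onorm (T t) \<le> M"
proof (rule ccontr)
  assume "\<not> ?thesis"
  then have "\<forall>n::nat. \<exists>t\<in>{0..1 / real (Suc n)}. onorm (T t) > real n"
    by (meson not_le of_nat_0_less_iff zero_less_Suc zero_less_divide_1_iff)
  then obtain t where t: "\<And>n. t n \<in> {0..1 / real (Suc n)}" "\<And>n. onorm (T (t n)) > real n" by metis
  have t0: "t \<longlonglongrightarrow> 0"
  proof (rule tendsto_sandwich[of "\<lambda>_. 0" _ _ "\<lambda>n. 1 / real (Suc n)"])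
    show "(\<lambda>n. 1 / real (Suc n)) \<longlonglongrightarrow> 0" using LIMSEQ_inverse_real_of_nat by (simp add: inverse_eq_divide)
  qed (use t(1) in auto)
  have "\<exists>M. \<forall>f\<in>range (\<lambda>n. T (t n)). onorm f \<le> M"
  proof (rule uniform_boundedness)
    show "bounded_linear f" if "f \<in> range (\<lambda>n. T (t n))" for f using that t(1) T_bl by auto
    fix x
    have "((\<lambda>t. T t x) \<longlongrightarrow> x) (at 0 within {0..})"
    proof -
      have "at 0 within {0..} = at_right (0::real)"
        unfolding at_within_def by (rule arg_cong[where f = "\<lambda>S. inf (nhds 0) (principal S)"]) auto
      then show ?thesis using T_right[of x] by simp
    qed
    then have "continuous (at 0 within {0..}) (\<lambda>t. T t x)" by (simp add: continuous_within)
    then have "(\<lambda>n. T (t n) x) \<longlonglongrightarrow> T 0 x"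
      using t0 t(1) unfolding continuous_within_sequentially by (auto simp: o_def)
    then have "bounded (range (\<lambda>n. T (t n) x))" using convergent_imp_bounded by blast
    then show "\<exists>c. \<forall>f\<in>range (\<lambda>n. T (t n)). norm (f x) \<le> c" by (auto simp: bounded_iff)
  qed
  then obtain M where M: "\<And>n. onorm (T (t n)) \<le> M" by auto
  obtain n :: nat where "real n > M" using reals_Archimedean2 by blast
  then show False using M[of n] t(2)[of n] by simp
qed

text \<open>With t split into n steps of length \<delta> and a remainder of at most \<delta>, the
  semigroup law gives n + 1 factors M, and M^n = exp (n ln M).\<close>

lemma exp_bound:
  obtains m a where "m \<ge> 1" "a \<ge> 0" "\<And>t x. t \<ge> 0 \<Longrightarrow> norm (T t x) \<le> m * exp (a * t) * norm x"
proof -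
  obtain \<delta> M0 where d: "\<delta> > 0" and M0: "\<And>t. t \<in> {0..\<delta>} \<Longrightarrow> onorm (T t) \<le> M0" using local_bound by blast
  define M where "M = max M0 1"
  have M: "M \<ge> 1" "\<And>t x. t \<in> {0..\<delta>} \<Longrightarrow> norm (T t x) \<le> M * norm x"
  proof -
    fix t x assume t: "t \<in> {0..\<delta>}"
    then have "norm (T t x) \<le> onorm (T t) * norm x" by (intro onorm T_bl) auto
    also have "\<dots> \<le> M * norm x" using M0[OF t] by (intro mult_right_mono) (auto simp: M_def)
    finally show "norm (T t x) \<le> M * norm x" .
  qed (simp add: M_def)
  have pow: "norm (T (real n * \<delta>) x) \<le> M ^ n * norm x" for n x
  proof (induction n)
    case (Suc n)
    have "T (real (Suc n) * \<delta>) x = T \<delta> (T (real n * \<delta>) x)"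
      using T_add[of \<delta> "real n * \<delta>"] d by (simp add: algebra_simps)
    also have "norm \<dots> \<le> M * norm (T (real n * \<delta>) x)" using M(2) d by simp
    also have "\<dots> \<le> M * (M ^ n * norm x)" using Suc M(1) by (intro mult_left_mono) auto
    finally show ?case by (simp add: mult_ac)
  qed simp
  show ?thesis
  proof (rule that[of M "ln M / \<delta>"])
    show "M \<ge> 1" "ln M / \<delta> \<ge> 0" using M(1) d by auto
    fix t x assume t: "t \<ge> (0::real)"
    define n where "n = nat \<lfloor>t / \<delta>\<rfloor>"
    have n: "real n \<le> t / \<delta>" "t / \<delta> < real n + 1" using t d by (auto simp: n_def)
    have r: "t - real n * \<delta> \<in> {0..\<delta>}" using n d by (auto simp: field_simps)
    have "T t x = T (t - real n * \<delta>) (T (real n * \<delta>) x)"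
      using T_add[of "t - real n * \<delta>" "real n * \<delta>"] r d by simp
    also have "norm \<dots> \<le> M * norm (T (real n * \<delta>) x)" by (rule M(2)[OF r])
    also have "\<dots> \<le> M * (M ^ n * norm x)" using pow M(1) by (intro mult_left_mono) auto
    also have "M ^ n = exp (real n * ln M)" using M(1) by (simp add: exp_of_nat_mult)
    also have "\<dots> \<le> exp (ln M / \<delta> * t)"
      using n(1) M(1) by (auto intro!: mult_right_mono simp: field_simps dest: mult_right_mono[of _ _ "ln M"])
    finally show "norm (T t x) \<le> M * exp (ln M / \<delta> * t) * norm x"
      using M(1) by (auto simp: mult_ac mult_left_mono mult_right_mono)
  qed
qed

lemma bounded_on:
  obtains m where "m \<ge> 1" "\<And>t x :: 'a. t \<in> {0..N} \<Longrightarrow> norm (T t x) \<le> m * norm x"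
proof -
  obtain m a where ma: "m \<ge> 1" "a \<ge> 0" "\<And>t x. t \<ge> 0 \<Longrightarrow> norm (T t x) \<le> m * exp (a * t) * norm x"
    using exp_bound by blast
  show ?thesis
  proof (rule that[of "m * exp (a * \<bar>N\<bar>)"])
    have "exp (a * \<bar>N\<bar>) \<ge> 1" using ma(2) by simp
    then show "m * exp (a * \<bar>N\<bar>) \<ge> 1" using ma(1) mult_mono[of 1 m 1 "exp (a * \<bar>N\<bar>)"] by simp
    fix t and x :: 'a assume "t \<in> {0..N}"
    then have t: "t \<ge> 0" "t \<le> \<bar>N\<bar>" by auto
    have "m * exp (a * t) * norm x \<le> m * exp (a * \<bar>N\<bar>) * norm x"
      using t ma by (intro mult_right_mono mult_left_mono) (auto simp: mult_left_mono)
    then show "norm (T t x) \<le> m * exp (a * \<bar>N\<bar>) * norm x" using ma(3)[OF t(1), of x] by linarith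
  qed
qed

text \<open>Right continuity at 0 spreads to two-sided continuity because for s \<le> t the
  increment is T s applied to \<open>T (t - s) x - x\<close>, and T s is bounded on compact time
  intervals.\<close>

lemma cont: "continuous_on {0..} (\<lambda>t. T t x)"
proof -
  have "continuous_on {0..N} (\<lambda>t. T t x)" for N
  proof -
    obtain m where m: "m \<ge> 1" "\<And>t x. t \<in> {0..N} \<Longrightarrow> norm (T t x) \<le> m * norm x" using bounded_on by blast
    have key: "norm (T t x - T s x) \<le> m * norm (T (t - s) x - x)" if "0 \<le> s" "s \<le> t" "t \<le> N" for s t
    proof -
      have "T t x - T s x = T s (T (t - s) x - x)" using T_add[of s "t - s" x] that by (simp add: T_lin)
      then show ?thesis using m(2)[of s "T (t - s) x - x"] that by simp
    qed
    show ?thesis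
    proof (rule continuous_onI)
      fix t e :: real assume t: "t \<in> {0..N}" and e: "e > 0"
      have "\<forall>\<^sub>F h in at_right 0. dist (T h x) x < e / m" using T_right e m(1) by (intro tendstoD) auto
      then obtain d where d: "d > 0" "\<And>h. 0 < h \<Longrightarrow> h < d \<Longrightarrow> dist (T h x) x < e / m"
        by (auto simp: eventually_at_right_field)
      show "\<exists>d>0. \<forall>s\<in>{0..N}. dist s t < d \<longrightarrow> dist (T s x) (T t x) \<le> e"
      proof (intro exI[of _ d] conjI ballI impI d(1))
        fix s assume s: "s \<in> {0..N}" "dist s t < d"
        have "norm (T \<bar>t - s\<bar> x - x) \<le> e / m"
          using d(2)[of "\<bar>t - s\<bar>"] s e m(1) by (cases "s = t") (auto simp: dist_norm abs_minus_commute intro: less_imp_le)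
        then have "m * norm (T \<bar>t - s\<bar> x - x) \<le> e" using m(1) by (simp add: field_simps)
        moreover have "norm (T s x - T t x) \<le> m * norm (T \<bar>t - s\<bar> x - x)"
          using key[of s t] key[of t s] s t by (cases "s \<le> t") (auto simp: norm_minus_commute)
        ultimately show "dist (T s x) (T t x) \<le> e" by (simp add: dist_norm)
      qed
    qed
  qed
  then show ?thesis
    unfolding continuous_on_eq_continuous_within
  proof (intro ballI)
    fix t :: real assume *: "\<And>N. \<forall>t\<in>{0..N}. continuous (at t within {0..N}) (\<lambda>t. T t x)" and t: "t \<in> {0..}"
    have "continuous (at t within {0..t+1}) (\<lambda>t. T t x)" using *[of "t+1"] t by auto
    moreover have "at t within {0..t+1} = at t within {0..}"
      by (rule at_within_nhd[of _ "{..<t+1}"]) (use t in auto)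
    ultimately show "continuous (at t within {0..}) (\<lambda>t. T t x)" by (simp add: continuous_within)
  qed
qed

end

context c0
begin

lemma cont_on: "S \<subseteq> {0..} \<Longrightarrow> continuous_on S (\<lambda>t. T t x)"
  using cont continuous_on_subset by blast

lemma T_int: "{a..b} \<subseteq> {0..} \<Longrightarrow> (\<lambda>t. T t x) integrable_on {a..b}"
  by (intro integrable_continuous_interval cont_on)

text \<open>Operator and argument both move; local boundedness of the norms absorbs the movement of
  the argument. This stands in for norm continuity, which fails in general.\<close>

lemma T_tendsto:
  assumes f: "(f \<longlongrightarrow> x) F" and g: "(g \<longlongrightarrow> t) F" and g0: "\<forall>\<^sub>F s in F. g s \<ge> 0" and t: "t \<ge> 0"
  shows "((\<lambda>s. T (g s) (f s)) \<longlongrightarrow> T t x) F"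
proof -
  obtain m where m: "m \<ge> 1" "\<And>s x. s \<in> {0..t + 1} \<Longrightarrow> norm (T s x) \<le> m * norm x" using bounded_on by blast
  have 1: "((\<lambda>s. T (g s) x) \<longlongrightarrow> T t x) F"
    using continuous_on_tendsto_compose[OF cont g] g0 t by auto
  have ev: "\<forall>\<^sub>F s in F. g s < t + 1" using g by (rule order_tendstoD) simp
  have "((\<lambda>s. T (g s) (f s) - T (g s) x) \<longlongrightarrow> 0) F"
  proof (rule tendsto_norm_zero_cancel, rule tendsto_sandwich[of "\<lambda>_. 0" _ _ "\<lambda>s. m * norm (f s - x)"])
    have "((\<lambda>s. m * norm (f s - x)) \<longlongrightarrow> m * norm (x - x)) F" by (intro tendsto_intros f)
    then show "((\<lambda>s. m * norm (f s - x)) \<longlongrightarrow> 0) F" by simp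
    show "\<forall>\<^sub>F s in F. norm (T (g s) (f s) - T (g s) x) \<le> m * norm (f s - x)"
      using ev g0
    proof eventually_elim
      case (elim s)
      then show ?case using m(2)[of "g s" "f s - x"] by (simp add: T_lin)
    qed
  qed auto
  from tendsto_add[OF this 1] show ?thesis by simp
qed

lemma T_joint:
  assumes "continuous_on S f" "continuous_on S g" "\<And>s. s \<in> S \<Longrightarrow> g s \<ge> 0"
  shows "continuous_on S (\<lambda>t. T (g t) (f t))"
  unfolding continuous_on_def using assms
  by (auto intro!: T_tendsto simp: continuous_on_def eventually_at_filter)

lemma T_integral:
  assumes "t \<ge> 0" "continuous_on {a..b::real} f"
  shows "T t (integral {a..b} f) = integral {a..b} (\<lambda>s. T t (f s))"
  using integral_linear[OF integrable_continuous_interval[OF assms(2)] T_bl[OF assms(1)]] by (simp add: o_def)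

end

lemma average_tendsto:
  fixes f :: "real \<Rightarrow> 'b::banach"
  assumes "continuous_on {a..} f"
  shows "((\<lambda>h. (1 / h) *\<^sub>R integral {a..a+h} f) \<longlongrightarrow> f a) (at_right 0)"
proof (rule tendstoI)
  fix e :: real assume e: "e > 0"
  have "(f \<longlongrightarrow> f a) (at a within {a..})" using assms by (auto simp: continuous_on_def)
  then have "\<forall>\<^sub>F t in at a within {a..}. dist (f t) (f a) < e / 2" using e by (intro tendstoD) auto
  then obtain d where d: "d > 0" "\<And>t. t \<in> {a..} \<Longrightarrow> t \<noteq> a \<Longrightarrow> dist t a < d \<Longrightarrow> dist (f t) (f a) < e / 2"
    unfolding eventually_at by auto
  show "\<forall>\<^sub>F h in at_right 0. dist ((1 / h) *\<^sub>R integral {a..a + h} f) (f a) < e"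
    unfolding eventually_at_right_field
  proof (intro exI[of _ d] conjI d(1) allI impI)
    fix h assume h: "0 < h" "h < d"
    have c: "continuous_on {a..a+h} f" using assms by (rule continuous_on_subset) auto
    have "integral {a..a+h} (\<lambda>t. f t - f a) = integral {a..a+h} f - h *\<^sub>R f a"
      using h by (subst integral_diff) (auto intro!: integrable_continuous_interval c)
    moreover have "norm (integral {a..a+h} (\<lambda>t. f t - f a)) \<le> (e / 2) * (a + h - a)"
    proof (rule integral_bound)
      show "continuous_on {a..a+h} (\<lambda>t. f t - f a)" by (intro continuous_intros c)
      show "norm (f t - f a) \<le> e / 2" if "t \<in> {a..a+h}" for t
        using d(2)[of t] that h e by (cases "t = a") (auto simp: dist_norm intro: less_imp_le)
    qed (use h in auto)
    ultimately have *: "norm (integral {a..a+h} f - h *\<^sub>R f a) \<le> (e / 2) * h" by simp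
    have "(1 / h) *\<^sub>R integral {a..a + h} f - f a = (1 / h) *\<^sub>R (integral {a..a+h} f - h *\<^sub>R f a)"
      using h by (simp add: scaleR_diff_right)
    then have "norm ((1 / h) *\<^sub>R integral {a..a + h} f - f a) = (1 / h) * norm (integral {a..a+h} f - h *\<^sub>R f a)"
      using h by (simp only: norm_scaleR) simp
    also have "\<dots> \<le> (1 / h) * ((e / 2) * h)" using * h by (intro mult_left_mono) auto
    finally have "norm ((1 / h) *\<^sub>R integral {a..a + h} f - f a) \<le> e / 2" using h by simp
    then show "dist ((1 / h) *\<^sub>R integral {a..a + h} f) (f a) < e" using e by (simp add: dist_norm)
  qed
qed

lemma integral_shift_interval:
  fixes f :: "real \<Rightarrow> 'b::banach"
  assumes "continuous_on {a+h..b+h} f" "a \<le> b"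
  shows "integral {a..b} (\<lambda>s. f (s + h)) = integral {a+h..b+h} f"
proof -
  have "(f has_integral integral {a+h..b+h} f) (cbox (a+h) (b+h))"
    using assms by (simp add: integrable_integral integrable_continuous_interval)
  from has_integral_affinity[OF this, of 1 h]
  have "((\<lambda>x. f (x + h)) has_integral integral {a+h..b+h} f) ((\<lambda>x. x + (-h)) ` {a+h..b+h})"
    by simp
  also have "(\<lambda>x. x + (-h)) ` {a+h..b+h} = {a..b}"
    by (subst image_add_atLeastAtMost') simp
  finally show ?thesis by (rule integral_unique)
qed

context c0
begin

lemma D_sub: "0 \<in> D" "x \<in> D \<Longrightarrow> y \<in> D \<Longrightarrow> x + y \<in> D" "x \<in> D \<Longrightarrow> z \<odot> x \<in> D"
  and A_add: "x \<in> D \<Longrightarrow> y \<in> D \<Longrightarrow> A (x + y) = A x + A y"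
  and A_cm: "x \<in> D \<Longrightarrow> A (z \<odot> x) = z \<odot> A x"
proof -
  have ev: "\<forall>\<^sub>F t in at_right (0::real). t > 0" by (simp add: eventually_at_right_less)
  have "((\<lambda>t. (1 / t) *\<^sub>R (T t 0 - 0)) \<longlongrightarrow> 0) (at_right 0)"
    by (rule tendsto_eventually) (use ev in eventually_elim, simp add: T_lin)
  then show "0 \<in> D" by (rule DI)
next
  assume x: "x \<in> D" "y \<in> D"
  have "((\<lambda>t. (1 / t) *\<^sub>R (T t (x + y) - (x + y))) \<longlongrightarrow> A x + A y) (at_right 0)"
  proof (rule Lim_transform_eventually[OF tendsto_add[OF A_lim[OF x(1)] A_lim[OF x(2)]]])
    show "\<forall>\<^sub>F t in at_right 0. (1 / t) *\<^sub>R (T t x - x) + (1 / t) *\<^sub>R (T t y - y) = (1 / t) *\<^sub>R (T t (x + y) - (x + y))"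
      using eventually_at_right_less[of "0::real"] by eventually_elim (simp add: T_lin scaleR_diff_right scaleR_add_right)
  qed
  then show "x + y \<in> D" "A (x + y) = A x + A y" using DI by blast+
next
  assume x: "x \<in> D"
  have "((\<lambda>t. (1 / t) *\<^sub>R (T t (z \<odot> x) - (z \<odot> x))) \<longlongrightarrow> z \<odot> A x) (at_right 0)"
  proof (rule Lim_transform_eventually[OF cm_tendsto[OF tendsto_const A_lim[OF x]]])
    show "\<forall>\<^sub>F t in at_right 0. z \<odot> (1 / t) *\<^sub>R (T t x - x) = (1 / t) *\<^sub>R (T t (z \<odot> x) - z \<odot> x)"
      using eventually_at_right_less[of "0::real"] by eventually_elim (simp add: T_lin cm_scaleR_right cm_diff_right)
  qed
  then show "z \<odot> x \<in> D" "A (z \<odot> x) = z \<odot> A x" using DI by blast+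
qed

lemma D_scaleR: "x \<in> D \<Longrightarrow> r *\<^sub>R x \<in> D" and A_scaleR: "x \<in> D \<Longrightarrow> A (r *\<^sub>R x) = r *\<^sub>R A x"
  using D_sub(3)[of x "complex_of_real r"] A_cm[of x "complex_of_real r"] by (auto simp: cm_of_real)

lemma D_diff: "x \<in> D \<Longrightarrow> y \<in> D \<Longrightarrow> x - y \<in> D"
  and A_diff: "x \<in> D \<Longrightarrow> y \<in> D \<Longrightarrow> A (x - y) = A x - A y"
  using D_sub(2)[of x "(-1) *\<^sub>R y"] A_add[of x "(-1) *\<^sub>R y"] D_scaleR[of y "-1"] A_scaleR[of y "-1"] by auto

text \<open>Applying T h shifts the window of integration, so the difference quotient is a
  difference of two averages, over [t, t+h] and over [0, h].\<close>

lemma integral_in_D: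
  assumes "t \<ge> 0"
  shows "integral {0..t} (\<lambda>s. T s x) \<in> D" "A (integral {0..t} (\<lambda>s. T s x)) = T t x - x"
proof -
  have "((\<lambda>h. (1 / h) *\<^sub>R (T h (integral {0..t} (\<lambda>s. T s x)) - integral {0..t} (\<lambda>s. T s x))) \<longlongrightarrow> T t x - T 0 x) (at_right 0)"
  proof (rule Lim_transform_eventually)
    show "((\<lambda>h. (1 / h) *\<^sub>R integral {t..t+h} (\<lambda>s. T s x) - (1 / h) *\<^sub>R integral {0..0+h} (\<lambda>s. T s x)) \<longlongrightarrow> T t x - T 0 x) (at_right 0)"
      using assms by (intro tendsto_diff average_tendsto cont_on) auto
    show "\<forall>\<^sub>F h in at_right 0. (1 / h) *\<^sub>R integral {t..t+h} (\<lambda>s. T s x) - (1 / h) *\<^sub>R integral {0..0+h} (\<lambda>s. T s x)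
      = (1 / h) *\<^sub>R (T h (integral {0..t} (\<lambda>s. T s x)) - integral {0..t} (\<lambda>s. T s x))"
      using eventually_at_right_less[of "0::real"]
    proof eventually_elim
      case (elim h)
      have "T h (integral {0..t} (\<lambda>s. T s x)) = integral {0..t} (\<lambda>s. T h (T s x))"
        using elim assms by (intro T_integral cont_on) auto
      also have "\<dots> = integral {0..t} (\<lambda>s. T (s + h) x)"
        using elim by (intro integral_cong) (simp add: T_add[symmetric] add.commute)
      also have "\<dots> = integral {0+h..t+h} (\<lambda>s. T s x)"
        using elim assms by (intro integral_shift_interval cont_on) auto
      finally have 1: "T h (integral {0..t} (\<lambda>s. T s x)) = integral {h..t+h} (\<lambda>s. T s x)" by simp
      have "integral {0..h} (\<lambda>s. T s x) + integral {h..t+h} (\<lambda>s. T s x) = integral {0..t+h} (\<lambda>s. T s x)"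
        using elim assms by (intro Henstock_Kurzweil_Integration.integral_combine T_int) auto
      moreover have "integral {0..t} (\<lambda>s. T s x) + integral {t..t+h} (\<lambda>s. T s x) = integral {0..t+h} (\<lambda>s. T s x)"
        using elim assms by (intro Henstock_Kurzweil_Integration.integral_combine T_int) auto
      ultimately have "integral {h..t+h} (\<lambda>s. T s x) - integral {0..t} (\<lambda>s. T s x) =
          integral {t..t+h} (\<lambda>s. T s x) - integral {0..h} (\<lambda>s. T s x)"
        by (simp add: algebra_simps)
      then show ?case by (simp add: 1 scaleR_diff_right[symmetric])
    qed
  qed
  then show "integral {0..t} (\<lambda>s. T s x) \<in> D" "A (integral {0..t} (\<lambda>s. T s x)) = T t x - x"
    using DI by auto
qed

text \<open>The difference quotient of the semigroup passes under the integral sign and converges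
  uniformly in s on [0, N]. Weight 1 yields the integral formula for orbits; a cutoff as weight
  yields the resolvent equation in \<open>weighted_energy\<close>.\<close>

lemma weighted_integral_in_D:
  assumes "x \<in> D" "0 \<le> N" "continuous_on {0..N} \<phi>"
  shows "integral {0..N} (\<lambda>s. \<phi> s *\<^sub>R T s x) \<in> D"
    "A (integral {0..N} (\<lambda>s. \<phi> s *\<^sub>R T s x)) = integral {0..N} (\<lambda>s. \<phi> s *\<^sub>R T s (A x))"
proof -
  have cc: "continuous_on {0..N} (\<lambda>s. \<phi> s *\<^sub>R T s y)" for y
    using assms(3) by (intro continuous_intros cont_on) auto
  obtain m where m: "m \<ge> 1" "\<And>t x. t \<in> {0..N} \<Longrightarrow> norm (T t x) \<le> m * norm x" using bounded_on by blast
  obtain c where c: "\<And>t. t \<in> {0..N} \<Longrightarrow> \<bar>\<phi> t\<bar> \<le> c" "c \<ge> 0"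
  proof -
    have "bounded (\<phi> ` {0..N})" using assms(3) by (intro compact_imp_bounded compact_continuous_image) auto
    then obtain c where "\<forall>t\<in>{0..N}. \<bar>\<phi> t\<bar> \<le> c" by (auto simp: bounded_iff)
    then show ?thesis by (intro that[of "max c 0"]) (auto simp: le_max_iff_disj)
  qed
  let ?V = "integral {0..N} (\<lambda>s. \<phi> s *\<^sub>R T s x)" and ?W = "integral {0..N} (\<lambda>s. \<phi> s *\<^sub>R T s (A x))"
  have "((\<lambda>h. (1 / h) *\<^sub>R (T h ?V - ?V) - ?W) \<longlongrightarrow> 0) (at_right 0)"
  proof (rule tendsto_norm_zero_cancel, rule tendsto_sandwich[of "\<lambda>_. 0" _ _
        "\<lambda>h. c * m * norm ((1 / h) *\<^sub>R (T h x - x) - A x) * N"])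
    have "((\<lambda>h. c * m * norm ((1 / h) *\<^sub>R (T h x - x) - A x) * N) \<longlongrightarrow> c * m * norm (A x - A x) * N) (at_right 0)"
      by (intro tendsto_intros A_lim assms(1))
    then show "((\<lambda>h. c * m * norm ((1 / h) *\<^sub>R (T h x - x) - A x) * N) \<longlongrightarrow> 0) (at_right 0)" by simp
    show "\<forall>\<^sub>F h in at_right 0. norm ((1 / h) *\<^sub>R (T h ?V - ?V) - ?W) \<le> c * m * norm ((1 / h) *\<^sub>R (T h x - x) - A x) * N"
      using eventually_at_right_less[of "0::real"]
    proof eventually_elim
      case (elim h)
      have e: "\<phi> s *\<^sub>R T s ((1 / h) *\<^sub>R (T h x - x) - A x) = (1 / h) *\<^sub>R (T h (\<phi> s *\<^sub>R T s x) - \<phi> s *\<^sub>R T s x) - \<phi> s *\<^sub>R T s (A x)"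
        if "s \<in> {0..N}" for s
      proof -
        have "T s (T h x) = T h (T s x)" using T_add[of s h x] T_add[of h s x] that elim by (simp add: add.commute)
        then show ?thesis using that elim by (simp add: T_lin scaleR_diff_right scaleR_left_commute)
      qed
      have cT: "continuous_on {0..N} (\<lambda>s. T h (\<phi> s *\<^sub>R T s x))"
        using bounded_linear.continuous_on[OF T_bl cc] elim by auto
      have "(1 / h) *\<^sub>R (T h ?V - ?V) - ?W
        = integral {0..N} (\<lambda>s. (1 / h) *\<^sub>R (T h (\<phi> s *\<^sub>R T s x) - \<phi> s *\<^sub>R T s x) - \<phi> s *\<^sub>R T s (A x))"
        using elim by (simp add: T_integral[OF _ cc] integral_diff integral_cmul integrable_continuous_interval cT cc
            continuous_intros)
      also have "\<dots> = integral {0..N} (\<lambda>s. \<phi> s *\<^sub>R T s ((1 / h) *\<^sub>R (T h x - x) - A x))"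
        by (intro integral_cong) (simp add: e)
      also have "norm \<dots> \<le> (c * m * norm ((1 / h) *\<^sub>R (T h x - x) - A x)) * (N - 0)"
      proof (rule integral_bound)
        show "norm (\<phi> t *\<^sub>R T t ((1 / h) *\<^sub>R (T h x - x) - A x)) \<le> c * m * norm ((1 / h) *\<^sub>R (T h x - x) - A x)"
          if "t \<in> {0..N}" for t
          using mult_mono[OF c(1)[OF that] m(2)[OF that, of "(1 / h) *\<^sub>R (T h x - x) - A x"]] c(2) by (simp add: mult_ac)
      qed (use assms cc in auto)
      finally show ?case by simp
    qed
  qed auto
  then have "((\<lambda>h. (1 / h) *\<^sub>R (T h ?V - ?V)) \<longlongrightarrow> ?W) (at_right 0)" by (simp add: LIM_zero_iff)
  then show "?V \<in> D" "A ?V = ?W" using DI by auto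
qed

lemma T_diff_integral:
  assumes "x \<in> D" "t \<ge> 0"
  shows "T t x - x = integral {0..t} (\<lambda>s. T s (A x))"
  using weighted_integral_in_D(2)[OF assms(1,2), of "\<lambda>_. 1"] integral_in_D(2)[OF assms(2), of x] by simp

lemma T_deriv:
  assumes "x \<in> D" "t \<ge> 0"
  shows "((\<lambda>t. T t x) has_vector_derivative T t (A x)) (at t within {0..})"
proof -
  have "((\<lambda>u. integral {0..u} (\<lambda>s. T s (A x))) has_vector_derivative T t (A x)) (at t within {0..t+1})"
    using assms by (intro integral_has_vector_derivative cont_on) auto
  then have "((\<lambda>u. x + integral {0..u} (\<lambda>s. T s (A x))) has_vector_derivative T t (A x)) (at t within {0..t+1})"
    by (auto intro!: derivative_eq_intros)
  then have "((\<lambda>u. T u x) has_vector_derivative T t (A x)) (at t within {0..t+1})"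
    by (rule has_vector_derivative_transform[rotated 2])
       (use assms in \<open>auto simp: T_diff_integral[OF assms(1), symmetric]\<close>)
  moreover have "at t within {0..t+1} = at t within {0..}"
    by (rule at_within_nhd[of _ "{..<t+1}"]) (use assms in auto)
  ultimately show ?thesis by (simp add: has_vector_derivative_def)
qed

lemma T_in_D:
  assumes "x \<in> D" "t \<ge> 0"
  shows "T t x \<in> D" "A (T t x) = T t (A x)"
proof -
  interpret bounded_linear "T t" by (rule T_bl[OF assms(2)])
  have "((\<lambda>h. (1 / h) *\<^sub>R (T h (T t x) - T t x)) \<longlongrightarrow> T t (A x)) (at_right 0)"
  proof (rule Lim_transform_eventually[OF tendsto[OF A_lim[OF assms(1)]]])
    show "\<forall>\<^sub>F h in at_right 0. T t ((1 / h) *\<^sub>R (T h x - x)) = (1 / h) *\<^sub>R (T h (T t x) - T t x)"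
      using eventually_at_right_less[of "0::real"]
    proof eventually_elim
      case (elim h)
      then show ?case using T_add[of t h x] T_add[of h t x] assms by (simp add: T_lin add.commute)
    qed
  qed
  then show "T t x \<in> D" "A (T t x) = T t (A x)" using DI by auto
qed

text \<open>In the integral formula of \<open>T_diff_integral\<close> the operator A enters only
  through \<open>A (x n)\<close>, which may be replaced by its limit v. The resulting identity for u
  is then differentiated at 0.\<close>

lemma A_closed:
  assumes "\<And>n. x n \<in> D" "x \<longlonglongrightarrow> u" "(\<lambda>n. A (x n)) \<longlonglongrightarrow> v"
  shows "u \<in> D" "A u = v"
proof -
  have "T t u - u = integral {0..t} (\<lambda>s. T s v)" if t: "t \<ge> 0" for t
  proof -
    interpret bounded_linear "T t" by (rule T_bl[OF t])
    obtain m where m: "m \<ge> 1" "\<And>s x. s \<in> {0..t} \<Longrightarrow> norm (T s x) \<le> m * norm x" using bounded_on by blast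
    have "(\<lambda>n. integral {0..t} (\<lambda>s. T s (A (x n)))) \<longlonglongrightarrow> integral {0..t} (\<lambda>s. T s v)"
    proof (rule Lim_null_comparison[THEN LIM_zero_cancel])
      show "(\<lambda>n. m * norm (A (x n) - v) * (t - 0)) \<longlonglongrightarrow> 0"
        using tendsto_mult_right_zero[OF tendsto_norm_zero[OF LIM_zero[OF assms(3)]]]
        by (intro tendsto_mult_left_zero tendsto_mult_right_zero tendsto_norm_zero LIM_zero assms(3))
      show "\<forall>\<^sub>F n in sequentially. norm (integral {0..t} (\<lambda>s. T s (A (x n))) - integral {0..t} (\<lambda>s. T s v)) \<le> m * norm (A (x n) - v) * (t - 0)"
      proof (intro always_eventually allI)
        fix n
        have "integral {0..t} (\<lambda>s. T s (A (x n))) - integral {0..t} (\<lambda>s. T s v) = integral {0..t} (\<lambda>s. T s (A (x n) - v))"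
          by (subst integral_diff[symmetric]) (auto intro!: T_int integral_cong simp: T_lin)
        also have "norm \<dots> \<le> m * norm (A (x n) - v) * (t - 0)"
          using m t by (intro integral_bound cont_on) auto
        finally show "norm (integral {0..t} (\<lambda>s. T s (A (x n))) - integral {0..t} (\<lambda>s. T s v)) \<le> m * norm (A (x n) - v) * (t - 0)" .
      qed
    qed
    moreover have "(\<lambda>n. T t (x n) - x n) \<longlonglongrightarrow> T t u - u" by (intro tendsto_diff tendsto assms(2))
    ultimately show ?thesis using T_diff_integral[OF assms(1) t] LIMSEQ_unique by auto
  qed
  then have "((\<lambda>h. (1 / h) *\<^sub>R (T h u - u)) \<longlongrightarrow> T 0 v) (at_right 0)"
    using average_tendsto[OF cont, of v]
    by (elim Lim_transform_eventually) (use eventually_at_right_less[of "0::real"] in eventually_elim, simp)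
  then show "u \<in> D" "A u = v" using DI by auto
qed

lemma D_dense: "\<exists>y. (\<forall>n. y n \<in> D) \<and> y \<longlonglongrightarrow> x"
proof -
  define y where "y n = (1 / (1 / real (Suc n))) *\<^sub>R integral {0..1 / real (Suc n)} (\<lambda>s. T s x)" for n
  have "y n \<in> D" for n
    unfolding y_def by (intro D_scaleR integral_in_D) auto
  moreover have "y \<longlonglongrightarrow> T 0 x"
  proof -
    have "filterlim (\<lambda>n. 1 / real (Suc n)) (at_right 0) sequentially"
      using LIMSEQ_inverse_real_of_nat unfolding filterlim_at by (simp add: inverse_eq_divide)
    from filterlim_compose[OF average_tendsto[OF cont[of x]] this] show ?thesis by (simp add: y_def[abs_def])
  qed
  ultimately show ?thesis by auto
qed

end

section \<open>Exponential rescaling, and solving the stationary equation by time integrals\<close>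

context cstruct
begin

lemma exp_quotient_tendsto: "((\<lambda>t. (exp (- ((z::complex) * of_real t)) - 1) / of_real t) \<longlongrightarrow> - z) (at_right 0)"
proof -
  have "((\<lambda>w. exp (- (z * w))) has_field_derivative - z) (at 0)"
    by (auto intro!: derivative_eq_intros)
  then have "((\<lambda>w. (exp (- (z * w)) - 1) / w) \<longlongrightarrow> - z) (at 0)"
    by (simp add: DERIV_def)
  moreover have "filterlim complex_of_real (at 0) (at_right 0)"
    unfolding filterlim_at using eventually_at_right_less[of "0::real"]
    by (auto intro!: tendsto_eq_intros elim: eventually_mono)
  ultimately show ?thesis by (rule filterlim_compose)
qed

lemma rescale_tendsto:
  assumes "((\<lambda>t. (1 / t) *\<^sub>R (g t - x)) \<longlongrightarrow> y) (at_right 0)"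
  shows "((\<lambda>t. (1 / t) *\<^sub>R (exp (- (z * of_real t)) \<odot> g t - x)) \<longlongrightarrow> y - z \<odot> x) (at_right 0)"
proof -
  have "((\<lambda>t. exp (- (z * of_real t))) \<longlongrightarrow> exp (- (z * of_real 0))) (at_right (0::real))"
    by (intro tendsto_intros)
  then have "((\<lambda>t. exp (- (z * of_real t)) \<odot> (1 / t) *\<^sub>R (g t - x) + ((exp (- (z * of_real t)) - 1) / of_real t) \<odot> x) \<longlongrightarrow>
     exp (- (z * of_real 0)) \<odot> y + (- z) \<odot> x) (at_right 0)"
    by (intro tendsto_add cm_tendsto exp_quotient_tendsto assms tendsto_const)
  then have "((\<lambda>t. exp (- (z * of_real t)) \<odot> (1 / t) *\<^sub>R (g t - x) + ((exp (- (z * of_real t)) - 1) / of_real t) \<odot> x) \<longlongrightarrow>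
     y - z \<odot> x) (at_right 0)" by (simp add: cm_minus_left)
  then show ?thesis
  proof (rule Lim_transform_eventually)
    show "\<forall>\<^sub>F t in at_right 0. exp (- (z * of_real t)) \<odot> (1 / t) *\<^sub>R (g t - x) + ((exp (- (z * of_real t)) - 1) / of_real t) \<odot> x
       = (1 / t) *\<^sub>R (exp (- (z * of_real t)) \<odot> g t - x)"
      using eventually_at_right_less[of "0::real"]
    proof eventually_elim
      case (elim t)
      have "((exp (- (z * of_real t)) - 1) / of_real t) = (1/t) *\<^sub>R (exp (- (z * of_real t)) - 1)"
        by (simp add: scaleR_conv_of_real)
      then show ?case by (simp only: cm_scaleR_left cm_scaleR_right cm_diff_left cm_diff_right cm_one) (simp add: algebra_simps)
    qed
  qed
qed

end

context c0
begin

text \<open>Moves the spectral parameter to 0: facts about \<open>z - A\<close> become facts about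
  the generator of the rescaled semigroup, whose domain is unchanged.\<close>

lemma rescale: "c0 J (\<lambda>t x. exp (- (z * of_real t)) \<odot> T t x) D (\<lambda>x. A x - z \<odot> x)"
proof (intro c0.intro c0_axioms.intro cstruct_axioms)
  show "C0_semigroup J (\<lambda>t x. exp (- (z * of_real t)) \<odot> T t x)"
    unfolding C0_semigroup_def
  proof (intro conjI allI impI)
    show "cbounded J (\<lambda>x. exp (- (z * of_real t)) \<odot> T t x)" if "t \<ge> 0" for t
      unfolding cbounded_def using that
      by (auto simp: T_lin cm_J intro!: bounded_linear_compose[OF cm.bounded_linear_right] T_bl)
    show "((\<lambda>x. exp (- (z * of_real (t + s))) \<odot> T (t + s) x)) = (\<lambda>x. exp (- (z * of_real t)) \<odot> T t x) \<circ> (\<lambda>x. exp (- (z * of_real s)) \<odot> T s x)"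
      if "t \<ge> 0" "s \<ge> 0" for t s
    proof
      fix x
      have "exp (- (z * of_real (t + s))) = exp (- (z * of_real t)) * exp (- (z * of_real s))"
        by (simp add: exp_add[symmetric] algebra_simps)
      then show "exp (- (z * of_real (t + s))) \<odot> T (t + s) x = ((\<lambda>x. exp (- (z * of_real t)) \<odot> T t x) \<circ> (\<lambda>x. exp (- (z * of_real s)) \<odot> T s x)) x"
        using that by (simp add: T_lin T_add)
    qed
    have "((\<lambda>t. exp (- (z * of_real t)) \<odot> T t x) \<longlongrightarrow> exp (- (z * of_real 0)) \<odot> x) (at_right 0)" for x
      by (intro tendsto_intros T_right)
    then show "((\<lambda>t. exp (- (z * of_real t)) \<odot> T t x) \<longlongrightarrow> x) (at_right 0)" for x by simp
  qed auto
  show "generator (\<lambda>t x. exp (- (z * of_real t)) \<odot> T t x) D (\<lambda>x. A x - z \<odot> x)"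
    unfolding generator_def
  proof (intro conjI ballI)
    show r: "((\<lambda>t. (1 / t) *\<^sub>R (exp (- (z * of_real t)) \<odot> T t x - x)) \<longlongrightarrow> A x - z \<odot> x) (at_right 0)" if "x \<in> D" for x
      by (intro rescale_tendsto A_lim that)
    have "x \<in> D" if "((\<lambda>t. (1 / t) *\<^sub>R (exp (- (z * of_real t)) \<odot> T t x - x)) \<longlongrightarrow> y) (at_right 0)" for x y
      using DI(1)[of x "y - (-z) \<odot> x"] rescale_tendsto[OF that, of "-z"] by (simp add: exp_add[symmetric])
    then show "D = {x. \<exists>y. ((\<lambda>t. (1 / t) *\<^sub>R (exp (- (z * of_real t)) \<odot> T t x - x)) \<longlongrightarrow> y) (at_right 0)}"
      using r by auto
  qed
qed

text \<open>After rescaling, the eigenvector lies in the kernel of the generator, so its rescaled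
  orbit is constant.\<close>

lemma eigenvector_semigroup:
  assumes "x \<in> D" "A x = z \<odot> x" "t \<ge> 0"
  shows "T t x = exp (z * of_real t) \<odot> x"
proof -
  interpret r: c0 J "\<lambda>t x. exp (- (z * of_real t)) \<odot> T t x" D "\<lambda>x. A x - z \<odot> x" by (rule rescale)
  have "exp (- (z * of_real t)) \<odot> T t x - x = integral {0..t} (\<lambda>s. exp (- (z * of_real s)) \<odot> T s (A x - z \<odot> x))"
    by (rule r.T_diff_integral[OF assms(1,3)])
  also have "\<dots> = integral {0..t} (\<lambda>s. 0)" using assms by (intro integral_cong) (simp add: T_lin)
  finally have "exp (z * of_real t) \<odot> exp (- (z * of_real t)) \<odot> T t x = exp (z * of_real t) \<odot> x" by simp
  then show ?thesis by (simp add: exp_add[symmetric])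
qed

lemma integral_decay:
  assumes "\<And>t. t \<ge> 0 \<Longrightarrow> norm (T t x) \<le> c * exp (- \<epsilon> * t)" "\<epsilon> > 0" "0 \<le> p" "p \<le> q"
  shows "norm (integral {p..q} (\<lambda>t. T t x)) \<le> c / \<epsilon> * exp (- \<epsilon> * p)"
proof -
  have c: "c \<ge> 0" using assms(1)[of 0] norm_ge_zero[of x] by (simp del: norm_ge_zero)
  have "((\<lambda>t. c * exp (- \<epsilon> * t)) has_integral (- (c / \<epsilon>) * exp (- \<epsilon> * q) - (- (c / \<epsilon>) * exp (- \<epsilon> * p)))) {p..q}"
    using assms(2,4) by (intro fundamental_theorem_of_calculus)
      (auto intro!: derivative_eq_intros simp: has_real_derivative_iff_has_vector_derivative[symmetric])
  note hi = this
  have "norm (integral {p..q} (\<lambda>t. T t x)) \<le> integral {p..q} (\<lambda>t. c * exp (- \<epsilon> * t))"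
    using assms by (intro integral_norm_bound_integral T_int has_integral_integrable[OF hi]) auto
  also have "\<dots> = - (c / \<epsilon>) * exp (- \<epsilon> * q) - (- (c / \<epsilon>) * exp (- \<epsilon> * p))"
    by (rule integral_unique[OF hi])
  also have "\<dots> \<le> c / \<epsilon> * exp (- \<epsilon> * p)" using c assms(2) by simp
  finally show ?thesis by simp
qed

text \<open>u is the improper integral of the orbit. The convergence of the truncated integrals is
  exported because it later shows that a bounded operator annihilating the orbit also annihilates
  u.\<close>

lemma decay_solution:
  assumes decay: "\<And>t. t \<ge> 0 \<Longrightarrow> norm (T t x) \<le> c * exp (- \<epsilon> * t)" and e: "\<epsilon> > 0"
  obtains u where "u \<in> D" "A u = - x" "norm u \<le> c / \<epsilon>" "(\<lambda>n::nat. integral {0..real n} (\<lambda>t. T t x)) \<longlonglongrightarrow> u"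
proof -
  define I where "I n = integral {0..real n} (\<lambda>t. T t x)" for n :: nat
  have c: "c \<ge> 0" using decay[of 0] norm_ge_zero[of x] by (simp del: norm_ge_zero)
  have lim0: "(\<lambda>n::nat. k * exp (- \<epsilon> * real n)) \<longlonglongrightarrow> 0" for k
  proof -
    have "(\<lambda>n. exp (- \<epsilon>) ^ n) \<longlonglongrightarrow> 0" using e by (intro LIMSEQ_power_zero) auto
    then show ?thesis by (intro tendsto_mult_right_zero) (simp add: exp_of_nat_mult[symmetric] mult_ac)
  qed
  have diff: "norm (I m - I n) \<le> c / \<epsilon> * exp (- \<epsilon> * real n)" if "n \<le> m" for m n
  proof -
    have "I n + integral {real n..real m} (\<lambda>t. T t x) = I m"
      unfolding I_def using that by (intro Henstock_Kurzweil_Integration.integral_combine T_int) auto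
    then have "I m - I n = integral {real n..real m} (\<lambda>t. T t x)" by (simp add: algebra_simps)
    then show ?thesis using integral_decay[OF decay e] that by simp
  qed
  have "Cauchy I"
  proof (rule CauchyI)
    fix e' :: real assume "e' > 0"
    then obtain N where N: "c / \<epsilon> * exp (- \<epsilon> * real N) < e' / 2"
      using order_tendstoD(2)[OF lim0[of "c / \<epsilon>"], of "e'/2"] unfolding eventually_sequentially by auto
    show "\<exists>M. \<forall>m\<ge>M. \<forall>n\<ge>M. norm (I m - I n) < e'"
    proof (intro exI[of _ N] allI impI)
      fix m n assume mn: "m \<ge> N" "n \<ge> N"
      have "norm (I m - I n) \<le> norm (I m - I N) + norm (I n - I N)"
        using norm_triangle_ineq4[of "I m - I N" "I n - I N"] by simp
      then show "norm (I m - I n) < e'" using diff[OF mn(1)] diff[OF mn(2)] N by linarith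
    qed
  qed
  then obtain u where u: "I \<longlonglongrightarrow> u" using convergent_eq_Cauchy[of I] by blast
  have "(\<lambda>n. T (real n) x) \<longlonglongrightarrow> 0"
    by (rule Lim_null_comparison[OF _ lim0[of c]]) (use decay in auto)
  then have "(\<lambda>n. T (real n) x - x) \<longlonglongrightarrow> 0 - x" by (intro tendsto_intros)
  then have "(\<lambda>n. A (I n)) \<longlonglongrightarrow> - x" unfolding I_def by (simp add: integral_in_D)
  then have "u \<in> D" "A u = - x" using A_closed[OF _ u] integral_in_D(1) by (auto simp: I_def)
  moreover have "norm u \<le> c / \<epsilon>"
  proof (rule tendsto_upperbound[OF tendsto_norm[OF u]])
    show "\<forall>\<^sub>F n in sequentially. norm (I n) \<le> c / \<epsilon>"
      using integral_decay[OF decay e, of 0] by (auto simp: I_def)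
  qed auto
  ultimately show ?thesis using that u by (auto simp: I_def[abs_def])
qed

end


section \<open>Bounded perturbations of semigroups\<close>

lemma has_vector_derivative_quotient_iff:
  "(f has_vector_derivative D) (at s within S) \<longleftrightarrow> ((\<lambda>r. (1 / (r - s)) *\<^sub>R (f r - f s)) \<longlongrightarrow> D) (at s within S)"
proof -
  have "((\<lambda>r. (1 / norm (r - s)) *\<^sub>R (f r - (f s + (r - s) *\<^sub>R D))) \<longlongrightarrow> 0) (at s within S) \<longleftrightarrow>
     ((\<lambda>r. norm ((1 / norm (r - s)) *\<^sub>R (f r - (f s + (r - s) *\<^sub>R D)))) \<longlongrightarrow> 0) (at s within S)"
    by (rule tendsto_norm_zero_iff[symmetric])
  also have "\<dots> \<longleftrightarrow> ((\<lambda>r. norm ((1 / (r - s)) *\<^sub>R (f r - f s) - D)) \<longlongrightarrow> 0) (at s within S)"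
  proof (rule filterlim_cong[OF refl refl])
    show "\<forall>\<^sub>F r in at s within S. norm ((1 / norm (r - s)) *\<^sub>R (f r - (f s + (r - s) *\<^sub>R D))) = norm ((1 / (r - s)) *\<^sub>R (f r - f s) - D)"
      unfolding eventually_at_filter
    proof (intro always_eventually allI impI)
      fix r assume "r \<noteq> s"
      then have "(1 / (r - s)) *\<^sub>R (f r - f s) - D = (1 / (r - s)) *\<^sub>R (f r - (f s + (r - s) *\<^sub>R D))"
        by (simp add: scaleR_diff_right scaleR_add_right)
      then show "norm ((1 / norm (r - s)) *\<^sub>R (f r - (f s + (r - s) *\<^sub>R D))) = norm ((1 / (r - s)) *\<^sub>R (f r - f s) - D)" by simp
    qed
  qed
  also have "\<dots> \<longleftrightarrow> ((\<lambda>r. (1 / (r - s)) *\<^sub>R (f r - f s)) \<longlongrightarrow> D) (at s within S)"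
    by (simp add: tendsto_norm_zero_iff LIM_zero_iff)
  finally show ?thesis
    by (simp add: has_vector_derivative_def has_derivative_within bounded_linear_scaleR_left)
qed

lemma gronwall:
  fixes u :: "real \<Rightarrow> real"
  assumes cont: "continuous_on {0..T} u" and L: "L > 0"
    and u: "\<And>t. t \<in> {0..T} \<Longrightarrow> u t \<le> a + L * integral {0..t} u" and T: "0 \<le> T"
  shows "u T \<le> a * exp (L * T)"
proof -
  \<comment> \<open>The integrating factor makes g nonincreasing; comparing its values at 0 and T
    and using the hypothesis once more at T gives the bound.\<close>
  define g where "g t = exp (- L * t) * (a + L * integral {0..t} u)" for t
  have cI: "continuous_on {0..T} (\<lambda>t. integral {0..t} u)"
    by (intro indefinite_integral_continuous_1 integrable_continuous_interval cont)
  have "g T \<le> g 0"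
  proof (rule DERIV_nonpos_imp_decreasing_open[OF T])
    fix t assume t: "0 < t" "t < T"
    have "((\<lambda>t. integral {0..t} u) has_vector_derivative u t) (at t within {0..T})"
      using t by (intro integral_has_vector_derivative cont) auto
    moreover have "at t within {0..T} = at t" by (rule at_within_interior) (use t in simp)
    ultimately have "((\<lambda>t. integral {0..t} u) has_real_derivative u t) (at t)"
      by (simp only: has_real_derivative_iff_has_vector_derivative)
    then have "((\<lambda>t. a + L * integral {0..t} u) has_real_derivative 0 + L * u t) (at t)"
      by (intro DERIV_add DERIV_cmult DERIV_const)
    moreover have "((\<lambda>t. exp (- L * t)) has_real_derivative (- L * exp (- L * t))) (at t)"
      by (auto intro!: derivative_eq_intros)
    ultimately have "(g has_real_derivative (exp (- L * t) * (L * u t) + (- L * exp (- L * t)) * (a + L * integral {0..t} u))) (at t)"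
      unfolding g_def using DERIV_mult[of "\<lambda>t. exp (- L * t)" "- L * exp (- L * t)" t UNIV "\<lambda>t. a + L * integral {0..t} u" "0 + L * u t"]
      by (simp only: add_0_left add.commute mult.commute)
    moreover have "exp (- L * t) * (L * u t) + (- L * exp (- L * t)) * (a + L * integral {0..t} u)
      = L * exp (- L * t) * (u t - (a + L * integral {0..t} u))" by (simp add: algebra_simps)
    moreover have "\<dots> \<le> 0" using u[of t] t L by (intro mult_nonneg_nonpos) auto
    ultimately show "\<exists>y. DERIV g t :> y \<and> y \<le> 0" by metis
  next
    show "continuous_on {0..T} g" unfolding g_def by (intro continuous_intros cI)
  qed
  then have "exp (- L * T) * (a + L * integral {0..T} u) \<le> a" by (simp add: g_def)
  then have "exp (L * T) * (exp (- L * T) * (a + L * integral {0..T} u)) \<le> exp (L * T) * a" by (intro mult_left_mono) auto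
  then have "a + L * integral {0..T} u \<le> exp (L * T) * a"
    by (simp add: mult.assoc[symmetric] exp_add[symmetric])
  then show ?thesis using u[of T] T by (simp add: mult.commute)
qed

context c0
begin

text \<open>A product rule with a factor that is only strongly continuous: the increment of y stays
  under the moving operator and is handled by \<open>T_tendsto\<close>, while the increment of the
  operator acts on the fixed vector \<open>y s\<close>. This is why only \<open>y s\<close> has to
  lie in the domain.\<close>

lemma T_product_deriv:
  assumes y: "(y has_vector_derivative y') (at s within {0..t})" and s: "s \<in> {0..t}" and D: "y s \<in> D"
  shows "((\<lambda>r. T (t - r) (y r)) has_vector_derivative (T (t - s) y' - T (t - s) (A (y s)))) (at s within {0..t})"
  unfolding has_vector_derivative_quotient_iff
proof (rule Lim_transform_eventually)
  have "((\<lambda>r. T r (y s)) has_vector_derivative T (t - s) (A (y s))) (at (t - s) within (-) t ` {0..t})"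
    by (rule has_vector_derivative_within_subset[OF T_deriv]) (use D s in auto)
  then have "(((\<lambda>r. T r (y s)) \<circ> (-) t) has_vector_derivative ((- 1) *\<^sub>R T (t - s) (A (y s)))) (at s within {0..t})"
    by (intro vector_diff_chain_within) (auto intro!: derivative_eq_intros)
  then have 1: "((\<lambda>r. (1 / (r - s)) *\<^sub>R (T (t - r) (y s) - T (t - s) (y s))) \<longlongrightarrow> - T (t - s) (A (y s))) (at s within {0..t})"
    unfolding has_vector_derivative_quotient_iff by simp
  have 2: "((\<lambda>r. T (t - r) ((1 / (r - s)) *\<^sub>R (y r - y s))) \<longlongrightarrow> T (t - s) y') (at s within {0..t})"
    using y s unfolding has_vector_derivative_quotient_iff
    by (intro T_tendsto) (auto intro!: tendsto_eq_intros simp: eventually_at_filter)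
  show "((\<lambda>r. T (t - r) ((1 / (r - s)) *\<^sub>R (y r - y s)) + (1 / (r - s)) *\<^sub>R (T (t - r) (y s) - T (t - s) (y s))) \<longlongrightarrow>
     T (t - s) y' - T (t - s) (A (y s))) (at s within {0..t})"
    using tendsto_add[OF 2 1] by simp
  show "\<forall>\<^sub>F r in at s within {0..t}. T (t - r) ((1 / (r - s)) *\<^sub>R (y r - y s)) + (1 / (r - s)) *\<^sub>R (T (t - r) (y s) - T (t - s) (y s))
    = (1 / (r - s)) *\<^sub>R (T (t - r) (y r) - T (t - s) (y s))"
    unfolding eventually_at_filter
    by (intro always_eventually allI impI) (simp add: T_lin scaleR_diff_right)
qed

end

locale c0_perturb = c0 J T D A + U: c0 J U D "\<lambda>x. A x + K x"
  for J :: "'a::{banach,real_inner} \<Rightarrow> 'a" and T D A U K +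
  assumes K: "cbounded J K"
begin

sublocale K: bounded_linear K using cboundedD(1)[OF K] .

text \<open>Both generators have the same domain, so \<open>U s x\<close> stays where A acts, and
  the unbounded terms cancel in the derivative of \<open>T (t - s) (U s x)\<close>. Integrate over
  [0, t].\<close>

lemma duhamel:
  assumes "x \<in> D" "t \<ge> 0"
  shows "U t x = T t x + integral {0..t} (\<lambda>s. T (t - s) (K (U s x)))"
proof -
  have "((\<lambda>s. T (t - s) (K (U s x))) has_integral (T (t - t) (U t x) - T (t - 0) (U 0 x))) {0..t}"
  proof (rule fundamental_theorem_of_calculus[OF assms(2)])
    fix s assume s: "s \<in> {0..t}"
    have "((\<lambda>s. U s x) has_vector_derivative U s (A x + K x)) (at s within {0..t})"
      by (rule has_vector_derivative_within_subset[OF U.T_deriv]) (use assms s in auto)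
    from T_product_deriv[OF this s] U.T_in_D[OF assms(1), of s] s
    have "((\<lambda>r. T (t - r) (U r x)) has_vector_derivative (T (t - s) (U s (A x + K x)) - T (t - s) (A (U s x)))) (at s within {0..t})"
      by simp
    also have "T (t - s) (U s (A x + K x)) - T (t - s) (A (U s x)) = T (t - s) (K (U s x))"
    proof -
      have "U s (A x + K x) - A (U s x) = K (U s x)"
        using U.T_in_D(2)[OF assms(1), of s] s by (metis add_diff_cancel_left' atLeastAtMost_iff)
      then show ?thesis using s by (simp add: T_lin[symmetric])
    qed
    finally show "((\<lambda>r. T (t - r) (U r x)) has_vector_derivative T (t - s) (K (U s x))) (at s within {0..t})" .
  qed
  from integral_unique[OF this] show ?thesis by simp
qed

text \<open>Gronwall for \<open>exp (- w * s) * norm (U s x)\<close> in the Duhamel formula, first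
  on the domain and then by density. The rate depends on K only through k, so it can be shared by a
  whole family.\<close>

lemma perturbed_growth:
  assumes T: "\<And>t x. t \<ge> 0 \<Longrightarrow> norm (T t x) \<le> M * exp (w * t) * norm x" and M: "M \<ge> 1"
    and Kk: "\<And>x. norm (K x) \<le> k * norm x" and k: "k > 0" and t: "t \<ge> 0"
  shows "norm (U t x) \<le> M * exp ((w + M * k) * t) * norm x"
proof -
  have *: "norm (U t x) \<le> M * exp ((w + M * k) * t) * norm x" if x: "x \<in> D" for x
  proof -
    define u where "u s = exp (- w * s) * norm (U s x)" for s
    have cu: "continuous_on {0..N} u" for N unfolding u_def by (intro continuous_intros U.cont_on) auto
    have "u t \<le> (M * norm x) * exp ((M * k) * t)"
    proof (rule gronwall)
      fix s assume s: "s \<in> {0..t}"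
      have c1: "continuous_on {0..s} (\<lambda>r. T (s - r) (K (U r x)))"
        using s by (intro T_joint K.continuous_on U.cont_on continuous_intros) auto
      have c2: "continuous_on {0..s} (\<lambda>r. M * exp (w * (s - r)) * (k * norm (U r x)))"
        by (intro continuous_intros U.cont_on) auto
      have "norm (integral {0..s} (\<lambda>r. T (s - r) (K (U r x)))) \<le> integral {0..s} (\<lambda>r. M * exp (w * (s - r)) * (k * norm (U r x)))"
      proof (rule integral_norm_bound_integral)
        fix r assume r: "r \<in> {0..s}"
        have "norm (T (s - r) (K (U r x))) \<le> M * exp (w * (s - r)) * norm (K (U r x))" using T r by auto
        also have "\<dots> \<le> M * exp (w * (s - r)) * (k * norm (U r x))" using M Kk by (intro mult_left_mono) auto
        finally show "norm (T (s - r) (K (U r x))) \<le> M * exp (w * (s - r)) * (k * norm (U r x))" .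
      qed (intro integrable_continuous_interval c1 c2)+
      also have "\<dots> = integral {0..s} (\<lambda>r. exp (w * s) * (M * k) * u r)"
        by (intro integral_cong) (simp add: u_def exp_diff exp_minus field_simps)
      also have "\<dots> = exp (w * s) * (M * k) * integral {0..s} u" by simp
      finally have i: "norm (integral {0..s} (\<lambda>r. T (s - r) (K (U r x)))) \<le> exp (w * s) * (M * k) * integral {0..s} u" .
      have "norm (U s x) \<le> norm (T s x) + norm (integral {0..s} (\<lambda>r. T (s - r) (K (U r x))))"
        using duhamel[OF x, of s] s norm_triangle_ineq by auto
      also have "\<dots> \<le> M * exp (w * s) * norm x + exp (w * s) * (M * k) * integral {0..s} u"
        using T[of s x] s i by (intro add_mono) auto
      finally have "exp (- w * s) * norm (U s x) \<le> exp (- w * s) * (M * exp (w * s) * norm x + exp (w * s) * (M * k) * integral {0..s} u)"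
        by (intro mult_left_mono) auto
      then show "u s \<le> M * norm x + M * k * integral {0..s} u"
        by (simp add: u_def exp_minus field_simps)
    qed (use cu M k t in auto)
    then have "exp (w * t) * u t \<le> exp (w * t) * ((M * norm x) * exp ((M * k) * t))" by (intro mult_left_mono) auto
    then show ?thesis by (simp add: u_def exp_add exp_minus algebra_simps)
  qed
  obtain y where y: "\<And>n. y n \<in> D" "y \<longlonglongrightarrow> x" using D_dense by blast
  interpret Ut: bounded_linear "U t" by (rule U.T_bl[OF t])
  show ?thesis
  proof (rule tendsto_le)
    show "(\<lambda>n. norm (U t (y n))) \<longlonglongrightarrow> norm (U t x)" by (intro tendsto_norm Ut.tendsto y)
    show "(\<lambda>n. M * exp ((w + M * k) * t) * norm (y n)) \<longlonglongrightarrow> M * exp ((w + M * k) * t) * norm x" by (intro tendsto_intros y)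
  qed (use * y in auto)
qed

end


section \<open>Resolvents\<close>

text \<open>Applied to resolvents, such functionals give complex-valued functions of z, for which
  holomorphy, residues and meromorphy are available.\<close>

definition clin :: "('a::{banach,real_inner} \<Rightarrow> 'a) \<Rightarrow> ('a \<Rightarrow> complex) \<Rightarrow> bool" where
  "clin J f \<longleftrightarrow> bounded_linear f \<and> (\<forall>x. f (J x) = \<i> * f x)"

context cstruct
begin

lemma clinD: assumes "clin J f"
  shows "bounded_linear f" "f (z \<odot> x) = z * f x" "f (x + y) = f x + f y" "f (x - y) = f x - f y" "f 0 = 0"
proof -
  show b: "bounded_linear f" using assms by (auto simp: clin_def)
  interpret f: bounded_linear f by (rule b)
  show "f (x + y) = f x + f y" "f (x - y) = f x - f y" "f 0 = 0" by (simp_all add: f.add f.diff f.zero)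
  show "f (z \<odot> x) = z * f x" using assms
    by (simp add: cmul_def f.add f.scaleR clin_def complex_eq_iff algebra_simps)
qed

text \<open>The complex inner product belonging to J, linear in x and antilinear in y.\<close>

definition cin :: "'a \<Rightarrow> 'a \<Rightarrow> complex" where "cin y x = Complex (inner x y) (inner x (J y))"

lemma cin_clin: "clin J (cin y)"
proof -
  have "cin y = (\<lambda>x. of_real (inner x y) + \<i> * of_real (inner x (J y)))"
    by (auto simp: cin_def complex_eq_iff)
  moreover have "bounded_linear (\<lambda>x. complex_of_real (inner x y) + \<i> * of_real (inner x (J y)))"
    by (intro bounded_linear_add bounded_linear_compose[OF bounded_linear_of_real] 
        bounded_linear_compose[OF bounded_linear_mult_right] bounded_linear_inner_left)
  moreover have "cin y (J x) = \<i> * cin y x" for x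
    using inner_J_right[of x y] by (simp add: cin_def complex_eq_iff)
  ultimately show ?thesis by (simp add: clin_def)
qed

lemma cin_sym: "cin x y = cnj (cin y x)"
  using inner_J_right[of y x] by (simp add: cin_def complex_eq_iff inner_commute)

lemma cin_self: "cin x x = of_real ((norm x)\<^sup>2)"
  by (simp add: cin_def complex_eq_iff power2_norm_eq_inner)

lemma cin_eqI: assumes "\<And>y. cin y x = cin y x'" shows "x = x'"
proof -
  have "cin (x - x') (x - x') = 0" using assms[of "x - x'"] clinD(4)[OF cin_clin] by simp
  then show ?thesis by (simp add: cin_self)
qed

end

locale coper = cstruct J for J :: "'a::{banach,real_inner} \<Rightarrow> 'a" +
  fixes D :: "'a set" and A :: "'a \<Rightarrow> 'a"
  assumes D_zero: "0 \<in> D" and D_add: "x \<in> D \<Longrightarrow> y \<in> D \<Longrightarrow> x + y \<in> D" and D_cm: "x \<in> D \<Longrightarrow> z \<odot> x \<in> D"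
    and A_add: "x \<in> D \<Longrightarrow> y \<in> D \<Longrightarrow> A (x + y) = A x + A y" and A_cm: "x \<in> D \<Longrightarrow> A (z \<odot> x) = z \<odot> A x"
begin

abbreviation "\<rho> \<equiv> resolvent_set J D A"
abbreviation "R \<equiv> resolvent J D A"

lemma D_diff: "x \<in> D \<Longrightarrow> y \<in> D \<Longrightarrow> x - y \<in> D" and A_diff: "x \<in> D \<Longrightarrow> y \<in> D \<Longrightarrow> A (x - y) = A x - A y"
  using D_add[of x "(-1) \<odot> y"] A_add[of x "(-1) \<odot> y"] D_cm[of y "-1"] A_cm[of y "-1"] by (auto simp: cm_minus_left)

lemma A_zero: "A 0 = 0" using A_diff[OF D_zero D_zero] by simp

lemma D_scaleR: "x \<in> D \<Longrightarrow> r *\<^sub>R x \<in> D" and A_scaleR: "x \<in> D \<Longrightarrow> A (r *\<^sub>R x) = r *\<^sub>R A x"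
  using D_cm[of x "of_real r"] A_cm[of x "of_real r"] by (auto simp: cm_of_real)

lemma perturb: assumes "cbounded J E" shows "coper J D (\<lambda>x. A x + E x)"
proof -
  interpret E: bounded_linear E by (rule cboundedD[OF assms])
  show ?thesis by unfold_locales
    (auto simp: D_zero D_add D_cm A_add A_cm E.add cboundedD(3)[OF assms] cm_add_right)
qed

lemma R_props:
  assumes z: "z \<in> \<rho>"
  shows "R z x \<in> D" "z \<odot> R z x - A (R z x) = x" "u \<in> D \<Longrightarrow> R z (z \<odot> u - A u) = u" "bounded_linear (R z)"
proof -
  have b: "bij_betw (\<lambda>x. z \<odot> x - A x) D UNIV" and "bounded_linear (R z)"
    using z by (auto simp: resolvent_set_def resolvent_def[abs_def])
  then show "bounded_linear (R z)" by simp
  have inj: "inj_on (\<lambda>x. z \<odot> x - A x) D" and im: "(\<lambda>x. z \<odot> x - A x) ` D = UNIV" using b by (auto simp: bij_betw_def)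
  show "R z x \<in> D" unfolding resolvent_def using the_inv_into_into[OF inj, of x D] im by auto
  show "z \<odot> R z x - A (R z x) = x" unfolding resolvent_def using f_the_inv_into_f[OF inj, of x] im by auto
  show "u \<in> D \<Longrightarrow> R z (z \<odot> u - A u) = u" unfolding resolvent_def using the_inv_into_f_f[OF inj] by simp
qed

lemma R_unique: "z \<in> \<rho> \<Longrightarrow> u \<in> D \<Longrightarrow> z \<odot> u - A u = x \<Longrightarrow> R z x = u"
  using R_props(3) by blast

lemma A_R: "z \<in> \<rho> \<Longrightarrow> A (R z x) = z \<odot> R z x - x"
  using R_props(2)[of z x] by (simp add: algebra_simps)

lemma R_cb: assumes "z \<in> \<rho>" shows "cbounded J (R z)"
proof -
  have "R z (J x) = J (R z x)" for x
  proof (rule R_unique[OF assms])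
    show "J (R z x) \<in> D" using D_cm[OF R_props(1)[OF assms], of \<i>] by (simp add: cm_ii)
    have "A (J (R z x)) = J (A (R z x))" using A_cm[OF R_props(1)[OF assms], of \<i>] by (simp add: cm_ii)
    then show "z \<odot> J (R z x) - A (J (R z x)) = J x"
      by (simp add: A_R[OF assms] cm_J J.diff)
  qed
  then show ?thesis using R_props(4)[OF assms] by (simp add: cbounded_def)
qed

lemma R_lin: assumes "z \<in> \<rho>"
  shows "R z (x + y) = R z x + R z y" "R z (x - y) = R z x - R z y" "R z (c \<odot> x) = c \<odot> R z x" "R z 0 = 0"
proof -
  interpret b: bounded_linear "R z" by (rule R_props(4)[OF assms])
  show "R z (x + y) = R z x + R z y" "R z (x - y) = R z x - R z y" "R z 0 = 0" by (simp_all add: b.add b.diff b.zero)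
  show "R z (c \<odot> x) = c \<odot> R z x" using cboundedD(3)[OF R_cb[OF assms]] .
qed

lemma rhoI:
  assumes surj: "\<And>x. \<exists>u\<in>D. z \<odot> u - A u = x \<and> norm u \<le> c * norm x"
    and inj: "\<And>u. u \<in> D \<Longrightarrow> z \<odot> u - A u = 0 \<Longrightarrow> u = 0"
  shows "z \<in> \<rho>" "norm (R z x) \<le> c * norm x"
proof -
  let ?f = "\<lambda>x. z \<odot> x - A x"
  have i: "inj_on ?f D"
  proof (rule inj_onI)
    fix u v assume uv: "u \<in> D" "v \<in> D" "?f u = ?f v"
    have "?f (u - v) = ?f u - ?f v" using uv(1,2) by (simp add: A_diff cm_diff_right)
    then show "u = v" using inj[OF D_diff[OF uv(1,2)]] uv(3) by simp
  qed
  have "x \<in> ?f ` D" for x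
  proof -
    obtain u where "u \<in> D" "?f u = x" using surj[of x] by blast
    then show ?thesis by (intro image_eqI[of _ _ u]) auto
  qed
  then have b: "bij_betw ?f D UNIV" unfolding bij_betw_def using i by auto
  define G where "G = the_inv_into D ?f"
  have G: "G x \<in> D" "?f (G x) = x" for x
    using the_inv_into_into[OF i, of x D] f_the_inv_into_f[OF i, of x] b by (auto simp: G_def bij_betw_def)
  have Gu: "G x = u" if "u \<in> D" "?f u = x" for u x using the_inv_into_f_f[OF i that(1)] that(2) by (simp add: G_def)
  have bd: "norm (G x) \<le> c * norm x" for x
  proof -
    obtain u where "u \<in> D" "?f u = x" "norm u \<le> c * norm x" using surj[of x] by blast
    then show ?thesis using Gu[of u x] by simp
  qed
  have "bounded_linear G"
  proof (rule bounded_linear_intro)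
    show "G (x + y) = G x + G y" for x y
    proof (rule Gu)
      show "?f (G x + G y) = x + y" using G[of x] G[of y] by (simp add: A_add cm_add_right algebra_simps)
    qed (auto intro: D_add G)
    show "G (r *\<^sub>R x) = r *\<^sub>R G x" for r x
    proof (rule Gu)
      show "?f (r *\<^sub>R G x) = r *\<^sub>R x" using G[of x] by (simp add: A_scaleR cm_scaleR_right flip: scaleR_diff_right)
    qed (auto intro: D_scaleR G)
    show "norm (G x) \<le> norm x * c" for x using bd[of x] by (simp add: mult.commute)
  qed
  then show "z \<in> \<rho>" using b by (simp add: resolvent_set_def G_def)
  show "norm (R z x) \<le> c * norm x" using bd by (simp add: resolvent_def G_def)
qed

lemma resolvent_identity:
  assumes "z \<in> \<rho>" "w \<in> \<rho>"
  shows "R z x - R w x = (w - z) \<odot> R z (R w x)"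
proof -
  have "R z x = R z (w \<odot> R w x - A (R w x))" using R_props(2)[OF assms(2)] by simp
  also have "w \<odot> R w x - A (R w x) = (z \<odot> R w x - A (R w x)) + (w - z) \<odot> R w x" by (simp add: cm_diff_left)
  also have "R z \<dots> = R w x + (w - z) \<odot> R z (R w x)"
    using R_props(1,3) assms by (simp add: R_lin)
  finally show ?thesis by simp
qed

lemma R_commute: "z \<in> \<rho> \<Longrightarrow> w \<in> \<rho> \<Longrightarrow> R z (R w x) = R w (R z x)"
proof (cases "z = w")
  case False
  assume zw: "z \<in> \<rho>" "w \<in> \<rho>"
  have "(w - z) \<odot> R z (R w x) = (w - z) \<odot> R w (R z x)"
    using resolvent_identity[OF zw, of x] resolvent_identity[OF zw(2,1), of x]
    by (simp add: cm_diff_left) (metis minus_diff_eq)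
  then show ?thesis using False by (subst (asm) cm_right_inject) auto
qed simp

text \<open>With \<open>y = (z - A) u\<close> the equation becomes the fixed point problem
  \<open>y = x + E (R z y)\<close>, a contraction of ratio q; it also gives
  \<open>norm y \<le> norm x / (1 - q)\<close>.\<close>

lemma neumann:
  assumes z: "z \<in> \<rho>" and c: "\<And>x. norm (R z x) \<le> c * norm x" and E: "cbounded J E"
    and q: "\<And>x. norm (E (R z x)) \<le> q * norm x" "q < 1" "0 \<le> q"
  shows "z \<in> resolvent_set J D (\<lambda>x. A x + E x)" "norm (resolvent J D (\<lambda>x. A x + E x) z x) \<le> c / (1 - q) * norm x"
proof -
  interpret E: bounded_linear E by (rule cboundedD[OF E])
  interpret P: coper J D "\<lambda>x. A x + E x" by (rule perturb[OF E])
  have c0: "c * norm x \<ge> 0" for x :: 'a using c[of x] norm_ge_zero order_trans by blast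
  have surj: "\<exists>u\<in>D. z \<odot> u - (A u + E u) = x \<and> norm u \<le> c / (1 - q) * norm x" for x
  proof -
    have "\<exists>!y. x + E (R z y) = y"
    proof (rule banach_fix_type[OF q(3,2)], intro allI)
      fix y y'
      have "x + E (R z y) - (x + E (R z y')) = E (R z (y - y'))" by (simp add: R_lin[OF z] E.diff)
      then show "dist (x + E (R z y)) (x + E (R z y')) \<le> q * dist y y'" using q(1) by (simp add: dist_norm)
    qed
    then obtain y where y: "x + E (R z y) = y" by blast
    have "norm y \<le> norm x + q * norm y" using norm_triangle_ineq[of x "E (R z y)"] q(1)[of y] y by simp
    then have ny: "norm y \<le> norm x / (1 - q)" using q(2) by (simp add: field_simps)
    have "norm (R z y) \<le> c * norm y" by (rule c)
    also have "\<dots> \<le> c / (1 - q) * norm x"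
    proof (cases "y = 0")
      case True
      then show ?thesis using c0[of x] q(2) by (simp add: divide_nonneg_nonneg)
    next
      case False
      then have "c \<ge> 0" using c0[of y] by (simp add: zero_le_mult_iff)
      then show ?thesis using mult_left_mono[OF ny] by simp
    qed
    finally have "norm (R z y) \<le> c / (1 - q) * norm x" .
    moreover have "z \<odot> R z y - (A (R z y) + E (R z y)) = x" using y by (simp add: A_R[OF z]) (metis add_diff_cancel_right')
    ultimately show ?thesis using R_props(1)[OF z] by blast
  qed
  have inj: "u = 0" if u: "u \<in> D" "z \<odot> u - (A u + E u) = 0" for u
  proof -
    define y where "y = z \<odot> u - A u"
    have uy: "R z y = u" using R_props(3)[OF z u(1)] by (simp add: y_def)
    have "y = E (R z y)" using u(2) uy by (simp add: y_def algebra_simps)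
    then have "norm y \<le> q * norm y" using q(1)[of y] by simp
    then have "y = 0" using q(2) by (metis mult_le_cancel_right1 not_le norm_eq_zero norm_ge_zero less_le)
    then show ?thesis using uy by (simp add: R_lin[OF z])
  qed
  show "z \<in> resolvent_set J D (\<lambda>x. A x + E x)" "norm (resolvent J D (\<lambda>x. A x + E x) z x) \<le> c / (1 - q) * norm x"
    using P.rhoI[OF surj inj] by auto
qed

text \<open>Replacing z by w is the bounded perturbation by \<open>z - w\<close> times the identity,
  to which the contraction argument applies with ratio 1/2.\<close>

lemma rho_near:
  assumes z: "z \<in> \<rho>" and c: "\<And>x. norm (R z x) \<le> c * norm x" and w: "cmod (w - z) * c \<le> 1/2"
  shows "w \<in> \<rho>" "norm (R w x) \<le> 2 * c * norm x"
proof -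
  have E: "cbounded J (\<lambda>x. (z - w) \<odot> x)"
    by (auto simp: cbounded_def cm.bounded_linear_right cm_J)
  have q: "norm ((z - w) \<odot> R z x) \<le> 1/2 * norm x" for x
  proof -
    have "norm ((z - w) \<odot> R z x) \<le> cmod (w - z) * (c * norm x)"
      using c[of x] by (simp add: norm_minus_commute mult_left_mono)
    also have "\<dots> \<le> 1/2 * norm x" using mult_right_mono[OF w, of "norm x"] by (simp add: mult_ac)
    finally show ?thesis .
  qed
  have eq: "(\<lambda>x. z \<odot> x - (A x + (z - w) \<odot> x)) = (\<lambda>x. w \<odot> x - A x)" by (auto simp: cm_diff_left)
  show "w \<in> \<rho>" using neumann(1)[OF z c E q] unfolding resolvent_set_def by (simp add: eq)
  show "norm (R w x) \<le> 2 * c * norm x" using neumann(2)[OF z c E q, of x] unfolding resolvent_def by (simp add: eq)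
qed

lemma R_bound: assumes "z \<in> \<rho>" obtains c where "c > 0" "\<And>x. norm (R z x) \<le> c * norm x"
proof -
  obtain K where "K > 0" "\<And>x. norm (R z x) \<le> norm x * K"
    using bounded_linear.pos_bounded[OF R_props(4)[OF assms]] by blast
  then show ?thesis using that[of K] by (simp add: mult.commute)
qed

lemma rho_nhd:
  assumes z: "z \<in> \<rho>"
  obtains d c where "d > 0" "c > 0" "ball z d \<subseteq> \<rho>" "\<And>w x. w \<in> ball z d \<Longrightarrow> norm (R w x) \<le> c * norm x"
proof -
  obtain c where c: "c > 0" "\<And>x. norm (R z x) \<le> c * norm x" using R_bound[OF z] by blast
  have *: "cmod (w - z) * c \<le> 1/2" if "w \<in> ball z (1 / (2 * c))" for w
    using that c(1) by (simp add: dist_norm norm_minus_commute field_simps)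
  show ?thesis
    by (rule that[of "1 / (2 * c)" "2 * c"]) (use c rho_near[OF z c(2) *] in auto)
qed

lemma open_rho: "open \<rho>"
  unfolding open_contains_ball by (metis rho_nhd)

text \<open>The radius 1/(2c) allowed by \<open>rho_near\<close> is the same around every
  \<open>w n\<close>, so z lies in one of these discs.\<close>

lemma rho_limit:
  assumes w: "\<And>n::nat. w n \<in> \<rho>" "w \<longlonglongrightarrow> z" and c: "\<And>n x. norm (R (w n) x) \<le> c * norm x" "c > 0"
  shows "z \<in> \<rho>"
proof -
  obtain n where "dist (w n) z < 1 / (2 * c)" using metric_LIMSEQ_D[OF w(2), of "1 / (2 * c)"] c(2) by auto
  then have "cmod (z - w n) * c \<le> 1/2" using c(2) by (simp add: dist_norm norm_minus_commute field_simps)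
  then show ?thesis using rho_near[OF w(1) c(1)] by blast
qed

lemma R_tendsto:
  assumes z: "z \<in> \<rho>" shows "((\<lambda>w. R w x) \<longlongrightarrow> R z x) (at z)"
proof -
  obtain d c where d: "d > 0" "c > 0" "ball z d \<subseteq> \<rho>" "\<And>w x. w \<in> ball z d \<Longrightarrow> norm (R w x) \<le> c * norm x"
    using rho_nhd[OF z] by blast
  show ?thesis
  proof (rule LIM_zero_cancel, rule Lim_null_comparison)
  have "((\<lambda>w. cmod (z - w) * (c * norm (R z x))) \<longlongrightarrow> cmod (z - z) * (c * norm (R z x))) (at z)"
    by (intro tendsto_intros)
  then show "((\<lambda>w. cmod (z - w) * (c * norm (R z x))) \<longlongrightarrow> 0) (at z)" by simp
  show "\<forall>\<^sub>F w in at z. norm (R w x - R z x) \<le> cmod (z - w) * (c * norm (R z x))"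
    unfolding eventually_at
  proof (intro exI[of _ d] conjI d(1) ballI impI)
    fix w assume "w \<noteq> z \<and> dist w z < d"
    then have w: "w \<in> ball z d" by (simp add: dist_commute)
    then show "norm (R w x - R z x) \<le> cmod (z - w) * (c * norm (R z x))"
      using resolvent_identity[of w z x] z d(3) d(4)[OF w, of "R z x"] by (auto simp: mult_left_mono)
  qed
  qed
qed

lemma R_continuous: "continuous_on \<rho> (\<lambda>w. R w x)"
  using R_tendsto by (auto simp: continuous_on_eq_continuous_at[OF open_rho] isCont_def)

text \<open>By the resolvent identity the difference quotient equals
  \<open>- f (R (z + h) (R z x))\<close> exactly, so strong continuity of the resolvent gives its
  limit.\<close>

lemma R_holomorphic:
  assumes f: "clin J f" shows "(\<lambda>w. f (R w x)) holomorphic_on \<rho>"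
proof -
  interpret f: bounded_linear f by (rule clinD[OF f])
  have "((\<lambda>w. f (R w x)) has_field_derivative - f (R z (R z x))) (at z)" if z: "z \<in> \<rho>" for z
    unfolding DERIV_def
  proof (rule Lim_transform_eventually)
    have "((\<lambda>w. - f (R w (R z x))) \<longlongrightarrow> - f (R z (R z x))) (at z)"
      by (intro tendsto_minus f.tendsto R_tendsto z)
    then show "((\<lambda>h. - f (R (z + h) (R z x))) \<longlongrightarrow> - f (R z (R z x))) (at 0)" by (rule LIM_offset_zero)
    obtain d where d: "d > 0" "ball z d \<subseteq> \<rho>" using open_rho z open_contains_ball by blast
    have "\<forall>\<^sub>F h in at 0. z + h \<in> \<rho>"
      unfolding eventually_at using d by (intro exI[of _ d]) (auto simp: dist_norm)
    moreover have "\<forall>\<^sub>F h in at (0::complex). h \<noteq> 0" by (simp add: eventually_at_filter)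
    ultimately show "\<forall>\<^sub>F h in at 0. - f (R (z + h) (R z x)) = (f (R (z + h) x) - f (R z x)) / h"
    proof eventually_elim
      case (elim h)
      have "f (R (z + h) x) - f (R z x) = f ((- h) \<odot> R (z + h) (R z x))"
        using resolvent_identity[of "z + h" z x] elim z by (simp add: clinD(4)[OF f, symmetric])
      also have "\<dots> = - h * f (R (z + h) (R z x))" by (simp only: clinD(2)[OF f])
      finally show ?case using elim by simp
    qed
  qed
  then show ?thesis by (auto simp: holomorphic_on_open[OF open_rho])
qed

text \<open>The Sherman-Morrison formula. The scalar \<open>1 - f (R z p)\<close> is the
  perturbation determinant: within \<open>\<rho>\<close> only its zeros can become new
  spectrum.\<close>

lemma rank_one:
  assumes z: "z \<in> \<rho>" and f: "clin J f" and h: "1 - f (R z p) \<noteq> 0"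
  shows "z \<in> resolvent_set J D (\<lambda>x. A x + f x \<odot> p)"
    "resolvent J D (\<lambda>x. A x + f x \<odot> p) z x = R z x + (f (R z x) / (1 - f (R z p))) \<odot> R z p"
proof -
  interpret f: bounded_linear f by (rule clinD[OF f])
  have F: "cbounded J (\<lambda>x. f x \<odot> p)"
    using f by (auto simp: cbounded_def clin_def cm_ii[symmetric] intro!: bounded_linear_compose[OF cm.bounded_linear_left])
  interpret P: coper J D "\<lambda>x. A x + f x \<odot> p" by (rule perturb[OF F])
  define G where "G x = R z x + (f (R z x) / (1 - f (R z p))) \<odot> R z p" for x
  have G: "G x \<in> D" "z \<odot> G x - (A (G x) + f (G x) \<odot> p) = x" for x
  proof -
    let ?k = "f (R z x) / (1 - f (R z p))"
    show "G x \<in> D" unfolding G_def by (intro D_add D_cm R_props z)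
    have "A (G x) = z \<odot> G x - x - ?k \<odot> p"
      unfolding G_def using R_props(1)[OF z]
      by (simp add: A_add A_cm D_cm A_R[OF z] cm_add_right cm_diff_right mult.commute del: cm_cm) (simp add: mult.commute)
    moreover have "f (G x) = ?k" using h unfolding G_def by (simp add: clinD[OF f] field_simps)
    ultimately show "z \<odot> G x - (A (G x) + f (G x) \<odot> p) = x" by simp
  qed
  interpret RZ: bounded_linear "R z" by (rule R_props(4)[OF z])
  have "bounded_linear G" unfolding G_def
    by (intro bounded_linear_add RZ.bounded_linear_axioms bounded_linear_compose[OF cm.bounded_linear_left]
        bounded_linear_compose[OF bounded_linear_divide] bounded_linear_compose[OF f.bounded_linear_axioms RZ.bounded_linear_axioms])
  then obtain c where c: "\<And>x. norm (G x) \<le> c * norm x"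
    using bounded_linear.bounded by (metis mult.commute)
  have inj: "u = 0" if u: "u \<in> D" "z \<odot> u - (A u + f u \<odot> p) = 0" for u
  proof -
    have "u = f u \<odot> R z p" using R_unique[OF z u(1), of "f u \<odot> p"] u(2) by (simp add: R_lin[OF z] algebra_simps)
    moreover from arg_cong[OF this, of f] have "f u = f u * f (R z p)" by (simp add: clinD[OF f])
    then have "f u = 0" using h by (metis mult_cancel_left2 right_minus_eq)
    ultimately show ?thesis by simp
  qed
  show z': "z \<in> resolvent_set J D (\<lambda>x. A x + f x \<odot> p)"
    using G c by (intro P.rhoI(1)[OF _ inj]) blast
  show "resolvent J D (\<lambda>x. A x + f x \<odot> p) z x = R z x + (f (R z x) / (1 - f (R z p))) \<odot> R z p"
    using P.R_unique[OF z' G] by (simp add: G_def)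
qed

end


section \<open>Discreteness of the spectrum under compact perturbations\<close>

context c0
begin

sublocale op: coper J D A
  by unfold_locales (auto simp: D_sub A_add A_cm)

text \<open>Existence is the Laplace transform of the orbit. For injectivity, the orbit of an
  eigenvector grows exactly like exp (Re z t), which contradicts the growth bound as soon as
  \<open>(Re z - w) * t\<close> exceeds ln M.\<close>

lemma halfplane_resolvent:
  assumes T: "\<And>t x. t \<ge> 0 \<Longrightarrow> norm (T t x) \<le> M * exp (w * t) * norm x" and z: "Re z > w"
  shows "z \<in> op.\<rho>" "norm (op.R z x) \<le> M / (Re z - w) * norm x"
proof -
  interpret r: c0 J "\<lambda>t x. exp (- (z * of_real t)) \<odot> T t x" D "\<lambda>x. A x - z \<odot> x" by (rule rescale)
  have surj: "\<exists>u\<in>D. z \<odot> u - A u = x \<and> norm u \<le> M / (Re z - w) * norm x" for x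
  proof -
    have "norm (exp (- (z * of_real t)) \<odot> T t x) \<le> (M * norm x) * exp (- (Re z - w) * t)" if "t \<ge> 0" for t
    proof -
      have "norm (exp (- (z * of_real t)) \<odot> T t x) \<le> exp (- Re z * t) * (M * exp (w * t) * norm x)"
        using T[OF that, of x] by (simp add: norm_exp_eq_Re)
      also have "\<dots> = (M * norm x) * exp (- (Re z - w) * t)"
        by (simp add: exp_add[symmetric] algebra_simps)
      finally show ?thesis .
    qed
    then obtain u where "u \<in> D" "A u - z \<odot> u = - x" "norm u \<le> (M * norm x) / (Re z - w)"
      by (rule r.decay_solution) (use z in auto)
    then show ?thesis by (intro bexI[of _ u]) (auto simp: algebra_simps)
  qed
  have inj: "u = 0" if u: "u \<in> D" "z \<odot> u - A u = 0" for u
  proof (rule ccontr)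
    assume "u \<noteq> 0"
    have "exp (Re z * t) \<le> M * exp (w * t)" if "t \<ge> 0" for t
      using T[OF that, of u] eigenvector_semigroup[OF u(1) _ that, of z] u(2) \<open>u \<noteq> 0\<close>
      by (simp add: norm_exp_eq_Re)
    then have le: "exp (Re z * t) \<le> M * exp (w * t)" if "t \<ge> 0" for t using that .
    have M: "M \<ge> 1" using le[of 0] by simp
    define t where "t = (ln M + 1) / (Re z - w)"
    have "t \<ge> 0" using M z by (simp add: t_def)
    from le[OF this] have "exp (Re z * t) * exp (- w * t) \<le> M * exp (w * t) * exp (- w * t)"
      by (intro mult_right_mono) auto
    then have "exp ((Re z - w) * t) \<le> M" by (simp add: mult.assoc exp_add[symmetric] algebra_simps)
    moreover have "(Re z - w) * t = ln M + 1" using z by (simp add: t_def)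
    ultimately have "exp (ln M + 1) \<le> exp (ln M)" using M by simp
    then show False by simp
  qed
  show "z \<in> op.\<rho>" "norm (op.R z x) \<le> M / (Re z - w) * norm x" using op.rhoI[OF surj inj] by auto
qed

lemma T_R_commute:
  assumes "z \<in> op.\<rho>" "t \<ge> 0" shows "T t (op.R z x) = op.R z (T t x)"
proof (rule sym, rule op.R_unique[OF assms(1)])
  show "T t (op.R z x) \<in> D" by (rule T_in_D(1)[OF op.R_props(1)[OF assms(1)] assms(2)])
  show "z \<odot> T t (op.R z x) - A (T t (op.R z x)) = T t x"
    using T_in_D(2)[OF op.R_props(1)[OF assms(1)] assms(2), of x] assms op.R_props(2)[OF assms(1), of x]
    by (simp add: T_lin(2,6)[symmetric])
qed

end

text \<open>Built from rank-one pieces instead of through the dimension of the range, so that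
  induction adds exactly the perturbations treated by \<open>rank_one\<close>.\<close>

inductive finite_rank :: "('a::{banach,real_inner} \<Rightarrow> 'a) \<Rightarrow> ('a \<Rightarrow> 'a) \<Rightarrow> bool" for J where
  zero: "finite_rank J (\<lambda>x. 0)"
| add: "finite_rank J F \<Longrightarrow> clin J f \<Longrightarrow> finite_rank J (\<lambda>x. F x + cmul J (f x) p)"

context cstruct
begin

lemma rank_one_cbounded: "clin J f \<Longrightarrow> cbounded J (\<lambda>x. f x \<odot> p)"
  by (auto simp: cbounded_def clin_def cm_ii[symmetric] intro!: bounded_linear_compose[OF cm.bounded_linear_left])

lemma cbounded_add: "cbounded J F \<Longrightarrow> cbounded J G \<Longrightarrow> cbounded J (\<lambda>x. F x + G x)"
  by (auto simp: cbounded_def J.add intro: bounded_linear_add)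

lemma cbounded_diff: "cbounded J F \<Longrightarrow> cbounded J G \<Longrightarrow> cbounded J (\<lambda>x. F x - G x)"
  by (auto simp: cbounded_def J.diff intro: bounded_linear_sub)

lemma finite_rank_cbounded: "finite_rank J F \<Longrightarrow> cbounded J F"
proof (induction rule: finite_rank.induct)
  case zero
  then show ?case by (simp add: cbounded_def J.zero bounded_linear_zero)
next
  case (add F f p)
  then show ?case by (intro cbounded_add rank_one_cbounded)
qed

lemma finite_rank_compose:
  assumes "finite_rank J F" "cbounded J X" shows "finite_rank J (\<lambda>x. F (X x))"
  using assms(1)
proof (induction rule: finite_rank.induct)
  case zero
  then show ?case by (rule finite_rank.zero)
next
  case (add F f p)
  have "clin J (\<lambda>x. f (X x))" using add(2) assms(2)
    by (auto simp: clin_def cbounded_def intro: bounded_linear_compose)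
  with add(3) show ?case by (rule finite_rank.add)
qed

text \<open>One Gram-Schmidt step: the residue of the new vector is normalised to e, and
  \<open>cin e x\<close> times e is added. Symmetry and idempotence are carried along because
  together they make P an orthogonal projection.\<close>

lemma projection_onto_span:
  assumes "finite G"
  shows "\<exists>P. finite_rank J P \<and> (\<forall>g\<in>G. P g = g) \<and> (\<forall>x y. cin y (P x) = cin (P y) x) \<and> (\<forall>x. P (P x) = P x)"
  using assms
proof (induction rule: finite_induct)
  case empty
  show ?case by (rule exI[of _ "\<lambda>x. 0"]) (auto simp: finite_rank.zero clinD(5)[OF cin_clin] cin_def complex_eq_iff J.zero)
next
  case (insert g G)
  then obtain P where P: "finite_rank J P" "\<And>g. g \<in> G \<Longrightarrow> P g = g" "\<And>x y. cin y (P x) = cin (P y) x" "\<And>x. P (P x) = P x"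
    by blast
  interpret P: bounded_linear P by (rule cboundedD[OF finite_rank_cbounded[OF P(1)]])
  note Pcm = cboundedD(3)[OF finite_rank_cbounded[OF P(1)]]
  show ?case
  proof (cases "P g = g")
    case True
    then show ?thesis using P by (intro exI[of _ P]) auto
  next
    case False
    define d where "d = g - P g"
    have d: "norm d \<noteq> 0" "P d = 0" using False by (auto simp: d_def P.diff P(4))
    define e where "e = (1 / norm d) *\<^sub>R d"
    have ne: "norm e = 1" and Pe: "P e = 0" using d by (auto simp: e_def P.scaleR)
    have de: "d = complex_of_real (norm d) \<odot> e" using d(1) by (simp add: e_def cm_of_real)
    have ee: "cin e e = 1" by (simp add: cin_self ne)
    have eP: "cin e (P x) = 0" for x using P(3)[of e x] Pe by (simp add: cin_def complex_eq_iff J.zero)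
    note ce = clinD[OF cin_clin]
    define Q where "Q x = P x + cin e x \<odot> e" for x
    have "finite_rank J Q" unfolding Q_def[abs_def] by (intro finite_rank.add P(1) cin_clin)
    moreover have "Q h = h" if "h \<in> insert g G" for h
    proof (cases "h = g")
      case True
      have "cin e g = cin e (P g + d)" by (simp add: d_def)
      also have "\<dots> = cin e (complex_of_real (norm d) \<odot> e)" using eP de by (simp add: ce(3))
      finally have "cin e g = complex_of_real (norm d)" by (simp add: ce(2) ee)
      then have "cin e g \<odot> e = d" using de by simp
      then show ?thesis using True by (simp add: Q_def d_def)
    next
      case False
      then have "P h = h" using that P(2) by auto
      then show ?thesis using eP[of h] by (simp add: Q_def)
    qed
    moreover have "cin y (Q x) = cin (Q y) x" for x y
    proof -
      have 1: "cin y (Q x) = cin y (P x) + cin e x * cin y e" for x y by (simp add: Q_def ce)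
      have "cin (Q y) x = cnj (cin x (Q y))" by (rule cin_sym)
      also have "\<dots> = cnj (cin x (P y)) + cnj (cin e y) * cnj (cin x e)" by (simp add: 1)
      also have "\<dots> = cin y (P x) + cin e x * cin y e"
        using cin_sym[of e x] cin_sym[of y e] cin_sym[of "P y" x] P(3)[of y x] by simp
      finally show ?thesis by (simp add: 1)
    qed
    moreover have "Q (Q x) = Q x" for x
      by (simp add: Q_def P.add Pcm Pe P(4) ce eP ee)
    ultimately show ?thesis by blast
  qed
qed

text \<open>Project onto the span of a finite e/2-net of the image of the ball. The complementary
  projection kills the net and does not increase norms, so only the distance to the net
  remains.\<close>

lemma compact_finite_rank_approx:
  assumes X: "cbounded J X" "compact_operator X" and e: "e > 0"
  obtains F where "finite_rank J F" "\<And>x. norm (X x - F x) \<le> e * norm x"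
proof -
  interpret X: bounded_linear X by (rule cboundedD[OF X(1)])
  obtain G where G: "finite G" "closure (X ` ball 0 1) \<subseteq> (\<Union>x\<in>G. ball x (e/2))"
    using X(2) e unfolding compact_operator_def compact_eq_totally_bounded by (meson half_gt_zero)
  obtain P where P: "finite_rank J P" "\<And>g. g \<in> G \<Longrightarrow> P g = g" "\<And>x y. cin y (P x) = cin (P y) x" "\<And>x. P (P x) = P x"
    using projection_onto_span[OF G(1)] by blast
  interpret P: bounded_linear P by (rule cboundedD[OF finite_rank_cbounded[OF P(1)]])
  have contr: "norm (x - P x) \<le> norm x" for x
  proof -
    have "cin (P x) (x - P x) = cin (P x) x - cin (P (P x)) x" by (simp add: clinD[OF cin_clin] P(3))
    then have "inner (x - P x) (P x) = 0" by (simp add: P(4) cin_def complex_eq_iff zero_complex.ctr)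
    then have "(norm x)\<^sup>2 = (norm (x - P x))\<^sup>2 + (norm (P x))\<^sup>2"
      using norm_add_Pythagorean[of "x - P x" "P x"] by (simp add: orthogonal_def)
    then have "(norm (x - P x))\<^sup>2 \<le> (norm x)\<^sup>2" by simp
    then show ?thesis by (simp add: power2_le_iff_abs_le)
  qed
  have ball: "norm (X x - P (X x)) \<le> e/2" if "x \<in> ball 0 1" for x
  proof -
    have "X x \<in> closure (X ` ball 0 1)" by (rule subsetD[OF closure_subset]) (rule imageI[OF that])
    then obtain g where g: "g \<in> G" "dist g (X x) < e/2" using G(2) by auto
    have "X x - P (X x) = (X x - g) - P (X x - g)" using P(2)[OF g(1)] by (simp add: P.diff)
    then have "norm (X x - P (X x)) \<le> norm (X x - g)" using contr[of "X x - g"] by (simp only:)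
    then show ?thesis using g(2) by (simp add: dist_norm norm_minus_commute)
  qed
  have "norm (X x - P (X x)) \<le> e * norm x" for x
  proof (cases "x = 0")
    case False
    \<comment> \<open>Half of the unit vector lies in the open unit ball; the factor 2 this costs is
      why the net has radius e/2.\<close>
    define y where "y = (1 / (2 * norm x)) *\<^sub>R x"
    have y: "y \<in> ball 0 1" "x = (2 * norm x) *\<^sub>R y" using False by (auto simp: y_def)
    have "X x - P (X x) = (2 * norm x) *\<^sub>R (X y - P (X y))"
      by (subst (1 2) y(2)) (simp only: X.scaleR P.scaleR scaleR_diff_right)
    then have "norm (X x - P (X x)) = 2 * norm x * norm (X y - P (X y))" by simp
    also have "\<dots> \<le> 2 * norm x * (e / 2)" by (intro mult_left_mono ball y) auto
    finally show ?thesis by (simp add: mult_ac)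
  qed (simp add: X.zero P.zero)
  then show ?thesis using that finite_rank_compose[OF P(1) X(1)] by blast
qed

end

text \<open>Since the resolvent of the unperturbed generator is bounded on a whole half-plane, one and the
  same finite-rank approximation of the compact perturbation works for all points of it. The finite-rank part
  is then added one rank-one operator at a time; each step divides by a scalar meromorphic function,
  which is not identically zero because the resolvent is small far to the right.\<close>

definition small_at_infinity :: "('a::{banach,real_inner} \<Rightarrow> 'a) \<Rightarrow> 'a set \<Rightarrow> ('a \<Rightarrow> 'a) \<Rightarrow> bool" where
  "small_at_infinity J D A \<longleftrightarrow> (\<forall>e>0. \<exists>W. \<forall>z. Re z > W \<longrightarrow> z \<in> resolvent_set J D A \<and> (\<forall>x. norm (resolvent J D A z x) \<le> e * norm x))"

text \<open>Meromorphy is asked of scalar functions only; invertibility off a sparse set is a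
  separate clause, because the scalar functions do not detect it.\<close>

definition mero_resolvent :: "('a::{banach,real_inner} \<Rightarrow> 'a) \<Rightarrow> 'a set \<Rightarrow> ('a \<Rightarrow> 'a) \<Rightarrow> complex set \<Rightarrow> bool" where
  "mero_resolvent J D A U \<longleftrightarrow> (\<forall>\<^sub>F z in cosparse U. z \<in> resolvent_set J D A) \<and>
     (\<forall>f x. clin J f \<longrightarrow> (\<lambda>z. f (resolvent J D A z x)) meromorphic_on U)"

context coper
begin

lemma small_at_infinity_perturb:
  assumes "small_at_infinity J D A" "cbounded J E"
  shows "small_at_infinity J D (\<lambda>x. A x + E x)"
  unfolding small_at_infinity_def
proof (intro allI impI)
  fix e :: real assume e: "e > 0"
  obtain K where K: "K > 0" "\<And>x. norm (E x) \<le> norm x * K"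
    using bounded_linear.pos_bounded[OF cboundedD(1)[OF assms(2)]] by blast
  \<comment> \<open>The first entry compensates the factor 2 in the bound of \<open>neumann\<close>;
    the second makes the contraction ratio 1/2.\<close>
  define e' where "e' = min (e / 2) (1 / (2 * K))"
  have e': "e' > 0" "e' \<le> e / 2" "K * e' \<le> 1/2" using e K(1) by (auto simp: e'_def min_def field_simps)
  obtain W where W: "\<And>z. Re z > W \<Longrightarrow> z \<in> \<rho>" "\<And>z x. Re z > W \<Longrightarrow> norm (R z x) \<le> e' * norm x"
    using assms(1) e'(1) unfolding small_at_infinity_def by meson
  show "\<exists>W. \<forall>z. Re z > W \<longrightarrow> z \<in> resolvent_set J D (\<lambda>x. A x + E x) \<and> (\<forall>x. norm (resolvent J D (\<lambda>x. A x + E x) z x) \<le> e * norm x)"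
  proof (intro exI[of _ W] allI impI)
    fix z assume z: "Re z > W"
    have q: "norm (E (R z x)) \<le> 1/2 * norm x" for x
    proof -
      have "norm (E (R z x)) \<le> (e' * norm x) * K" using K W(2)[OF z, of x] by (meson mult_right_mono less_imp_le order_trans)
      also have "\<dots> = (K * e') * norm x" by simp
      also have "\<dots> \<le> 1/2 * norm x" using e'(3) by (intro mult_right_mono) auto
      finally show ?thesis .
    qed
    have "e' / (1 - 1/2) * norm x \<le> e * norm x" for x :: 'a using e'(2) by (intro mult_right_mono) auto
    then show "z \<in> resolvent_set J D (\<lambda>x. A x + E x) \<and> (\<forall>x. norm (resolvent J D (\<lambda>x. A x + E x) z x) \<le> e * norm x)"
      using neumann[OF W(1)[OF z] W(2)[OF z] assms(2) q] by (auto intro: order_trans)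
  qed
qed

lemma mero_resolvent_rank_one:
  assumes mero: "mero_resolvent J D A {z. Re z > w}" and small: "small_at_infinity J D A" and f: "clin J f"
  shows "mero_resolvent J D (\<lambda>x. A x + f x \<odot> p) {z. Re z > w}"
proof -
  let ?U = "{z. Re z > w}"
  let ?A = "\<lambda>x. A x + f x \<odot> p"
  define h where "h z = 1 - f (R z p)" for z
  have ev: "\<forall>\<^sub>F z in cosparse ?U. z \<in> \<rho>"
    and m: "\<And>f x. clin J f \<Longrightarrow> (\<lambda>z. f (R z x)) meromorphic_on ?U" using mero by (auto simp: mero_resolvent_def)
  have hm: "h meromorphic_on ?U" unfolding h_def by (intro meromorphic_intros m f)
  \<comment> \<open>On the connected half-plane, h either vanishes off a sparse set or is nonzero
    off a sparse set. The first is impossible because far to the right \<open>f (R z p)\<close> has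
    modulus at most 1/2.\<close>
  have "(\<forall>\<^sub>F z in cosparse ?U. h z = 0) \<or> (\<forall>\<^sub>F z in cosparse ?U. h z \<noteq> 0)"
    by (rule meromorphic_imp_constant_or_avoid[OF hm open_halfspace_Re_gt]) (rule connected_halfspace_Re_gt)
  moreover have "\<not> (\<forall>\<^sub>F z in cosparse ?U. h z = 0)"
  proof
    assume h0: "\<forall>\<^sub>F z in cosparse ?U. h z = 0"
    obtain K where K: "K > 0" "\<And>x. norm (f x) \<le> norm x * K"
      using bounded_linear.pos_bounded[OF clinD(1)[OF f]] by blast
    define e where "e = 1 / (2 * K * (norm p + 1))"
    have np: "norm p + 1 > 0" using norm_ge_zero[of p] by linarith
    have e: "e > 0" using K np by (simp add: e_def)
    have "e * norm p * K = norm p / (2 * (norm p + 1))" using K(1) by (simp add: e_def)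
    also have "\<dots> \<le> 1/2" using np by (simp add: field_simps)
    finally have eK: "e * norm p * K \<le> 1/2" .
    obtain W where W: "\<And>z. Re z > W \<Longrightarrow> norm (R z p) \<le> e * norm p"
      using small e unfolding small_at_infinity_def by meson
    have nz: "h z \<noteq> 0" if "Re z > W" for z
    proof
      assume "h z = 0"
      then have "norm (f (R z p)) = 1" by (simp add: h_def)
      moreover have "norm (f (R z p)) \<le> (e * norm p) * K"
        using K W[OF that] by (meson mult_right_mono less_imp_le order_trans)
      ultimately show False using eK by simp
    qed
    define z0 where "z0 = complex_of_real (max W w + 1)"
    have z0: "Re z0 > W" "z0 \<in> ?U" by (auto simp: z0_def)
    have "\<forall>\<^sub>F z in at z0. h z = 0" using eventually_cosparse_imp_eventually_at[OF h0 z0(2)] .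
    moreover have "\<forall>\<^sub>F z in at z0. Re z > W"
      by (rule order_tendstoD(1)[OF tendsto_Re[OF tendsto_ident_at] z0(1)])
    ultimately have "\<forall>\<^sub>F z in at z0. False" by eventually_elim (use nz in auto)
    then show False by simp
  qed
  ultimately have hne: "\<forall>\<^sub>F z in cosparse ?U. h z \<noteq> 0" by blast
  have good: "\<forall>\<^sub>F z in cosparse ?U. z \<in> \<rho> \<and> h z \<noteq> 0" using ev hne by eventually_elim auto
  have "\<forall>\<^sub>F z in cosparse ?U. z \<in> resolvent_set J D ?A"
    using good by eventually_elim (use rank_one(1)[OF _ f] in \<open>auto simp: h_def\<close>)
  moreover have "(\<lambda>z. g (resolvent J D ?A z x)) meromorphic_on ?U" if g: "clin J g" for g x
  proof -
    have "(\<lambda>z. g (R z x) + f (R z x) / h z * g (R z p)) meromorphic_on ?U"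
      by (intro meromorphic_intros m f g hm)
    moreover have "\<forall>\<^sub>F z in cosparse ?U. g (resolvent J D ?A z x) = g (R z x) + f (R z x) / h z * g (R z p)"
      using good
    proof eventually_elim
      case (elim z)
      then show ?case using rank_one(2)[of z f p x] f by (simp add: h_def clinD[OF g])
    qed
    ultimately show ?thesis by (subst meromorphic_on_cong'[OF _ refl])
  qed
  ultimately show ?thesis by (auto simp: mero_resolvent_def)
qed

end

context cstruct
begin

lemma mero_resolvent_finite_rank:
  assumes "finite_rank J F" "coper J D A" "mero_resolvent J D A {z. Re z > w}" "small_at_infinity J D A"
  shows "mero_resolvent J D (\<lambda>x. A x + F x) {z. Re z > w}"
  using assms(1)
proof (induction rule: finite_rank.induct)
  case zero
  then show ?case using assms(3) by simp
next
  case (add F f p)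
  note F = finite_rank_cbounded[OF add(1)]
  interpret coper J D "\<lambda>x. A x + F x" by (rule coper.perturb[OF assms(2) F])
  show ?case using mero_resolvent_rank_one[OF add(3) coper.small_at_infinity_perturb[OF assms(2,4) F] add(2), of p]
    by (simp add: add.assoc)
qed

end

context c0
begin

lemma discrete_spectrum:
  assumes T: "\<And>t x. t \<ge> 0 \<Longrightarrow> norm (T t x) \<le> M * exp (w * t) * norm x" and w: "w < w1"
    and X: "cbounded J X" "compact_operator X"
  shows "\<forall>\<^sub>F z in cosparse {z. Re z > w1}. z \<in> resolvent_set J D (\<lambda>x. A x + X x)"
proof -
  define c where "c = max 1 (M / (w1 - w))"
  have c: "norm (op.R z x) \<le> c * norm x" if "Re z > w1" for z x
  proof (cases "x = 0")
    case True
    then show ?thesis using halfplane_resolvent(2)[OF T, of z 0] w that by simp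
  next
    case False
    have "norm x \<le> M * norm x" using T[of 0 x] by simp
    then have "M \<ge> 1" using False by simp
    then have "M / (Re z - w) \<le> M / (w1 - w)" using w that by (intro divide_left_mono mult_pos_pos) auto
    then have "M / (Re z - w) * norm x \<le> c * norm x" by (intro mult_right_mono) (auto simp: c_def)
    then show ?thesis using halfplane_resolvent(2)[OF T, of z x] w that by linarith
  qed
  have rho: "z \<in> op.\<rho>" if "Re z > w1" for z using halfplane_resolvent[OF T] w that by simp
  have c0: "c \<ge> 1" by (simp add: c_def)
  \<comment> \<open>Accuracy 1/(2c) makes \<open>X - F\<close> after the resolvent a contraction of
    ratio 1/2 at all points of the half-plane simultaneously. Adding \<open>X - F\<close> thus
    creates no spectrum there, and only F remains to be added.\<close>
  obtain F where F: "finite_rank J F" "\<And>x. norm (X x - F x) \<le> 1 / (2 * c) * norm x"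
    using compact_finite_rank_approx[OF X, of "1 / (2 * c)"] c0 by auto
  have E: "cbounded J (\<lambda>x. X x - F x)" by (intro cbounded_diff X finite_rank_cbounded F)
  interpret P: coper J D "\<lambda>x. A x + (X x - F x)" by (rule op.perturb[OF E])
  have q: "norm (X (op.R z x) - F (op.R z x)) \<le> 1/2 * norm x" if "Re z > w1" for z x
  proof -
    have "norm (X (op.R z x) - F (op.R z x)) \<le> 1 / (2 * c) * norm (op.R z x)" by (rule F)
    also have "\<dots> \<le> 1 / (2 * c) * (c * norm x)" using c[OF that] c0 by (intro mult_left_mono) auto
    finally show ?thesis using c0 by simp
  qed
  have rP: "z \<in> P.\<rho>" if "Re z > w1" for z
    using op.neumann(1)[OF rho[OF that] c[OF that] E q[OF that]] by simp
  have "mero_resolvent J D (\<lambda>x. A x + (X x - F x)) {z. Re z > w1}"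
    unfolding mero_resolvent_def
  proof (intro conjI allI impI)
    show "\<forall>\<^sub>F z in cosparse {z. Re z > w1}. z \<in> P.\<rho>"
      by (rule eventually_in_cosparse) (use rP open_halfspace_Re_gt in auto)
    show "(\<lambda>z. f (P.R z x)) meromorphic_on {z. Re z > w1}" if "clin J f" for f x
      by (rule analytic_on_imp_meromorphic_on, subst analytic_on_open[OF open_halfspace_Re_gt])
         (use P.R_holomorphic[OF that] rP in \<open>auto intro: holomorphic_on_subset\<close>)
  qed
  moreover have "small_at_infinity J D A"
    unfolding small_at_infinity_def
  proof (intro allI impI)
    fix e :: real assume e: "e > 0"
    show "\<exists>W. \<forall>z. Re z > W \<longrightarrow> z \<in> op.\<rho> \<and> (\<forall>x. norm (op.R z x) \<le> e * norm x)"
    proof (intro exI[of _ "w + \<bar>M\<bar> / e"] allI impI conjI)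
      fix z and x :: 'a assume z: "w + \<bar>M\<bar> / e < Re z"
      have zw: "Re z > w" using z e by (meson abs_ge_zero add_increasing2 divide_nonneg_pos le_less_trans order_refl)
      then show "z \<in> op.\<rho>" using halfplane_resolvent(1)[OF T] by blast
      have "M / (Re z - w) \<le> e"
      proof -
        have "\<bar>M\<bar> < e * (Re z - w)" using z e by (simp add: field_simps)
        then show ?thesis using zw by (simp add: field_simps)
      qed
      then have "M / (Re z - w) * norm x \<le> e * norm x" by (intro mult_right_mono) auto
      then show "norm (op.R z x) \<le> e * norm x" using halfplane_resolvent(2)[OF T zw, of x] by linarith
    qed
  qed
  ultimately have "mero_resolvent J D (\<lambda>x. (A x + (X x - F x)) + F x) {z. Re z > w1}"
    using mero_resolvent_finite_rank[OF F(1) P.coper_axioms _ op.small_at_infinity_perturb[OF _ E]] by blast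
  then show ?thesis by (simp add: mero_resolvent_def)
qed

end


section \<open>Riesz projections\<close>

abbreviation ee :: "real \<Rightarrow> complex" where "ee t \<equiv> exp (2 * of_real pi * \<i> * of_real t)"

lemma norm_ee [simp]: "cmod (ee t) = 1" by (simp add: norm_exp_eq_Re)

lemma ee_continuous [continuous_intros]: "continuous_on S (\<lambda>t. ee t)" by (intro continuous_intros)

lemma circle_in_sphere: "r \<ge> 0 \<Longrightarrow> c + of_real r * ee t \<in> sphere c r"
  by (simp add: dist_norm norm_mult)

lemma contour_integral_circle:
  "contour_integral (circlepath c r) f = 2 * pi * \<i> * integral {0..1} (\<lambda>t. (of_real r * ee t) * f (c + of_real r * ee t))"
  unfolding contour_integral_integral
  by (simp add: vector_derivative_circlepath circlepath[THEN fun_cong] mult_ac flip: integral_mult_right)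

lemma integral_circle_inverse:
  assumes "r > 0" "cmod (a - c) \<noteq> r"
  shows "integral {0..1} (\<lambda>t. (of_real r * ee t) / (c + of_real r * ee t - a)) = (if cmod (a - c) < r then 1 else 0)"
proof -
  have a: "a \<notin> path_image (circlepath c r)" using assms by (auto simp: dist_norm norm_minus_commute)
  have "winding_number (circlepath c r) a = 1 / (2 * pi * \<i>) * contour_integral (circlepath c r) (\<lambda>w. 1 / (w - a))"
    by (rule winding_number_valid_path[OF _ a]) simp
  also have "\<dots> = integral {0..1} (\<lambda>t. (of_real r * ee t) / (c + of_real r * ee t - a))"
    by (simp add: contour_integral_circle)
  finally have "integral {0..1} (\<lambda>t. (of_real r * ee t) / (c + of_real r * ee t - a)) = winding_number (circlepath c r) a" ..
  moreover have "winding_number (circlepath c r) a = 1" if "cmod (a - c) < r" using that by (rule winding_number_circlepath)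
  moreover have "winding_number (circlepath c r) a = 0" if "\<not> cmod (a - c) < r"
    by (rule winding_number_zero_outside[of _ "cball c r"])
       (use that assms in \<open>auto simp: dist_norm norm_minus_commute\<close>)
  ultimately show ?thesis by auto
qed

context coper
begin

abbreviation "riesz c r \<equiv> riesz_proj J D A c r"

lemma riesz_eq: "riesz c r x = integral {0..1} (\<lambda>t. (of_real r * ee t) \<odot> R (c + of_real r * ee t) x)"
  unfolding riesz_proj_def
  by (intro integral_cong) (simp add: vector_derivative_circlepath01 circlepath[THEN fun_cong])

lemma circle_R_continuous:
  assumes "sphere c r \<subseteq> \<rho>" "r \<ge> 0"
  shows "continuous_on S (\<lambda>t. R (c + of_real r * ee t) x)"
  by (rule continuous_on_compose2[OF R_continuous])
     (use assms circle_in_sphere[OF assms(2)] in \<open>auto intro!: continuous_intros simp: subset_eq\<close>)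

lemma riesz_linear_image:
  assumes s: "sphere c r \<subseteq> \<rho>" "r \<ge> 0" and E: "bounded_linear E"
  shows "E (riesz c r x) = integral {0..1} (\<lambda>t. E ((of_real r * ee t) \<odot> R (c + of_real r * ee t) x))"
proof -
  have "(\<lambda>t. (of_real r * ee t) \<odot> R (c + of_real r * ee t) x) integrable_on {0..1}"
    by (intro integrable_continuous_interval continuous_intros circle_R_continuous s)
  from integral_linear[OF this E] show ?thesis by (simp add: riesz_eq o_def)
qed

lemma riesz_functional:
  assumes s: "sphere c r \<subseteq> \<rho>" "r \<ge> 0" and f: "clin J f"
  shows "f (riesz c r x) = contour_integral (circlepath c r) (\<lambda>w. f (R w x)) / (2 * pi * \<i>)"
  by (subst riesz_linear_image[OF s clinD(1)[OF f]]) (simp add: clinD(2)[OF f] contour_integral_circle)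

text \<open>For each x the function \<open>R w x\<close> of w is continuous on the compact sphere;
  uniform boundedness turns these separate bounds into one operator bound.\<close>

lemma sphere_R_bound:
  assumes "sphere c r \<subseteq> \<rho>"
  obtains K where "K > 0" "\<And>w x. w \<in> sphere c r \<Longrightarrow> norm (R w x) \<le> K * norm x"
proof -
  have "\<exists>M. \<forall>g\<in>R ` sphere c r. onorm g \<le> M"
  proof (rule uniform_boundedness)
    show "bounded_linear g" if "g \<in> R ` sphere c r" for g using that assms R_props(4) by auto
    fix x
    have "bounded ((\<lambda>w. R w x) ` sphere c r)"
      using assms by (intro compact_imp_bounded compact_continuous_image continuous_on_subset[OF R_continuous]) auto
    then show "\<exists>K. \<forall>g\<in>R ` sphere c r. norm (g x) \<le> K" by (auto simp: bounded_iff)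
  qed
  then obtain M where "\<forall>g\<in>R ` sphere c r. onorm g \<le> M" by blast
  then have M: "\<And>w. w \<in> sphere c r \<Longrightarrow> onorm (R w) \<le> M" by auto
  have "norm (R w x) \<le> max M 1 * norm x" if "w \<in> sphere c r" for w x
  proof -
    have "norm (R w x) \<le> onorm (R w) * norm x" using that assms by (intro onorm R_props(4)) auto
    also have "\<dots> \<le> max M 1 * norm x" using M[OF that] by (intro mult_right_mono) auto
    finally show ?thesis .
  qed
  then show ?thesis by (intro that[of "max M 1"]) auto
qed

lemma riesz_norm_le:
  assumes "r \<ge> 0" "\<And>w x. w \<in> sphere c r \<Longrightarrow> norm (R w x) \<le> K * norm x" "sphere c r \<subseteq> \<rho>"
  shows "norm (riesz c r x) \<le> r * K * norm x"
proof -
  have "norm (riesz c r x) \<le> (r * K * norm x) * (1 - 0)"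
    unfolding riesz_eq
  proof (rule integral_bound)
    show "continuous_on {0..1} (\<lambda>t. (of_real r * ee t) \<odot> R (c + of_real r * ee t) x)"
      by (intro continuous_intros circle_R_continuous assms)
    show "norm ((of_real r * ee t) \<odot> R (c + of_real r * ee t) x) \<le> r * K * norm x" for t
      using mult_left_mono[OF assms(2)[OF circle_in_sphere[OF assms(1)]] assms(1)] assms(1)
      by (simp add: norm_mult mult.assoc)
  qed simp
  then show ?thesis by simp
qed

lemma riesz_cbounded:
  assumes s: "sphere c r \<subseteq> \<rho>" "r \<ge> 0"
  shows "cbounded J (riesz c r)"
  unfolding cbounded_def
proof
  obtain K where K: "K > 0" "\<And>w x. w \<in> sphere c r \<Longrightarrow> norm (R w x) \<le> K * norm x"
    using sphere_R_bound[OF s(1)] by blast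
  have inS: "c + of_real r * ee t \<in> \<rho>" for t using s circle_in_sphere[OF s(2)] by auto
  have int: "(\<lambda>t. (of_real r * ee t) \<odot> R (c + of_real r * ee t) x) integrable_on {0..1}" for x
    by (intro integrable_continuous_interval continuous_intros circle_R_continuous s)
  show "bounded_linear (riesz c r)"
  proof (rule bounded_linear_intro)
    show "riesz c r (x + y) = riesz c r x + riesz c r y" for x y
      unfolding riesz_eq by (subst integral_add[symmetric, OF int int]) (simp add: R_lin[OF inS] cm_add_right)
    show "riesz c r (k *\<^sub>R x) = k *\<^sub>R riesz c r x" for k x
    proof -
      have e: "(of_real r * ee t) \<odot> R (c + of_real r * ee t) (k *\<^sub>R x) = k *\<^sub>R ((of_real r * ee t) \<odot> R (c + of_real r * ee t) x)" for t
        using R_lin(3)[OF inS[of t], of "of_real k" x] by (simp add: cm_of_real cm_scaleR_right)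
      show ?thesis unfolding riesz_eq e by simp
    qed
    show "norm (riesz c r x) \<le> norm x * (r * K)" for x
      using riesz_norm_le[OF s(2) K(2) s(1), of x] by (simp add: mult_ac)
  qed
  show "\<forall>x. riesz c r (J x) = J (riesz c r x)"
  proof
    fix x
    have e: "(of_real r * ee t) \<odot> R (c + of_real r * ee t) (J x) = J ((of_real r * ee t) \<odot> R (c + of_real r * ee t) x)" for t
      using R_lin(3)[OF inS[of t], of \<i> x] by (simp add: cm_ii cm_J)
    show "riesz c r (J x) = J (riesz c r x)"
      unfolding riesz_linear_image[OF s J.bounded_linear_axioms] unfolding riesz_eq e ..
  qed
qed

lemma riesz_commute:
  assumes s: "sphere c r \<subseteq> \<rho>" "r \<ge> 0" and E: "cbounded J E" "\<And>w x. w \<in> \<rho> \<Longrightarrow> E (R w x) = R w (E x)"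
  shows "E (riesz c r x) = riesz c r (E x)"
proof -
  have inS: "c + of_real r * ee t \<in> \<rho>" for t using s circle_in_sphere[OF s(2)] by auto
  show ?thesis
    by (subst riesz_linear_image[OF s cboundedD(1)[OF E(1)]])
       (simp add: riesz_eq cboundedD(3)[OF E(1)] E(2)[OF inS])
qed

lemma R_eigenvector:
  assumes "u \<in> D" "A u = l \<odot> u" "w \<in> \<rho>" "w \<noteq> l"
  shows "R w u = (1 / (w - l)) \<odot> u"
proof (rule R_unique[OF assms(3)])
  show "(1 / (w - l)) \<odot> u \<in> D" by (rule D_cm[OF assms(1)])
  have "w \<odot> (1 / (w - l)) \<odot> u - A ((1 / (w - l)) \<odot> u) = (w * (1 / (w - l)) - (1 / (w - l)) * l) \<odot> u"
    using assms(1,2) by (simp add: A_cm cm_diff_left)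
  also have "w * (1 / (w - l)) - (1 / (w - l)) * l = (w - l) * (1 / (w - l))" by (simp only: left_diff_distrib mult.commute)
  also have "\<dots> = 1" using assms(4) by simp
  finally show "w \<odot> (1 / (w - l)) \<odot> u - A ((1 / (w - l)) \<odot> u) = u" by simp
qed

lemma riesz_eigenvector:
  assumes s: "sphere c r \<subseteq> \<rho>" "r > 0" and u: "u \<in> D" "A u = l \<odot> u" and l: "cmod (l - c) \<noteq> r"
  shows "riesz c r u = (if cmod (l - c) < r then u else 0)"
proof -
  have inS: "c + of_real r * ee t \<in> \<rho>" for t using s circle_in_sphere[of r] by auto
  have ne: "c + of_real r * ee t \<noteq> l" for t
    using l circle_in_sphere[of r c t] s(2) by (auto simp: dist_norm norm_minus_commute)
  have "riesz c r u = integral {0..1} (\<lambda>t. ((of_real r * ee t) / (c + of_real r * ee t - l)) \<odot> u)"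
    unfolding riesz_eq by (simp add: R_eigenvector[OF u inS ne])
  also have "\<dots> = integral {0..1} (\<lambda>t. (of_real r * ee t) / (c + of_real r * ee t - l)) \<odot> u"
  proof -
    have "(\<lambda>t. (of_real r * ee t) / (c + of_real r * ee t - l)) integrable_on {0..1}"
      using ne by (intro integrable_continuous_interval continuous_intros) auto
    from integral_linear[OF this cm.bounded_linear_left] show ?thesis by (simp add: o_def)
  qed
  finally show ?thesis using integral_circle_inverse[OF s(2) l] by simp
qed

text \<open>The resolvent identity splits the product of resolvents into two terms divided by
  \<open>w - z\<close>. For w on the larger circle, integrating 1/(w - z) over the smaller one gives
  0; for z on the smaller circle, the larger one winds once around z and gives 1. So only one term
  survives.\<close>

lemma riesz_composition:
  assumes r: "0 < r1" "r1 < r2" and s: "sphere c r1 \<subseteq> \<rho>" "sphere c r2 \<subseteq> \<rho>"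
  shows "riesz c r2 (riesz c r1 x) = riesz c r1 x"
proof -
  define w where "w t = c + of_real r2 * ee t" for t
  define z where "z t = c + of_real r1 * ee t" for t
  define a where "a t = of_real r2 * ee t" for t
  define b where "b t = of_real r1 * ee t" for t
  have w\<rho>: "w t \<in> \<rho>" and z\<rho>: "z t \<in> \<rho>" for t
    using s r circle_in_sphere[of r1 c t] circle_in_sphere[of r2 c t] by (auto simp: w_def z_def)
  have mw: "cmod (w t - c) = r2" and mz: "cmod (z t - c) = r1" for t using r by (auto simp: w_def z_def norm_mult)
  have ne: "w u \<noteq> z t" for t u using mw[of u] mz[of t] r by auto
  have cont: "continuous_on S w" "continuous_on S z" "continuous_on S a" "continuous_on S b" for S
    unfolding w_def z_def a_def b_def by (intro continuous_intros)+
  have cR: "continuous_on S (\<lambda>t. R (z t) x)" "continuous_on S (\<lambda>t. R (w t) x)" for S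
    using circle_R_continuous[OF s(1)] circle_R_continuous[OF s(2)] r by (auto simp: w_def z_def)
  have in1: "integral {0..1} (\<lambda>t. a t / (w t - z u)) = 1" for u
    using integral_circle_inverse[of r2 "z u" c] mz[of u] r by (simp add: a_def w_def)
  have in2: "integral {0..1} (\<lambda>t. b t / (w u - z t)) = 0" for u
  proof -
    have "integral {0..1} (\<lambda>t. - (b t / (w u - z t))) = integral {0..1} (\<lambda>t. b t / (z t - w u))"
      by (intro integral_cong) (metis minus_diff_eq minus_divide_right)
    also have "\<dots> = 0" using integral_circle_inverse[of r1 "w u" c] mw[of u] r by (simp add: b_def z_def)
    finally show ?thesis by simp
  qed
  have pull: "integral {0..1} (\<lambda>t. g t \<odot> y) = integral {0..1} g \<odot> y" if "continuous_on {0..1} g" for g :: "real \<Rightarrow> complex" and y :: 'a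
    using integral_linear[OF integrable_continuous_interval[OF that] cm.bounded_linear_left] by (simp add: o_def)
  have "riesz c r2 (riesz c r1 x) = integral {0..1} (\<lambda>u. a u \<odot> R (w u) (riesz c r1 x))"
    by (simp add: riesz_eq[of c r2] a_def w_def)
  also have "\<dots> = integral {0..1} (\<lambda>u. integral {0..1} (\<lambda>t. (a u * b t / (w u - z t)) \<odot> R (z t) x))"
  proof (rule integral_cong)
    fix u
    have id: "(a u * b t) \<odot> R (w u) (R (z t) x) = (a u * b t / (w u - z t)) \<odot> R (z t) x - (a u * b t / (w u - z t)) \<odot> R (w u) x" for t
    proof -
      have "R (z t) x - R (w u) x = (w u - z t) \<odot> R (w u) (R (z t) x)"
        using resolvent_identity[OF z\<rho> w\<rho>] R_commute[OF z\<rho> w\<rho>] by simp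
      then have "(a u * b t / (w u - z t)) \<odot> (R (z t) x - R (w u) x) = (a u * b t) \<odot> R (w u) (R (z t) x)"
        using ne by simp
      then show ?thesis by (simp add: cm_diff_right)
    qed
    have "a u \<odot> R (w u) (riesz c r1 x) = integral {0..1} (\<lambda>t. a u \<odot> R (w u) (b t \<odot> R (z t) x))"
      using riesz_linear_image[OF s(1) less_imp_le[OF r(1)] bounded_linear_compose[OF cm.bounded_linear_right R_props(4)[OF w\<rho>]]]
      by (simp add: b_def z_def)
    also have "\<dots> = integral {0..1} (\<lambda>t. (a u * b t / (w u - z t)) \<odot> R (z t) x - (a u * b t / (w u - z t)) \<odot> R (w u) x)"
      by (simp add: R_lin[OF w\<rho>] id)
    also have "\<dots> = integral {0..1} (\<lambda>t. (a u * b t / (w u - z t)) \<odot> R (z t) x) - integral {0..1} (\<lambda>t. (a u * b t / (w u - z t)) \<odot> R (w u) x)"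
      using ne by (intro integral_diff integrable_continuous_interval continuous_intros cont cR) auto
    also have "integral {0..1} (\<lambda>t. (a u * b t / (w u - z t)) \<odot> R (w u) x) = integral {0..1} (\<lambda>t. a u * (b t / (w u - z t))) \<odot> R (w u) x"
      using ne by (subst pull) (auto intro!: continuous_intros cont)
    also have "integral {0..1} (\<lambda>t. a u * (b t / (w u - z t))) = 0" by (simp only: integral_mult_right in2 mult_zero_right)
    finally show "a u \<odot> R (w u) (riesz c r1 x) = integral {0..1} (\<lambda>t. (a u * b t / (w u - z t)) \<odot> R (z t) x)" by simp
  qed
  also have "\<dots> = integral {0..1} (\<lambda>t. integral {0..1} (\<lambda>u. (a u * b t / (w u - z t)) \<odot> R (z t) x))"
  proof -
    have c2: "continuous_on S (\<lambda>(u, t). (a u * b t / (w u - z t)) \<odot> R (z t) x)" for S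
    proof -
      have comp: "continuous_on S (\<lambda>p. g (fst p))" "continuous_on S (\<lambda>p. g (snd p))"
        if "continuous_on UNIV g" for g :: "real \<Rightarrow> 'c::topological_space" and S :: "(real \<times> real) set"
        by (rule continuous_on_compose2[OF that], auto intro!: continuous_intros)+
      note cs = comp[OF cont(1)] comp[OF cont(2)] comp[OF cont(3)] comp[OF cont(4)]
      show ?thesis unfolding case_prod_unfold
        by (intro continuous_intros cs comp(2)[OF cR(1)]) (use ne in auto)
    qed
    from integral_swap_continuous[OF c2, of 0 1 0 1] show ?thesis by simp
  qed
  also have "\<dots> = integral {0..1} (\<lambda>t. b t \<odot> R (z t) x)"
  proof (rule integral_cong)
    fix t
    have "integral {0..1} (\<lambda>u. (a u * b t / (w u - z t)) \<odot> R (z t) x) = integral {0..1} (\<lambda>u. b t * (a u / (w u - z t))) \<odot> R (z t) x"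
      using ne by (subst pull[symmetric]) (auto intro!: continuous_intros cont simp: mult_ac)
    also have "integral {0..1} (\<lambda>u. b t * (a u / (w u - z t))) = b t" by (simp only: integral_mult_right in1 mult_1_right)
    finally show "integral {0..1} (\<lambda>u. (a u * b t / (w u - z t)) \<odot> R (z t) x) = b t \<odot> R (z t) x" .
  qed
  also have "\<dots> = riesz c r1 x" by (simp add: riesz_eq b_def z_def)
  finally show ?thesis .
qed

text \<open>Tested against the functionals \<open>cin y\<close>, both sides are the sum of the
  residues at the points of \<Sigma>, whatever the type of these isolated singularities.\<close>

lemma riesz_sum_circles:
  assumes H: "open H" "convex H" "finite \<Sigma>" "H - \<Sigma> \<subseteq> \<rho>" and C: "cball C r \<subseteq> H" "\<Sigma> \<subseteq> ball C r" "r > 0"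
    and small: "s > 0" "\<And>l. l \<in> \<Sigma> \<Longrightarrow> cball l s - {l} \<subseteq> \<rho>"
  shows "riesz C r x = (\<Sum>l\<in>\<Sigma>. riesz l s x)"
proof (rule cin_eqI)
  fix y
  note f = cin_clin[of y]
  let ?g = "\<lambda>w. cin y (R w x)"
  have sC: "sphere C r \<subseteq> \<rho>"
  proof
    fix w assume "w \<in> sphere C r"
    then have "w \<in> H" "w \<notin> \<Sigma>" using C by auto
    then show "w \<in> \<rho>" using H by auto
  qed
  have sl: "sphere l s \<subseteq> \<rho>" if "l \<in> \<Sigma>" for l
  proof
    fix w assume w: "w \<in> sphere l s"
    then have "w \<in> cball l s - {l}" using small(1) by auto
    then show "w \<in> \<rho>" using small(2)[OF that] by blast
  qed
  have hol: "?g holomorphic_on H - \<Sigma>" using R_holomorphic[OF f] H(4) holomorphic_on_subset by blast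
  have "contour_integral (circlepath C r) ?g = 2 * pi * \<i> * (\<Sum>p\<in>\<Sigma>. winding_number (circlepath C r) p * residue ?g p)"
  proof (rule Residue_theorem[OF H(1) convex_connected[OF H(2)] H(3) hol])
    show "path_image (circlepath C r) \<subseteq> H - \<Sigma>" using C by auto
    show "\<forall>z. z \<notin> H \<longrightarrow> winding_number (circlepath C r) z = 0"
      using C by (intro allI impI winding_number_zero_outside[of _ H]) (auto simp: H)
  qed auto
  also have "(\<Sum>p\<in>\<Sigma>. winding_number (circlepath C r) p * residue ?g p) = (\<Sum>p\<in>\<Sigma>. residue ?g p)"
  proof (rule sum.cong[OF refl])
    fix p assume "p \<in> \<Sigma>"
    then have "cmod (p - C) < r" using C(2) by (auto simp: dist_norm norm_minus_commute)
    then show "winding_number (circlepath C r) p * residue ?g p = residue ?g p" by (simp add: winding_number_circlepath)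
  qed
  finally have 1: "cin y (riesz C r x) = (\<Sum>p\<in>\<Sigma>. residue ?g p)"
    using riesz_functional[OF sC _ f] C(3) by simp
  have "cin y (riesz l s x) = residue ?g l" if l: "l \<in> \<Sigma>" for l
  proof -
    have "(?g has_contour_integral 2 * pi * \<i> * residue ?g l) (circlepath l s)"
    proof (rule base_residue)
      show "open (\<rho> \<union> ball l s)" using open_rho by auto
      show "l \<in> \<rho> \<union> ball l s" using small(1) by simp
      have "\<rho> \<union> ball l s - {l} \<subseteq> \<rho>" using small(2)[OF l] ball_subset_cball by blast
      then show "?g holomorphic_on \<rho> \<union> ball l s - {l}" by (rule holomorphic_on_subset[OF R_holomorphic[OF f]])
      show "cball l s \<subseteq> \<rho> \<union> ball l s" using small(1) small(2)[OF l] centre_in_ball by blast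
    qed (rule small)
    then show ?thesis using riesz_functional[OF sl[OF l] _ f] small(1) by (simp add: contour_integral_unique)
  qed
  moreover have "cin y (\<Sum>l\<in>\<Sigma>. riesz l s x) = (\<Sum>l\<in>\<Sigma>. cin y (riesz l s x))"
    using linear_sum[OF bounded_linear.linear[OF clinD(1)[OF f]]] .
  ultimately show "cin y (riesz C r x) = cin y (\<Sum>l\<in>\<Sigma>. riesz l s x)" using 1 by simp
qed

end


section \<open>The spectral projection of a half-plane\<close>

text \<open>A bounded part of a half-plane lies in a disc inside any larger half-plane, so circles suffice
  as contours enclosing the whole unstable spectrum.\<close>

lemma half_plane_disc:
  fixes b w0 R0 :: real
  assumes "b < w0"
  obtains C where "C > b" "\<And>z. Re z \<ge> w0 \<Longrightarrow> cmod z \<le> R0 \<Longrightarrow> cmod (z - of_real C) < C - b"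
proof -
  \<comment> \<open>Expanding both squares, the claim for these z reduces to R0^2 < 2 C (w0 - b).
    The quotient in C provides this, and the summand \<open>\<bar>b\<bar> + 1\<close> makes it
    strict and gives C > b.\<close>
  define C where "C = \<bar>b\<bar> + 1 + R0\<^sup>2 / (w0 - b)"
  have q: "R0\<^sup>2 / (w0 - b) \<ge> 0" using assms by simp
  have Cb: "C > b" "C \<ge> 0" using q by (auto simp: C_def)
  have "C * (w0 - b) = \<bar>b\<bar> * (w0 - b) + (w0 - b) + R0\<^sup>2"
    using assms by (simp add: C_def distrib_right)
  then have "C * (w0 - b) \<ge> R0\<^sup>2 + (w0 - b)"
    using assms mult_nonneg_nonneg[of "\<bar>b\<bar>" "w0 - b"] by linarith
  then have C2: "2 * (C * (w0 - b)) > R0\<^sup>2"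
    using assms zero_le_power2[of R0] by linarith
  show ?thesis
  proof (rule that[OF Cb(1)])
    fix z assume z: "Re z \<ge> w0" "cmod z \<le> R0"
    have 1: "(cmod z)\<^sup>2 \<le> R0\<^sup>2" using z by (intro power_mono) auto
    have 2: "C * Re z \<ge> C * w0" using z Cb by (intro mult_left_mono) auto
    have 3: "(cmod (z - of_real C))\<^sup>2 = (cmod z)\<^sup>2 - 2 * (C * Re z) + C\<^sup>2"
      unfolding cmod_power2 by (simp add: power2_eq_square algebra_simps)
    have 4: "(C - b)\<^sup>2 = C\<^sup>2 - 2 * (C * b) + b\<^sup>2" by (simp add: power2_eq_square algebra_simps)
    have 5: "2 * (C * w0) - 2 * (C * b) > R0\<^sup>2" using C2 by (simp only: right_diff_distrib)
    have less: "p - 2 * q + r < r - 2 * s + t" if "p \<le> d" "q \<ge> v" "2 * v - 2 * s > d" "t \<ge> 0" for p q r s t d v :: real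
      using that by linarith
    have "(cmod (z - of_real C))\<^sup>2 < (C - b)\<^sup>2"
      unfolding 3 4 by (rule less[OF 1 2 5 zero_le_power2])
    from power2_less_imp_less[OF this] show "cmod (z - of_real C) < C - b" using Cb(1) by simp
  qed
qed

lemma finite_separated:
  fixes S :: "'m::metric_space set"
  assumes "finite S"
  obtains d where "d > 0" "\<And>x y. x \<in> S \<Longrightarrow> y \<in> S \<Longrightarrow> x \<noteq> y \<Longrightarrow> dist x y \<ge> d"
proof -
  define Q where "Q = insert 1 ((\<lambda>(x, y). dist x y) ` (S \<times> S - {p. fst p = snd p}))"
  have Q: "finite Q" "Q \<noteq> {}" "\<And>q. q \<in> Q \<Longrightarrow> q > 0" using assms by (auto simp: Q_def)
  show ?thesis
  proof (rule that[of "Min Q"])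
    show "Min Q > 0" using Q by simp
    fix x y assume "x \<in> S" "y \<in> S" "x \<noteq> y"
    then have "dist x y \<in> Q" by (force simp: Q_def)
    then show "Min Q \<le> dist x y" using Q by simp
  qed
qed

context coper
begin

text \<open>Otherwise z - A is bounded below by e, hence the resolvents at points within e/2 of z
  are bounded by 2/e, and \<open>rho_limit\<close> would put z into \<open>\<rho>\<close>.\<close>

lemma approx_eigenvector:
  assumes z: "z \<notin> \<rho>" and w: "\<And>n::nat. w n \<in> \<rho>" "w \<longlonglongrightarrow> z" and e: "e > 0"
  shows "\<exists>u\<in>D. norm u = 1 \<and> norm (z \<odot> u - A u) \<le> e"
proof (rule ccontr)
  assume no: "\<not> ?thesis"
  have low: "norm (z \<odot> u - A u) \<ge> e * norm u" if u: "u \<in> D" for u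
  proof (cases "u = 0")
    case False
    define v where "v = (1 / norm u) *\<^sub>R u"
    have "v \<in> D" "norm v = 1" using False u by (auto simp: v_def D_scaleR)
    then have "norm (z \<odot> v - A v) > e" using no by auto
    moreover have "z \<odot> v - A v = (1 / norm u) *\<^sub>R (z \<odot> u - A u)"
      using u by (simp add: v_def A_scaleR cm_scaleR_right scaleR_diff_right)
    then have "norm (z \<odot> v - A v) = (1 / norm u) * norm (z \<odot> u - A u)" by (simp only: norm_scaleR) simp
    ultimately have "(1 / norm u) * norm (z \<odot> u - A u) > e" by simp
    then show ?thesis using False by (simp add: field_simps)
  qed simp
  obtain N where N: "\<And>n. n \<ge> N \<Longrightarrow> dist (w n) z < e / 2" using metric_LIMSEQ_D[OF w(2), of "e/2"] e by auto
  have "norm (R (w (n + N)) x) \<le> 2 / e * norm x" for n x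
  proof -
    define u where "u = R (w (n + N)) x"
    have u: "u \<in> D" "w (n + N) \<odot> u - A u = x" unfolding u_def using R_props[OF w(1)] by auto
    have "z \<odot> u - A u = x + (z - w (n + N)) \<odot> u" using u(2) by (simp add: cm_diff_left algebra_simps)
    then have "e * norm u \<le> norm x + cmod (z - w (n + N)) * norm u"
      using low[OF u(1)] norm_triangle_ineq[of x "(z - w (n + N)) \<odot> u"] by simp
    also have "\<dots> \<le> norm x + e / 2 * norm u"
      using N[of "n + N"] by (intro add_left_mono mult_right_mono) (auto simp: dist_norm norm_minus_commute)
    finally show ?thesis using e unfolding u_def[symmetric] by (simp add: field_simps)
  qed
  moreover have "(\<lambda>n. w (n + N)) \<longlonglongrightarrow> z" using w(2) by (rule LIMSEQ_ignore_initial_segment)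
  ultimately have "z \<in> \<rho>" using e w(1) by (intro rho_limit[of "\<lambda>n. w (n + N)" z "2 / e"]) auto
  then show False using z by simp
qed

end

text \<open>Points of \<Sigma> may lie on the line Re z = w0 itself; the strip down to w2, free of
  spectrum, provides the room for contours around them.\<close>

locale spectral = coper J D A for J :: "'a::{banach,real_inner} \<Rightarrow> 'a" and D A +
  fixes w0 w2 :: real
  assumes w2: "w2 < w0" and fin: "finite (Sigma_set J D A w0)"
    and gap: "{z. Re z > w2} - Sigma_set J D A w0 \<subseteq> resolvent_set J D A"
begin

abbreviation "\<Sigma> \<equiv> Sigma_set J D A w0"
abbreviation "P \<equiv> total_proj J D A w0"
abbreviation "r0 \<equiv> riesz_radius J D A w0"

lemma Sigma_iff: "l \<in> \<Sigma> \<longleftrightarrow> l \<notin> \<rho> \<and> Re l \<ge> w0"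
  by (auto simp: Sigma_set_def spectrum_op_def)

text \<open>\<open>riesz_radius\<close> is a choice, so it says something only once a suitable
  radius is exhibited: d/3 keeps the discs apart, half the width of the strip keeps them to the
  right of w2.\<close>

lemma r0: "r0 > 0" "l \<in> \<Sigma> \<Longrightarrow> cball l r0 - {l} \<subseteq> \<rho>"
proof -
  obtain d where d: "d > 0" "\<And>x y. x \<in> \<Sigma> \<Longrightarrow> y \<in> \<Sigma> \<Longrightarrow> x \<noteq> y \<Longrightarrow> dist x y \<ge> d"
    using finite_separated[OF fin] by blast
  define r where "r = min (d / 3) ((w0 - w2) / 2)"
  have r: "r > 0" "r \<le> d / 3" "r \<le> (w0 - w2) / 2"
    using d(1) w2 min.cobounded1[of "d / 3" "(w0 - w2) / 2"] min.cobounded2[of "d / 3" "(w0 - w2) / 2"]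
    unfolding r_def by simp_all
  have 1: "cball l r - {l} \<subseteq> \<rho>" if l: "l \<in> \<Sigma>" for l
  proof
    fix z assume z: "z \<in> cball l r - {l}"
    have "\<bar>Re (l - z)\<bar> \<le> r" using z abs_Re_le_cmod[of "l - z"] by (simp add: dist_norm)
    then have "Re z > w2" using l r(3) w2 by (simp add: Sigma_iff abs_le_iff)
    moreover have "z \<notin> \<Sigma>" using d(2)[OF l, of z] z r(1,2) by auto
    ultimately show "z \<in> \<rho>" using gap by auto
  qed
  have 2: "cball l r \<inter> cball m r = {}" if "l \<in> \<Sigma>" "m \<in> \<Sigma>" "l \<noteq> m" for l m
  proof -
    have False if "z \<in> cball l r" "z \<in> cball m r" for z
      using dist_triangle2[of l m z] d(2)[OF \<open>l \<in> \<Sigma>\<close> \<open>m \<in> \<Sigma>\<close> \<open>l \<noteq> m\<close>] that r d(1) by auto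
    then show ?thesis by blast
  qed
  have "\<exists>r. r > 0 \<and> (\<forall>l\<in>\<Sigma>. cball l r - {l} \<subseteq> \<rho>) \<and> (\<forall>l\<in>\<Sigma>. \<forall>\<mu>\<in>\<Sigma>. l \<noteq> \<mu> \<longrightarrow> cball l r \<inter> cball \<mu> r = {})"
    using r(1) 1 2 by blast
  from someI_ex[OF this] show "r0 > 0" "l \<in> \<Sigma> \<Longrightarrow> cball l r0 - {l} \<subseteq> \<rho>"
    unfolding riesz_radius_def by blast+
qed

lemma r0_sphere: assumes "l \<in> \<Sigma>" shows "sphere l r0 \<subseteq> \<rho>"
proof
  fix z assume "z \<in> sphere l r0"
  then have "z \<in> cball l r0 - {l}" using r0(1) by auto
  then show "z \<in> \<rho>" using r0(2)[OF assms] by blast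
qed

lemma P_eq: "P = (\<lambda>x. \<Sum>l\<in>\<Sigma>. riesz l r0 x)"
  by (simp add: total_proj_def fun_eq_iff)

lemma P_cbounded: "cbounded J P"
proof -
  have "cbounded J (\<lambda>x. \<Sum>l\<in>S. riesz l r0 x)" if "S \<subseteq> \<Sigma>" for S
    using finite_subset[OF that fin] that
  proof (induction S rule: finite_induct)
    case empty
    then show ?case by (simp add: cbounded_def J.zero bounded_linear_zero)
  next
    case (insert l S)
    then show ?case using riesz_cbounded[OF r0_sphere less_imp_le[OF r0(1)]] by (simp add: cbounded_add)
  qed
  then show ?thesis by (simp add: P_eq)
qed

lemma P_commute:
  assumes E: "cbounded J E" "\<And>w x. w \<in> \<rho> \<Longrightarrow> E (R w x) = R w (E x)"
  shows "E (P x) = P (E x)"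
proof -
  have "E (\<Sum>l\<in>\<Sigma>. riesz l r0 x) = (\<Sum>l\<in>\<Sigma>. E (riesz l r0 x))"
    using linear_sum[OF bounded_linear.linear[OF cboundedD(1)[OF E(1)]]] .
  also have "\<dots> = (\<Sum>l\<in>\<Sigma>. riesz l r0 (E x))"
    by (intro sum.cong refl riesz_commute[OF r0_sphere less_imp_le[OF r0(1)] E])
  finally show ?thesis by (simp add: P_eq)
qed

text \<open>On an eigenvector each Riesz projection is a scalar Cauchy integral, equal to 1 for the
  disc around l and 0 for the others. This later gives uniqueness in the reduced equation.\<close>

lemma P_eigenvector:
  assumes u: "u \<in> D" "A u = l \<odot> u" "u \<noteq> 0" and l: "Re l > w2"
  shows "l \<in> \<Sigma>" "P u = u"
proof -
  have nr: "l \<notin> \<rho>"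
  proof
    assume "l \<in> \<rho>"
    from R_props(3)[OF this u(1)] u(2,3) show False by (simp add: R_lin[OF \<open>l \<in> \<rho>\<close>])
  qed
  then show ls: "l \<in> \<Sigma>" using gap l by blast
  have "riesz m r0 u = (if m = l then u else 0)" if m: "m \<in> \<Sigma>" for m
  proof (cases "m = l")
    case True
    then show ?thesis using riesz_eigenvector[OF r0_sphere[OF m] r0(1) u(1,2)] r0(1) by simp
  next
    case False
    then have "l \<notin> cball m r0" using r0(2)[OF m] nr by blast
    then show ?thesis using riesz_eigenvector[OF r0_sphere[OF m] r0(1) u(1,2)] False
      by (auto simp: dist_norm norm_minus_commute)
  qed
  then have "P u = (\<Sum>m\<in>\<Sigma>. if m = l then u else 0)" unfolding P_eq by (intro sum.cong) auto
  also have "\<dots> = u" using ls fin by simp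
  finally show "P u = u" .
qed

text \<open>Applied to eigenvalues left of the threshold: their eigenvectors belong to the kernel of
  P, where a decay estimate can be tested.\<close>

lemma P_foreign_eigenvector:
  assumes u: "u \<in> D" "A u = l \<odot> u" and l: "l \<notin> \<Sigma>"
  shows "P u = 0"
proof (cases "u = 0")
  case True
  interpret b: bounded_linear P by (rule cboundedD[OF P_cbounded])
  show ?thesis using True b.zero by simp
next
  case False
  have nr: "l \<notin> \<rho>"
  proof
    assume "l \<in> \<rho>"
    from R_props(3)[OF this u(1)] u(2) False show False by (simp add: R_lin[OF \<open>l \<in> \<rho>\<close>])
  qed
  have "riesz m r0 u = 0" if m: "m \<in> \<Sigma>" for m
  proof -
    have "l \<notin> cball m r0" using r0(2)[OF m] nr l m by blast
    then show ?thesis using riesz_eigenvector[OF r0_sphere[OF m] r0(1) u]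
      by (auto simp: dist_norm norm_minus_commute)
  qed
  then show ?thesis by (simp add: P_eq)
qed

text \<open>The circle touches the line Re z = b from the right, so it stays in the half-plane where
  all spectrum belongs to \<Sigma>, and the sum over small circles collapses to it.\<close>

lemma P_circle:
  assumes "b > w2" "r = C - b" "r > 0" "\<Sigma> \<subseteq> ball (of_real C) r"
  shows "P x = riesz (of_real C) r x" "sphere (of_real C) r \<subseteq> \<rho>"
proof -
  have sub: "cball (of_real C) r \<subseteq> {z. Re z > w2}"
  proof
    fix z :: complex assume "z \<in> cball (of_real C) r"
    then have "\<bar>Re (complex_of_real C - z)\<bar> \<le> r" using abs_Re_le_cmod[of "complex_of_real C - z"] by (simp add: dist_norm)
    then show "z \<in> {z. Re z > w2}" using assms by (auto simp: abs_le_iff)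
  qed
  show "P x = riesz (of_real C) r x"
    unfolding P_eq
    by (rule riesz_sum_circles[OF open_halfspace_Re_gt convex_halfspace_Re_gt fin gap sub, symmetric])
       (use assms r0 in auto)
  show "sphere (of_real C) r \<subseteq> \<rho>"
  proof
    fix z assume z: "z \<in> sphere (complex_of_real C) r"
    then have "z \<notin> \<Sigma>" "Re z > w2" using assms(4) sub by auto
    then show "z \<in> \<rho>" using gap by auto
  qed
qed

text \<open>Two concentric circles touching different vertical lines in the gap both represent P,
  and \<open>riesz_composition\<close> applies to the nested pair.\<close>

lemma P_idem: "P (P x) = P x"
proof -
  define d where "d = (w0 - w2) / 3"
  have d: "d > 0" "w2 + d < w0" "w2 + 2 * d < w0" using w2 by (auto simp: d_def field_simps)
  obtain R0 where R0: "\<And>l. l \<in> \<Sigma> \<Longrightarrow> cmod l \<le> R0" using finite_imp_bounded[OF fin] by (auto simp: bounded_iff)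
  obtain C where C: "C > w2 + 2 * d" "\<And>z. Re z \<ge> w0 \<Longrightarrow> cmod z \<le> R0 \<Longrightarrow> cmod (z - of_real C) < C - (w2 + 2 * d)"
    using half_plane_disc[OF d(3)] by blast
  have S1: "\<Sigma> \<subseteq> ball (of_real C) (C - (w2 + 2 * d))"
    using C(2) R0 by (auto simp: Sigma_iff dist_norm norm_minus_commute)
  have S2: "\<Sigma> \<subseteq> ball (of_real C) (C - (w2 + d))"
    using S1 d(1) by (force simp: subset_eq)
  note c1 = P_circle[OF _ refl _ S1] note c2 = P_circle[OF _ refl _ S2]
  have "riesz (of_real C) (C - (w2 + d)) (riesz (of_real C) (C - (w2 + 2 * d)) x) = riesz (of_real C) (C - (w2 + 2 * d)) x"
    by (rule riesz_composition) (use c1(2) c2(2) d C(1) in auto)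
  then show ?thesis using c1(1) c2(1) d C(1) by simp
qed

end


section \<open>Families of compact perturbations\<close>

locale pert_family = c0 J S D L for J :: "'a::{banach,real_inner} \<Rightarrow> 'a" and S D L +
  fixes B :: "'b::metric_space set" and K :: "'b \<Rightarrow> 'a \<Rightarrow> 'a" and U :: "'b \<Rightarrow> real \<Rightarrow> 'a \<Rightarrow> 'a"
    and M w w0 :: real
  assumes S_bound: "\<And>t x. t \<ge> 0 \<Longrightarrow> norm (S t x) \<le> M * exp (w * t) * norm x" and M: "M \<ge> 1" and w: "w < w0"
    and B: "compact B"
    and K_cb: "\<And>\<beta>. \<beta> \<in> B \<Longrightarrow> cbounded J (K \<beta>)" and K_compact: "\<And>\<beta>. \<beta> \<in> B \<Longrightarrow> compact_operator (K \<beta>)"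
    and K_cont: "continuous_on B (\<lambda>\<beta>. Blinfun (K \<beta>))"
    and U: "\<And>\<beta>. \<beta> \<in> B \<Longrightarrow> c0 J (U \<beta>) D (\<lambda>x. L x + K \<beta> x)"
begin

abbreviation "Lb \<beta> \<equiv> \<lambda>x. L x + K \<beta> x"
abbreviation "\<rho>b \<beta> \<equiv> resolvent_set J D (Lb \<beta>)"

lemma Lb_coper: "\<beta> \<in> B \<Longrightarrow> coper J D (Lb \<beta>)" by (rule op.perturb[OF K_cb])

lemma K_Blinfun: "\<beta> \<in> B \<Longrightarrow> blinfun_apply (Blinfun (K \<beta>)) = K \<beta>"
  by (rule bounded_linear_Blinfun_apply) (rule cboundedD(1)[OF K_cb])

lemma K_bound: obtains k where "k > 0" "\<And>\<beta> x. \<beta> \<in> B \<Longrightarrow> norm (K \<beta> x) \<le> k * norm x"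
proof -
  have "bounded ((\<lambda>\<beta>. Blinfun (K \<beta>)) ` B)" by (intro compact_imp_bounded compact_continuous_image K_cont B)
  then obtain k where k: "\<forall>\<beta>\<in>B. norm (Blinfun (K \<beta>)) \<le> k" by (auto simp: bounded_iff)
  have "norm (K \<beta> x) \<le> max k 1 * norm x" if "\<beta> \<in> B" for \<beta> x
  proof -
    have "norm (K \<beta> x) \<le> norm (Blinfun (K \<beta>)) * norm x"
      using norm_blinfun[of "Blinfun (K \<beta>)" x] K_Blinfun[OF that] by simp
    also have "\<dots> \<le> max k 1 * norm x" using k that by (intro mult_right_mono) (auto simp: le_max_iff_disj)
    finally show ?thesis .
  qed
  then show ?thesis by (intro that[of "max k 1"]) auto
qed

lemma uniform_growth:
  obtains m a where "m \<ge> 1" "a \<ge> 0" "\<And>\<beta> t x. \<beta> \<in> B \<Longrightarrow> t \<ge> 0 \<Longrightarrow> norm (U \<beta> t x) \<le> m * exp (a * t) * norm x"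
proof -
  obtain k where k: "k > 0" "\<And>\<beta> x. \<beta> \<in> B \<Longrightarrow> norm (K \<beta> x) \<le> k * norm x" using K_bound by blast
  show ?thesis
  proof (rule that[of M "\<bar>w + M * k\<bar>"])
    fix \<beta> t and x :: 'a assume b: "\<beta> \<in> B" and t: "(t::real) \<ge> 0"
    interpret p: c0_perturb J S D L "U \<beta>" "K \<beta>"
      by (intro c0_perturb.intro c0_perturb_axioms.intro c0_axioms U K_cb b)
    have "norm (U \<beta> t x) \<le> M * exp ((w + M * k) * t) * norm x"
      using p.perturbed_growth[OF S_bound M k(2)[OF b] k(1) t] by simp
    also have "\<dots> \<le> M * exp (\<bar>w + M * k\<bar> * t) * norm x"
      using M t by (intro mult_right_mono mult_left_mono) (auto intro: mult_right_mono)
    finally show "norm (U \<beta> t x) \<le> M * exp (\<bar>w + M * k\<bar> * t) * norm x" .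
  qed (use M in auto)
qed

lemma resolvent_bound:
  assumes "w < w1" "Re z \<ge> w1"
  shows "z \<in> op.\<rho>" "norm (op.R z x) \<le> M / (w1 - w) * norm x"
proof -
  show "z \<in> op.\<rho>" using halfplane_resolvent(1)[OF S_bound, of z] assms by simp
  have "norm (op.R z x) \<le> M / (Re z - w) * norm x" using halfplane_resolvent(2)[OF S_bound, of z x] assms by simp
  also have "\<dots> \<le> M / (w1 - w) * norm x"
    using assms M by (intro mult_right_mono divide_left_mono mult_pos_pos) auto
  finally show "norm (op.R z x) \<le> M / (w1 - w) * norm x" .
qed

text \<open>For y in the domain, z R(z) y = y + R(z) L y is bounded, so R(z) y is of order 1/|z|.
  The uniform resolvent bound extends this to all v by density, which is why the rate depends on
  v.\<close>

lemma resolvent_vanishes: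
  assumes w1: "w < w1" and e: "e > 0"
  shows "\<exists>C. \<forall>z. Re z \<ge> w1 \<longrightarrow> C \<le> cmod z \<longrightarrow> norm (op.R z v) \<le> e"
proof -
  define c where "c = M / (w1 - w)"
  have c: "c > 0" using M w1 by (simp add: c_def)
  obtain y where y: "\<And>n. y n \<in> D" "y \<longlonglongrightarrow> v" using D_dense by blast
  obtain n where "dist (y n) v < e / (2 * c)" using metric_LIMSEQ_D[OF y(2), of "e / (2 * c)"] e c by auto
  then have n: "c * norm (v - y n) \<le> e / 2" using c by (simp add: dist_norm norm_minus_commute field_simps)
  define b where "b = norm (y n) + c * norm (L (y n))"
  have b: "b \<ge> 0" using c by (simp add: b_def)
  show ?thesis
  proof (intro exI[of _ "2 * b / e + 1"] allI impI)
    fix z assume z: "Re z \<ge> w1" "2 * b / e + 1 \<le> cmod z"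
    note r = resolvent_bound[OF w1 z(1), folded c_def]
    have z0: "cmod z > 0" using z(2) b e by (meson add_nonneg_pos divide_nonneg_pos less_le_trans mult_nonneg_nonneg zero_le_numeral zero_less_one)
    have "op.R z (z \<odot> y n - L (y n)) = y n" by (rule op.R_props(3)[OF r(1) y(1)])
    then have "z \<odot> op.R z (y n) = y n + op.R z (L (y n))" by (simp add: op.R_lin[OF r(1)] algebra_simps)
    then have "cmod z * norm (op.R z (y n)) = norm (y n + op.R z (L (y n)))" using cm_norm by metis
    also have "\<dots> \<le> b" unfolding b_def using r(2)[of "L (y n)"] norm_triangle_ineq[of "y n" "op.R z (L (y n))"] by linarith
    also have "b \<le> cmod z * (e / 2)" using z(2) e by (simp add: field_simps)
    finally have 1: "norm (op.R z (y n)) \<le> e / 2" using z0 by simp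
    have eq: "op.R z v = op.R z (v - y n) + op.R z (y n)" by (simp add: op.R_lin[OF r(1)])
    show "norm (op.R z v) \<le> e"
      using arg_cong[OF eq, of norm] 1 r(2)[of "v - y n"] n norm_triangle_ineq[of "op.R z (v - y n)" "op.R z (y n)"] by linarith
  qed
qed

lemma approx_eigenvectors_converge:
  fixes \<beta> :: "nat \<Rightarrow> 'b" and z :: "nat \<Rightarrow> complex" and u :: "nat \<Rightarrow> 'a"
  assumes w1: "w < w1" and \<beta>: "\<And>n. \<beta> n \<in> B" and z: "\<And>n. Re (z n) \<ge> w1"
    and u: "\<And>n. u n \<in> D" "\<And>n. norm (u n) = 1" and lim: "(\<lambda>n. z n \<odot> u n - Lb (\<beta> n) (u n)) \<longlonglongrightarrow> 0"
  obtains r b \<zeta> v where "strict_mono r" "b \<in> B" "(\<beta> \<circ> r) \<longlonglongrightarrow> b" "(z \<circ> r) \<longlonglongrightarrow> \<zeta>" "Re \<zeta> \<ge> w1"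
    "v \<in> D" "norm v = 1" "Lb b v = \<zeta> \<odot> v"
proof -
  define c where "c = M / (w1 - w)"
  have c: "c > 0" using M w1 by (simp add: c_def)
  note rb = resolvent_bound[OF w1, folded c_def]
  define y where "y n = z n \<odot> u n - Lb (\<beta> n) (u n)" for n
  have y0: "y \<longlonglongrightarrow> 0" using lim by (simp add: y_def[abs_def])
  obtain b r1 where b: "b \<in> B" "strict_mono r1" "(\<beta> \<circ> r1) \<longlonglongrightarrow> b"
    using B \<beta> unfolding compact_def by (metis (no_types, lifting))
  interpret Kb: bounded_linear "K b" by (rule cboundedD[OF K_cb[OF b(1)]])
  have KK: "(\<lambda>n. K (\<beta> (r1 n)) (u (r1 n)) - K b (u (r1 n))) \<longlonglongrightarrow> 0"
  proof (rule Lim_null_comparison)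
    have "(\<lambda>n. Blinfun (K (\<beta> (r1 n)))) \<longlonglongrightarrow> Blinfun (K b)"
      using continuous_on_tendsto_compose[OF K_cont b(3) b(1)] \<beta> by (simp add: o_def)
    then show "(\<lambda>n. norm (Blinfun (K (\<beta> (r1 n))) - Blinfun (K b))) \<longlonglongrightarrow> 0"
      by (intro tendsto_norm_zero LIM_zero)
    show "\<forall>\<^sub>F n in sequentially. norm (K (\<beta> (r1 n)) (u (r1 n)) - K b (u (r1 n))) \<le> norm (Blinfun (K (\<beta> (r1 n))) - Blinfun (K b))"
      using norm_blinfun[of "Blinfun (K (\<beta> (r1 n))) - Blinfun (K b)" "u (r1 n)" for n] K_Blinfun \<beta> b(1) u(2)
      by (simp add: minus_blinfun.rep_eq)
  qed
  define X where "X = closure (K b ` ball 0 1)"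
  have X: "compact X" using K_compact[OF b(1)] by (simp add: compact_operator_def X_def)
  \<comment> \<open>Unit vectors are halved because compactness is stated for the open unit ball;
    the definition of \<open>v\<close> below undoes the scaling.\<close>
  have "K b ((1/2) *\<^sub>R u (r1 n)) \<in> X" for n
    unfolding X_def by (rule subsetD[OF closure_subset]) (rule imageI, simp add: u(2))
  then obtain v0 r2 where r2: "strict_mono r2" "((\<lambda>n. K b ((1/2) *\<^sub>R u (r1 n))) \<circ> r2) \<longlonglongrightarrow> v0"
    using X unfolding compact_def by (metis (no_types, lifting))
  define q where "q = r1 \<circ> r2"
  have q: "strict_mono q" using b(2) r2(1) by (simp add: q_def strict_mono_o)
  define v where "v = 2 *\<^sub>R v0"
  have "(\<lambda>n. 2 *\<^sub>R K b ((1/2) *\<^sub>R u (q n))) \<longlonglongrightarrow> v"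
    unfolding v_def using r2(2) by (intro tendsto_intros) (simp add: q_def o_def)
  then have Kv: "(\<lambda>n. K b (u (q n))) \<longlonglongrightarrow> v" by (simp add: Kb.scaleR)
  have KK2: "(\<lambda>n. K (\<beta> (q n)) (u (q n)) - K b (u (q n))) \<longlonglongrightarrow> 0"
    using LIMSEQ_subseq_LIMSEQ[OF KK r2(1)] by (simp add: q_def o_def)
  have kv: "(\<lambda>n. K (\<beta> (q n)) (u (q n))) \<longlonglongrightarrow> v" using tendsto_add[OF KK2 Kv] by simp
  have yq: "(\<lambda>n. y (q n)) \<longlonglongrightarrow> 0" using LIMSEQ_subseq_LIMSEQ[OF y0 q] by (simp add: o_def)
  have diff0: "(\<lambda>n. u (q n) - op.R (z (q n)) v) \<longlonglongrightarrow> 0"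
  proof (rule Lim_null_comparison)
    have "(\<lambda>n. c * norm (y (q n) + (K (\<beta> (q n)) (u (q n)) - v))) \<longlonglongrightarrow> c * norm (0 + (v - v))"
      by (intro tendsto_intros yq kv)
    then show "(\<lambda>n. c * norm (y (q n) + (K (\<beta> (q n)) (u (q n)) - v))) \<longlonglongrightarrow> 0" by simp
    show "\<forall>\<^sub>F n in sequentially. norm (u (q n) - op.R (z (q n)) v) \<le> c * norm (y (q n) + (K (\<beta> (q n)) (u (q n)) - v))"
    proof (intro always_eventually allI)
      fix n
      note r = rb[OF z[of "q n"]]
      have "z (q n) \<odot> u (q n) - L (u (q n)) = y (q n) + K (\<beta> (q n)) (u (q n))" by (simp add: y_def)
      then have "u (q n) = op.R (z (q n)) (y (q n) + K (\<beta> (q n)) (u (q n)))"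
        using op.R_props(3)[OF r(1) u(1)] by metis
      then have "u (q n) - op.R (z (q n)) v = op.R (z (q n)) (y (q n) + K (\<beta> (q n)) (u (q n))) - op.R (z (q n)) v" by simp
      also have "\<dots> = op.R (z (q n)) (y (q n) + (K (\<beta> (q n)) (u (q n)) - v))"
        by (simp add: op.R_lin[OF r(1)])
      finally show "norm (u (q n) - op.R (z (q n)) v) \<le> c * norm (y (q n) + (K (\<beta> (q n)) (u (q n)) - v))"
        using r(2) by simp
    qed
  qed
  \<comment> \<open>For |z| beyond C the vector \<open>op.R z v\<close> has norm at most 1/2. Being
    within less than 1/2 of a unit vector excludes this, so the spectral parameters stay in a
    ball.\<close>
  obtain C where C: "\<And>z. Re z \<ge> w1 \<Longrightarrow> C \<le> cmod z \<Longrightarrow> norm (op.R z v) \<le> 1/2"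
    using resolvent_vanishes[OF w1, of "1/2" v] by auto
  obtain N where N: "\<And>n. n \<ge> N \<Longrightarrow> norm (u (q n) - op.R (z (q n)) v) < 1/2"
    using LIMSEQ_D[OF diff0, of "1/2"] by auto
  have zb: "z (q (n + N)) \<in> cball 0 C" for n
  proof (rule ccontr)
    assume "z (q (n + N)) \<notin> cball 0 C"
    then have "norm (op.R (z (q (n + N))) v) \<le> 1/2" using C[OF z] by (simp add: dist_norm)
    then show False using N[of "n + N"] u(2)[of "q (n + N)"]
        norm_triangle_ineq[of "u (q (n + N)) - op.R (z (q (n + N))) v" "op.R (z (q (n + N))) v"] by simp
  qed
  obtain \<zeta> r3 where r3: "strict_mono r3" "((\<lambda>n. z (q (n + N))) \<circ> r3) \<longlonglongrightarrow> \<zeta>"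
    using compact_cball[of 0 C] zb unfolding compact_def by (metis (no_types, lifting))
  define r where "r n = q (r3 n + N)" for n
  have r: "strict_mono r" using q r3(1) by (auto simp: r_def strict_mono_def)
  have rq: "strict_mono (\<lambda>n. r3 n + N)" using r3(1) by (auto simp: strict_mono_def)
  have zl: "(z \<circ> r) \<longlonglongrightarrow> \<zeta>" using r3(2) by (simp add: r_def o_def)
  have Re: "Re \<zeta> \<ge> w1"
    by (rule tendsto_lowerbound[OF tendsto_Re[OF zl]]) (use z in \<open>auto simp: o_def\<close>)
  have bl: "(\<beta> \<circ> r) \<longlonglongrightarrow> b"
    using LIMSEQ_subseq_LIMSEQ[OF LIMSEQ_subseq_LIMSEQ[OF b(3) r2(1)] rq] by (simp add: o_def r_def q_def)
  have Rl: "(\<lambda>n. op.R (z (r n)) v) \<longlonglongrightarrow> op.R \<zeta> v"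
    using continuous_on_tendsto_compose[OF op.R_continuous zl] rb(1) z Re by (simp add: o_def)
  have "(\<lambda>n. u (r n) - op.R (z (r n)) v) \<longlonglongrightarrow> 0"
    using LIMSEQ_subseq_LIMSEQ[OF diff0 rq] by (simp add: o_def r_def)
  from tendsto_add[OF this Rl] have ul: "(\<lambda>n. u (r n)) \<longlonglongrightarrow> op.R \<zeta> v" by simp
  have "norm (op.R \<zeta> v) = 1"
    using LIMSEQ_unique[OF tendsto_norm[OF ul]] u(2) by simp
  moreover have "op.R \<zeta> v \<in> D" by (rule op.R_props(1)[OF rb(1)[OF Re]])
  moreover have "K b (op.R \<zeta> v) = v"
  proof (rule LIMSEQ_unique)
    show "(\<lambda>n. K b (u (r n))) \<longlonglongrightarrow> K b (op.R \<zeta> v)" by (rule Kb.tendsto[OF ul])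
    show "(\<lambda>n. K b (u (r n))) \<longlonglongrightarrow> v"
      using LIMSEQ_subseq_LIMSEQ[OF Kv rq] by (simp add: o_def r_def)
  qed
  then have "Lb b (op.R \<zeta> v) = \<zeta> \<odot> op.R \<zeta> v" using op.A_R[OF rb(1)[OF Re], of v] by simp
  ultimately show ?thesis using that[OF r b(1) bl zl Re] by blast
qed

text \<open>Discreteness of the spectrum provides the nearby resolvent points that
  \<open>approx_eigenvector\<close> requires.\<close>

lemma rho_dense:
  assumes \<beta>: "\<beta> \<in> B" and z: "Re z > w"
  obtains s where "\<And>n::nat. s n \<in> \<rho>b \<beta>" "s \<longlonglongrightarrow> z"
proof -
  define w1 where "w1 = (w + Re z) / 2"
  have w1: "w < w1" "w1 < Re z" using z by (auto simp: w1_def)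
  have ev: "\<forall>\<^sub>F s in at z. s \<in> \<rho>b \<beta>"
    using discrete_spectrum[OF S_bound w1(1) K_cb[OF \<beta>] K_compact[OF \<beta>]] w1(2)
    by (auto intro: eventually_cosparse_imp_eventually_at)
  have "\<exists>s\<in>\<rho>b \<beta>. dist s z < 1 / real (Suc n)" for n
  proof -
    have "\<forall>\<^sub>F s in at z. dist s z < 1 / real (Suc n)"
      using tendstoD[OF tendsto_ident_at, of "1 / real (Suc n)" z UNIV] by simp
    with ev have "\<forall>\<^sub>F s in at z. s \<in> \<rho>b \<beta> \<and> dist s z < 1 / real (Suc n)" by eventually_elim simp
    then show ?thesis using eventually_happens[of _ "at z"] by (auto simp: trivial_limit_at)
  qed
  then obtain s where s: "\<And>n. s n \<in> \<rho>b \<beta>" "\<And>n. dist (s n) z < 1 / real (Suc n)" by metis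
  have "s \<longlonglongrightarrow> z"
  proof (rule metric_tendsto_imp_tendsto[where f = "\<lambda>n. 1 / real (Suc n)" and a = 0])
    show "(\<lambda>n. 1 / real (Suc n)) \<longlonglongrightarrow> 0" using LIMSEQ_inverse_real_of_nat by (simp add: inverse_eq_divide)
    show "\<forall>\<^sub>F n in sequentially. dist (s n) z \<le> dist (1 / real (Suc n)) 0"
      using s(2) by (auto intro!: always_eventually less_imp_le)
  qed
  then show ?thesis using that s(1) by blast
qed

lemma spectrum_approx_eigenvector:
  assumes \<beta>: "\<beta> \<in> B" and z: "Re z > w" "z \<notin> \<rho>b \<beta>" and e: "e > 0"
  shows "\<exists>u\<in>D. norm u = 1 \<and> norm (z \<odot> u - Lb \<beta> u) \<le> e"
proof -
  obtain s where "\<And>n::nat. s n \<in> \<rho>b \<beta>" "s \<longlonglongrightarrow> z" using rho_dense[OF \<beta> z(1)] by blast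
  then show ?thesis using coper.approx_eigenvector[OF Lb_coper[OF \<beta>] z(2) _ _ e] by blast
qed

lemma spectrum_sequence:
  assumes w1: "w < w1" and \<beta>: "\<And>n::nat. \<beta> n \<in> B" and z: "\<And>n. Re (z n) \<ge> w1"
    and low: "\<And>n. \<exists>u\<in>D. norm u = 1 \<and> norm (z n \<odot> u - Lb (\<beta> n) u) \<le> 1 / real (Suc n)"
  obtains r b \<zeta> v where "strict_mono r" "b \<in> B" "(\<beta> \<circ> r) \<longlonglongrightarrow> b" "(z \<circ> r) \<longlonglongrightarrow> \<zeta>" "Re \<zeta> \<ge> w1"
    "v \<in> D" "norm v = 1" "Lb b v = \<zeta> \<odot> v"
proof -
  obtain u where u: "\<And>n. u n \<in> D" "\<And>n. norm (u n) = 1" "\<And>n. norm (z n \<odot> u n - Lb (\<beta> n) (u n)) \<le> 1 / real (Suc n)"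
    using low by metis
  have "(\<lambda>n. z n \<odot> u n - Lb (\<beta> n) (u n)) \<longlonglongrightarrow> 0"
    by (rule Lim_null_comparison[OF always_eventually[OF allI[OF u(3)]]])
       (use LIMSEQ_inverse_real_of_nat in \<open>simp add: inverse_eq_divide\<close>)
  from approx_eigenvectors_converge[OF w1 \<beta> z u(1,2) this] show ?thesis using that by metis
qed

text \<open>Spectral points of modulus above n, belonging to arbitrary parameters, would have
  approximate eigenvectors, and then a subsequence of these points would converge.\<close>

lemma spectrum_bounded:
  assumes w1: "w < w1"
  obtains R0 where "\<And>\<beta> z. \<beta> \<in> B \<Longrightarrow> Re z \<ge> w1 \<Longrightarrow> z \<notin> \<rho>b \<beta> \<Longrightarrow> cmod z \<le> R0"
proof (rule ccontr)
  assume no: "\<not> thesis"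
  have "\<exists>\<beta> z. \<beta> \<in> B \<and> Re z \<ge> w1 \<and> z \<notin> \<rho>b \<beta> \<and> cmod z > real n" for n
    using that[of "real n"] no by (meson not_le)
  then obtain \<beta> z where bz: "\<And>n. \<beta> n \<in> B" "\<And>n. Re (z n) \<ge> w1" "\<And>n. z n \<notin> \<rho>b (\<beta> n)" "\<And>n. cmod (z n) > real n"
    by metis
  have "\<exists>u\<in>D. norm u = 1 \<and> norm (z n \<odot> u - Lb (\<beta> n) u) \<le> 1 / real (Suc n)" for n
    using spectrum_approx_eigenvector[OF bz(1) _ bz(3)] bz(2)[of n] w1 by simp
  from spectrum_sequence[OF w1 bz(1,2) this]
  obtain r :: "nat \<Rightarrow> nat" and \<zeta> where r: "strict_mono r" "(z \<circ> r) \<longlonglongrightarrow> \<zeta>" by blast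
  have "Bseq (z \<circ> r)" using r(2) by (intro convergent_imp_Bseq) (auto simp: convergent_def)
  then obtain k where k: "\<And>n. cmod (z (r n)) \<le> k" by (auto simp: Bseq_def)
  obtain n :: nat where "real n > k" using reals_Archimedean2 by blast
  moreover have "real n \<le> real (r n)" using seq_suble[OF r(1)] by simp
  ultimately show False using k[of n] bz(4)[of "r n"] by linarith
qed

text \<open>If no bound works, the normalised vectors \<open>R z x\<close> are approximate
  eigenvectors with z in \<Gamma>. Closedness puts the limiting eigenvalue into \<Gamma>, against
  invertibility there.\<close>

lemma uniform_resolvent_bound:
  assumes w1: "w < w1" and G: "closed \<Gamma>" "\<And>z. z \<in> \<Gamma> \<Longrightarrow> Re z \<ge> w1" "\<And>\<beta>. \<beta> \<in> B \<Longrightarrow> \<Gamma> \<subseteq> \<rho>b \<beta>"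
  obtains c where "c > 0" "\<And>\<beta> z x. \<beta> \<in> B \<Longrightarrow> z \<in> \<Gamma> \<Longrightarrow> norm (resolvent J D (Lb \<beta>) z x) \<le> c * norm x"
proof (rule ccontr)
  assume no: "\<not> thesis"
  have "\<exists>\<beta> z. \<beta> \<in> B \<and> z \<in> \<Gamma> \<and> (\<exists>u\<in>D. norm u = 1 \<and> norm (z \<odot> u - Lb \<beta> u) \<le> 1 / real (Suc n))" for n
  proof -
    have "\<exists>\<beta> z x. \<beta> \<in> B \<and> z \<in> \<Gamma> \<and> norm (resolvent J D (Lb \<beta>) z x) > real (Suc n) * norm x"
      using that[of "real (Suc n)"] no by (metis not_le of_nat_0_less_iff zero_less_Suc)
    then obtain \<beta> z x where x: "\<beta> \<in> B" "z \<in> \<Gamma>" "norm (resolvent J D (Lb \<beta>) z x) > real (Suc n) * norm x" by blast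
    interpret P: coper J D "Lb \<beta>" by (rule Lb_coper[OF x(1)])
    have zr: "z \<in> P.\<rho>" using G(3) x by blast
    define y where "y = P.R z x"
    have y: "y \<in> D" "z \<odot> y - Lb \<beta> y = x" using P.R_props[OF zr] by (auto simp: y_def)
    have ny: "norm y > real (Suc n) * norm x" using x(3) by (simp add: y_def)
    have y0: "norm y > 0" using ny by (smt (verit) mult_nonneg_nonneg norm_ge_zero of_nat_0_le_iff)
    define u where "u = (1 / norm y) *\<^sub>R y"
    have "z \<odot> u - Lb \<beta> u = (1 / norm y) *\<^sub>R x"
      using y by (simp only: u_def P.A_scaleR[OF y(1)] cm_scaleR_right scaleR_diff_right[symmetric])
    then have "norm (z \<odot> u - Lb \<beta> u) = norm x / norm y" by simp
    also have "\<dots> \<le> 1 / real (Suc n)" using ny y0 by (simp add: field_simps)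
    finally have "norm (z \<odot> u - Lb \<beta> u) \<le> 1 / real (Suc n)" .
    moreover have "u \<in> D" "norm u = 1" using y(1) y0 P.D_scaleR by (auto simp: u_def)
    ultimately show ?thesis using x(1,2) by blast
  qed
  then obtain \<beta> z where bz: "\<And>n. \<beta> n \<in> B" "\<And>n. z n \<in> \<Gamma>"
    "\<And>n. \<exists>u\<in>D. norm u = 1 \<and> norm (z n \<odot> u - Lb (\<beta> n) u) \<le> 1 / real (Suc n)" by metis
  from spectrum_sequence[OF w1 bz(1) G(2)[OF bz(2)] bz(3)]
  obtain r b \<zeta> v where r: "strict_mono r" "b \<in> B" "(z \<circ> r) \<longlonglongrightarrow> \<zeta>" "v \<in> D" "norm v = 1" "Lb b v = \<zeta> \<odot> v" by metis
  have "\<zeta> \<in> \<Gamma>" using closed_sequentially[OF G(1) _ r(3)] bz(2) by (simp add: o_def)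
  then have zr: "\<zeta> \<in> \<rho>b b" using G(3) r(2) by blast
  interpret P: coper J D "Lb b" by (rule Lb_coper[OF r(2)])
  show False using P.R_props(3)[OF zr r(4)] r(5,6) P.R_lin(4)[OF zr] by simp
qed

lemma spectrum_finite:
  assumes \<beta>: "\<beta> \<in> B" and w1: "w < w1"
  shows "finite ({z. Re z \<ge> w1} - \<rho>b \<beta>)"
proof -
  obtain R0 where R0: "\<And>z. Re z \<ge> w1 \<Longrightarrow> z \<notin> \<rho>b \<beta> \<Longrightarrow> cmod z \<le> R0"
    using spectrum_bounded[OF w1] \<beta> by metis
  define w' where "w' = (w + w1) / 2"
  have w': "w < w'" "w' < w1" using w1 by (auto simp: w'_def)
  have "{z. z \<notin> \<rho>b \<beta>} sparse_in {z. Re z > w'}"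
    using discrete_spectrum[OF S_bound w'(1) K_cb[OF \<beta>] K_compact[OF \<beta>]] by (simp add: eventually_cosparse)
  then have "{z. z \<notin> \<rho>b \<beta>} sparse_in (cball 0 R0 \<inter> {z. Re z \<ge> w1})"
    by (rule sparse_in_subset) (use w' in auto)
  moreover have "compact (cball 0 R0 \<inter> {z. Re z \<ge> w1})"
    by (intro compact_Int_closed compact_cball closed_halfspace_Re_ge)
  ultimately have "finite ((cball 0 R0 \<inter> {z. Re z \<ge> w1}) \<inter> {z. z \<notin> \<rho>b \<beta>})"
    by (rule sparse_in_compact_finite)
  moreover have "{z. Re z \<ge> w1} - \<rho>b \<beta> \<subseteq> (cball 0 R0 \<inter> {z. Re z \<ge> w1}) \<inter> {z. z \<notin> \<rho>b \<beta>}"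
    using R0 by auto
  ultimately show ?thesis by (rule rev_finite_subset)
qed

text \<open>Only finitely many spectral points have real part at least w1, so those left of w0 have
  a largest real part. The resulting w2 depends on the parameter.\<close>

lemma spectral_gap:
  assumes \<beta>: "\<beta> \<in> B"
  obtains w2 where "w < w2" "spectral J D (Lb \<beta>) w0 w2"
proof -
  define w1 where "w1 = (w + w0) / 2"
  have w1: "w < w1" "w1 < w0" using w by (auto simp: w1_def)
  define F where "F = {z. Re z \<ge> w1} - \<rho>b \<beta>"
  have F: "finite F" unfolding F_def by (rule spectrum_finite[OF \<beta> w1(1)])
  \<comment> \<open>Including w1 makes the maximum exist and keeps w2 above w.\<close>
  define Q where "Q = insert w1 (Re ` F \<inter> {..<w0})"
  have Q: "finite Q" "Q \<noteq> {}" using F by (auto simp: Q_def)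
  define w2 where "w2 = Max Q"
  have w2: "w2 < w0" using Q Max_in[OF Q] w1 unfolding w2_def Q_def by auto
  have w12: "w1 \<le> w2" unfolding w2_def using Q by (intro Max_ge) (auto simp: Q_def)
  have S: "Sigma_set J D (Lb \<beta>) w0 \<subseteq> F" using w1 by (auto simp: Sigma_set_def spectrum_op_def F_def)
  have "{z. Re z > w2} - Sigma_set J D (Lb \<beta>) w0 \<subseteq> \<rho>b \<beta>"
  proof (rule subsetI, rule ccontr)
    fix z assume z: "z \<in> {z. Re z > w2} - Sigma_set J D (Lb \<beta>) w0" "z \<notin> \<rho>b \<beta>"
    then have "Re z < w0" by (auto simp: Sigma_set_def spectrum_op_def)
    moreover have "z \<in> F" using z w12 by (auto simp: F_def)
    ultimately have "Re z \<in> Q" by (auto simp: Q_def)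
    then have "Re z \<le> w2" unfolding w2_def using Q by simp
    then show False using z by simp
  qed
  then have "spectral J D (Lb \<beta>) w0 w2"
    by (intro spectral.intro spectral_axioms.intro Lb_coper \<beta> w2 finite_subset[OF S F])
  then show ?thesis by (intro that[of w2]) (use w1 w12 in auto)
qed

text \<open>The compactness result is applied to constant sequences of parameters and points, so the
  limiting eigenvector belongs to the given \<beta> and z.\<close>

lemma spectrum_eigenvector:
  assumes \<beta>: "\<beta> \<in> B" and z: "Re z > w" "z \<notin> \<rho>b \<beta>"
  obtains v where "v \<in> D" "norm v = 1" "Lb \<beta> v = z \<odot> v"
proof -
  have "\<exists>u\<in>D. norm u = 1 \<and> norm (z \<odot> u - Lb \<beta> u) \<le> 1 / real (Suc n)" for n
    using spectrum_approx_eigenvector[OF \<beta> z] by simp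
  from spectrum_sequence[OF z(1) \<beta> order_refl this]
  obtain r :: "nat \<Rightarrow> nat" and b \<zeta> v where v: "((\<lambda>_. \<beta>) \<circ> r) \<longlonglongrightarrow> b" "((\<lambda>_. z) \<circ> r) \<longlonglongrightarrow> \<zeta>" "v \<in> D" "norm v = 1" "Lb b v = \<zeta> \<odot> v"
    by metis
  have "b = \<beta>" "\<zeta> = z" using v(1,2) by (simp_all add: o_def LIMSEQ_const_iff)
  then show ?thesis using that v by simp
qed

end


section \<open>A Plancherel identity for vector-valued Fourier coefficients\<close>

text \<open>With y = x/2, combine \<open>y * cos y \<le> sin y\<close> with sin x = 2 sin y cos y;
  on this range the square of \<open>cos y\<close> is at least 1/2.\<close>

lemma half_le_sin:
  assumes "0 \<le> x" "x \<le> pi / 2" shows "x / 2 \<le> sin x"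
proof -
  define y where "y = x / 2"
  have y: "0 \<le> y" "y \<le> pi / 4" using assms by (auto simp: y_def)
  have "(\<lambda>y. sin y - y * cos y) 0 \<le> (\<lambda>y. sin y - y * cos y) y"
  proof (rule DERIV_nonneg_imp_nondecreasing[OF y(1)])
    fix t assume t: "0 \<le> t" "t \<le> y"
    have "((\<lambda>y. sin y - y * cos y) has_real_derivative t * sin t) (at t)"
      by (auto intro!: derivative_eq_intros)
    moreover have "t * sin t \<ge> 0" using t y by (intro mult_nonneg_nonneg sin_ge_zero) auto
    ultimately show "\<exists>d. ((\<lambda>y. sin y - y * cos y) has_real_derivative d) (at t) \<and> 0 \<le> d" by blast
  qed
  then have 1: "y * cos y \<le> sin y" by simp
  have cy: "cos y \<ge> 0" using y by (intro cos_ge_zero) auto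
  have "cos (2 * y) \<ge> 0" using assms by (intro cos_ge_zero) (auto simp: y_def)
  then have "1 / 2 \<le> (cos y)\<^sup>2" by (simp add: cos_double_cos)
  then have "y \<le> 2 * (y * (cos y)\<^sup>2)" using mult_left_mono[of "1/2" "(cos y)\<^sup>2" y] y by simp
  also have "\<dots> = 2 * cos y * (y * cos y)" by (simp add: power2_eq_square)
  also have "\<dots> \<le> 2 * cos y * sin y" using 1 cy by (intro mult_left_mono) auto
  also have "\<dots> = sin (2 * y)" using sin_double[of y] by simp
  finally show ?thesis by (simp add: y_def)
qed

lemma ee_add: "ee (s + t) = ee s * ee t"
  by (simp add: exp_add[symmetric] algebra_simps)

lemma ee_minus: "ee (- t) = cnj (ee t)"
  by (simp add: exp_cnj)

lemma ee_of_nat: "ee (real n) = 1"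
proof -
  have "2 * of_real pi * \<i> * of_real (real n) = of_nat n * (2 * of_real pi * \<i>)" by simp
  then show ?thesis by (simp only: exp_of_nat_mult exp_two_pi_i power_one)
qed

text \<open>The modulus is 2 sin (pi u), and the crude sine bound is applied to pi u or pi (1 - u),
  whichever lies in the first quadrant.\<close>

lemma ee_minus_one:
  assumes "0 \<le> u" "u \<le> 1"
  shows "min u (1 - u) \<le> cmod (ee u - 1)"
proof -
  have "2 * of_real pi * \<i> * of_real u = \<i> * complex_of_real (2 * (pi * u))" by simp
  then have "ee u = cis (2 * (pi * u))" by (simp only: cis_conv_exp)
  then have "(cmod (ee u - 1))\<^sup>2 = (cos (2 * (pi * u)) - 1)\<^sup>2 + (sin (2 * (pi * u)))\<^sup>2"
    by (simp only: cmod_power2) simp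
  also have "\<dots> = 2 - 2 * cos (2 * (pi * u))"
    using sin_cos_squared_add[of "2 * (pi * u)"] by (simp only: power2_diff) simp
  also have "\<dots> = (2 * sin (pi * u))\<^sup>2" by (simp add: cos_double_sin power_mult_distrib)
  finally have sq: "(cmod (ee u - 1))\<^sup>2 = (2 * sin (pi * u))\<^sup>2" .
  have "sin (pi * u) \<ge> 0" using assms by (intro sin_ge_zero) auto
  then have eq: "cmod (ee u - 1) = 2 * sin (pi * u)" by (intro power2_eq_imp_eq[OF sq] norm_ge_zero) simp
  have p: "pi \<ge> 1" using pi_ge_two by linarith
  show ?thesis
  proof (cases "u \<le> 1/2")
    case True
    then have "pi * u / 2 \<le> sin (pi * u)" using assms by (intro half_le_sin) auto
    moreover have "u \<le> pi * u" using p assms mult_right_mono[of 1 pi u] by simp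
    ultimately show ?thesis using eq by simp
  next
    case False
    have "pi * (1 - u) / 2 \<le> sin (pi * (1 - u))"
      using assms False by (intro half_le_sin) (auto simp: algebra_simps)
    also have "sin (pi * (1 - u)) = sin (pi * u)" using sin_pi_minus[of "pi * u"] by (simp add: algebra_simps)
    finally have "pi * (1 - u) / 2 \<le> sin (pi * u)" .
    moreover have "1 - u \<le> pi * (1 - u)" using p assms mult_right_mono[of 1 pi "1 - u"] by simp
    ultimately show ?thesis using eq by simp
  qed
qed

text \<open>A one-sided Dirichlet kernel, with frequencies 0 to n - 1. Its squared modulus is n
  times the Fejer kernel.\<close>

definition dirichlet :: "nat \<Rightarrow> real \<Rightarrow> complex" where "dirichlet n u = (\<Sum>j<n. ee (real j * u))"

lemma dirichlet_continuous [continuous_intros]: "continuous_on S f \<Longrightarrow> continuous_on S (\<lambda>x. dirichlet n (f x))"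
  unfolding dirichlet_def by (intro continuous_intros)

lemma dirichlet_minus: "cmod (dirichlet n (- u)) = cmod (dirichlet n u)"
proof -
  have "dirichlet n (- u) = cnj (dirichlet n u)"
    unfolding dirichlet_def by (simp add: exp_cnj)
  then show ?thesis by simp
qed

lemma dirichlet_telescope: "dirichlet n u * (ee u - 1) = ee (real n * u) - 1"
proof (induction n)
  case (Suc n)
  have "ee (real (Suc n) * u) = ee (real n * u) * ee u"
  proof -
    have "real (Suc n) * u = real n * u + u" by (simp add: algebra_simps)
    then show ?thesis by (simp only: ee_add)
  qed
  then show ?case using Suc by (simp add: dirichlet_def algebra_simps)
qed (simp add: dirichlet_def)

lemma dirichlet_bound:
  assumes "0 \<le> u" "u \<le> 1"
  shows "cmod (dirichlet n u) * min u (1 - u) \<le> 2"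
proof -
  have "cmod (dirichlet n u) * min u (1 - u) \<le> cmod (dirichlet n u) * cmod (ee u - 1)"
    using ee_minus_one[OF assms] by (intro mult_left_mono) auto
  also have "\<dots> = cmod (ee (real n * u) - 1)" by (simp only: norm_mult[symmetric] dirichlet_telescope)
  also have "\<dots> \<le> 2" using norm_triangle_ineq4[of "ee (real n * u)" 1] by simp
  finally show ?thesis .
qed

lemma dirichlet_square: "(\<Sum>j<n. \<Sum>l<n. ee ((real j - real l) * u)) = of_real ((cmod (dirichlet n u))\<^sup>2)"
proof -
  have "(\<Sum>j<n. \<Sum>l<n. ee ((real j - real l) * u)) = (\<Sum>j<n. \<Sum>l<n. ee (real j * u) * cnj (ee (real l * u)))"
    by (intro sum.cong refl) (simp only: ee_minus[symmetric] ee_add[symmetric], simp add: algebra_simps)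
  also have "\<dots> = dirichlet n u * cnj (dirichlet n u)"
    by (simp add: dirichlet_def sum_product)
  also have "\<dots> = of_real ((cmod (dirichlet n u))\<^sup>2)" by (rule complex_norm_square[symmetric])
  finally show ?thesis .
qed

lemma integral_ee:
  assumes N: "N > 0"
  shows "integral {0..N} (\<lambda>t. ee ((real j - real l) * ((s - t) / N))) = (if j = l then of_real N else 0)"
proof (cases "j = l")
  case False
  define k where "k = real j - real l"
  have k: "k \<noteq> 0" using False by (simp add: k_def)
  define a where "a = - (2 * of_real pi * \<i> * of_real (k / N))"
  have a: "a \<noteq> 0" using k N by (simp add: a_def)
  have e: "ee (k * ((s - t) / N)) = ee (k * s / N) * exp (a * of_real t)" for t
    by (simp add: a_def exp_add[symmetric] diff_divide_distrib algebra_simps)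
  have "((\<lambda>t. exp (a * of_real t)) has_integral (exp (a * of_real N) / a - exp (a * of_real 0) / a)) {0..N}"
    using N a by (intro fundamental_theorem_of_calculus)
      (auto intro!: derivative_eq_intros has_vector_derivative_real_field)
  moreover have "exp (a * of_real N) = ee (- k)" using N by (simp add: a_def)
  moreover have "ee (- k) = ee (real l) * cnj (ee (real j))" by (simp only: ee_minus[symmetric] ee_add[symmetric], simp add: k_def)
  then have "ee (- k) = 1" by (simp only: ee_of_nat complex_cnj_one mult_1)
  ultimately have "integral {0..N} (\<lambda>t. exp (a * of_real t)) = 0" by (simp add: integral_unique)
  then show ?thesis using False unfolding k_def[symmetric] e by simp
qed (use N in \<open>simp add: scaleR_conv_of_real\<close>)

lemma integral_dirichlet:
  assumes N: "N > 0"
  shows "integral {0..N} (\<lambda>t. (cmod (dirichlet n ((s - t) / N)))\<^sup>2) = real n * N"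
proof -
  have "complex_of_real (integral {0..N} (\<lambda>t. (cmod (dirichlet n ((s - t) / N)))\<^sup>2)) =
     integral {0..N} (\<lambda>t. of_real ((cmod (dirichlet n ((s - t) / N)))\<^sup>2))"
  proof -
    have "(\<lambda>t. (cmod (dirichlet n ((s - t) / N)))\<^sup>2) integrable_on {0..N}"
      using N by (intro integrable_continuous_interval continuous_intros) auto
    from integral_linear[OF this bounded_linear_of_real[where 'a = complex]] show ?thesis by (simp add: o_def)
  qed
  also have "\<dots> = integral {0..N} (\<lambda>t. \<Sum>j<n. \<Sum>l<n. ee ((real j - real l) * ((s - t) / N)))"
    by (simp only: dirichlet_square)
  also have "\<dots> = (\<Sum>j<n. \<Sum>l<n. integral {0..N} (\<lambda>t. ee ((real j - real l) * ((s - t) / N))))"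
    using N by (subst integral_sum; (subst integral_sum)?) (auto intro!: integrable_continuous_interval continuous_intros sum.cong)
  also have "\<dots> = (\<Sum>j<n. \<Sum>l<n. if j = l then of_real N else 0)" by (simp only: integral_ee[OF N])
  also have "\<dots> = of_real (real n * N)" by simp
  finally show ?thesis using of_real_eq_iff by blast
qed

context cstruct
begin

lemma inner_cm_unit:
  "inner (ee (- a) \<odot> x) (ee (- b) \<odot> y) = inner (ee (b - a) \<odot> x) y"
proof -
  have adj: "inner (z \<odot> x) (w \<odot> y) = inner ((cnj w * z) \<odot> x) y" for z w x y
    using inner_J_right[of x y]
    by (simp add: cmul_def inner_add_left inner_add_right algebra_simps)
  show ?thesis unfolding adj by (simp only: ee_minus[symmetric] ee_add[symmetric]) simp
qed

text \<open>Summing over differences of indices instead of over the frequencies themselves produces the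
  Fejer kernel. The identity gives an upper bound for every continuous function and, when the kernel
  is cancelled by a Lipschitz condition, an asymptotically matching lower bound; this replaces both
  halves of Parseval's theorem.\<close>

lemma fourier_identity:
  assumes N: "N > 0" and f: "continuous_on {0..N} f"
  defines "V \<equiv> \<lambda>k. integral {0..N} (\<lambda>t. ee (- (k * (t / N))) \<odot> f t)"
  shows "(\<Sum>j<n. \<Sum>l<n. (norm (V (real j - real l)))\<^sup>2) = real n * N * integral {0..N} (\<lambda>t. (norm (f t))\<^sup>2)
     - 1/2 * integral {0..N} (\<lambda>s. integral {0..N} (\<lambda>t. (cmod (dirichlet n ((s - t) / N)))\<^sup>2 * (norm (f t - f s))\<^sup>2))"
proof -
  let ?Q = "cbox (0, 0) (N, N)"
  let ?k = "\<lambda>s t. (cmod (dirichlet n ((s - t) / N)))\<^sup>2"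
  have cf: "continuous_on ?Q (\<lambda>p. f (fst p))" "continuous_on ?Q (\<lambda>p. f (snd p))"
    by (rule continuous_on_compose2[OF f], auto intro!: continuous_intros simp: cbox_Pair_eq)+
  have I2: "integral ?Q (\<lambda>p. F (fst p) (snd p)) = integral {0..N} (\<lambda>s. integral {0..N} (F s))"
    if "continuous_on ?Q (\<lambda>p. F (fst p) (snd p))" for F :: "real \<Rightarrow> real \<Rightarrow> real"
    using integral_prod_continuous[of 0 0 N N "\<lambda>p. F (fst p) (snd p)"] that by (simp add: case_prod_unfold)
  have ck: "continuous_on ?Q (\<lambda>p. ?k (fst p) (snd p))" using N by (intro continuous_intros) auto
  have V2: "(norm (V \<kappa>))\<^sup>2 = integral ?Q (\<lambda>p. inner (ee (\<kappa> * ((fst p - snd p) / N)) \<odot> f (snd p)) (f (fst p)))" for \<kappa>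
  proof -
    define h where "h t = ee (- (\<kappa> * (t / N))) \<odot> f t" for t
    have ch: "continuous_on {0..N} h" unfolding h_def using N by (intro continuous_intros f) auto
    have ih: "h integrable_on {0..N}" by (intro integrable_continuous_interval ch)
    have "(norm (V \<kappa>))\<^sup>2 = inner (integral {0..N} h) (integral {0..N} h)"
      by (simp add: V_def h_def[abs_def] power2_norm_eq_inner)
    also have "\<dots> = integral {0..N} (\<lambda>s. inner (integral {0..N} h) (h s))"
      using integral_linear[OF ih bounded_linear_inner_right] by (simp add: o_def)
    also have "\<dots> = integral {0..N} (\<lambda>s. integral {0..N} (\<lambda>t. inner (h t) (h s)))"
      using integral_linear[OF ih bounded_linear_inner_left] by (simp add: o_def)
    also have "\<dots> = integral {0..N} (\<lambda>s. integral {0..N} (\<lambda>t. inner (ee (\<kappa> * ((s - t) / N)) \<odot> f t) (f s)))"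
      unfolding h_def inner_cm_unit by (simp add: diff_divide_distrib right_diff_distrib)
    also have "\<dots> = integral ?Q (\<lambda>p. inner (ee (\<kappa> * ((fst p - snd p) / N)) \<odot> f (snd p)) (f (fst p)))"
      using N by (intro I2[symmetric] continuous_intros cf) auto
    finally show ?thesis .
  qed
  have "(\<Sum>j<n. \<Sum>l<n. (norm (V (real j - real l)))\<^sup>2) =
     integral ?Q (\<lambda>p. \<Sum>j<n. \<Sum>l<n. inner (ee ((real j - real l) * ((fst p - snd p) / N)) \<odot> f (snd p)) (f (fst p)))"
    unfolding V2 using N
    by (subst integral_sum; (subst integral_sum)?) (auto intro!: integrable_continuous continuous_intros cf sum.cong)
  also have "\<dots> = integral ?Q (\<lambda>p. ?k (fst p) (snd p) * inner (f (snd p)) (f (fst p)))"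
  proof (rule integral_cong)
    fix p
    have "(\<Sum>j<n. \<Sum>l<n. inner (ee ((real j - real l) * ((fst p - snd p) / N)) \<odot> f (snd p)) (f (fst p)))
       = inner ((\<Sum>j<n. \<Sum>l<n. ee ((real j - real l) * ((fst p - snd p) / N))) \<odot> f (snd p)) (f (fst p))"
      by (simp only: cm.sum_left inner_sum_left)
    also have "\<dots> = ?k (fst p) (snd p) * inner (f (snd p)) (f (fst p))"
      by (simp only: dirichlet_square cm_of_real inner_scaleR_left)
    finally show "(\<Sum>j<n. \<Sum>l<n. inner (ee ((real j - real l) * ((fst p - snd p) / N)) \<odot> f (snd p)) (f (fst p)))
       = ?k (fst p) (snd p) * inner (f (snd p)) (f (fst p))" .
  qed
  \<comment> \<open>Polarisation: twice the inner product is the sum of the squared norms minus the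
    squared norm of the difference. The first two parts become the main term by
    \<open>integral_dirichlet\<close>, the last is the error term.\<close>
  also have "\<dots> = integral ?Q (\<lambda>p. (1/2) * (?k (fst p) (snd p) * (norm (f (fst p)))\<^sup>2) + (1/2) * (?k (fst p) (snd p) * (norm (f (snd p)))\<^sup>2)
     - (1/2) * (?k (fst p) (snd p) * (norm (f (snd p) - f (fst p)))\<^sup>2))"
    by (intro integral_cong) (simp add: power2_norm_eq_inner inner_diff_left inner_diff_right inner_commute algebra_simps)
  also have "\<dots> = (1/2) * integral ?Q (\<lambda>p. ?k (fst p) (snd p) * (norm (f (fst p)))\<^sup>2) + (1/2) * integral ?Q (\<lambda>p. ?k (fst p) (snd p) * (norm (f (snd p)))\<^sup>2)
     - (1/2) * integral ?Q (\<lambda>p. ?k (fst p) (snd p) * (norm (f (snd p) - f (fst p)))\<^sup>2)"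
    by (subst integral_diff, (intro integrable_continuous continuous_intros ck cf)+, subst integral_add,
        (intro integrable_continuous continuous_intros ck cf)+) (simp only: integral_mult_right)
  also have "integral ?Q (\<lambda>p. ?k (fst p) (snd p) * (norm (f (fst p)))\<^sup>2) = real n * N * integral {0..N} (\<lambda>t. (norm (f t))\<^sup>2)"
    by (subst I2, intro continuous_intros ck cf) (simp add: integral_dirichlet[OF N])
  also have "integral ?Q (\<lambda>p. ?k (fst p) (snd p) * (norm (f (snd p)))\<^sup>2) = integral {0..N} (\<lambda>s. integral {0..N} (\<lambda>t. ?k s t * (norm (f t))\<^sup>2))"
    by (subst I2, intro continuous_intros ck cf) simp
  also have "\<dots> = integral {0..N} (\<lambda>t. integral {0..N} (\<lambda>s. ?k s t * (norm (f t))\<^sup>2))"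
  proof -
    have "continuous_on (cbox (0, 0) (N, N)) (\<lambda>(s, t). ?k s t * (norm (f t))\<^sup>2)"
      unfolding case_prod_unfold by (intro continuous_intros ck cf)
    from integral_swap_continuous[OF this] show ?thesis by simp
  qed
  also have "\<dots> = real n * N * integral {0..N} (\<lambda>t. (norm (f t))\<^sup>2)"
  proof -
    have "?k s t = ?k t s" for s t
      using dirichlet_minus[of n "(s - t) / N"] by (simp add: minus_divide_left)
    then have "integral {0..N} (\<lambda>s. ?k s t * (norm (f t))\<^sup>2) = real n * N * (norm (f t))\<^sup>2" for t
      using integral_dirichlet[OF N, of n t] by simp
    then show ?thesis by (simp only: integral_mult_right)
  qed
  also have "integral ?Q (\<lambda>p. ?k (fst p) (snd p) * (norm (f (snd p) - f (fst p)))\<^sup>2) =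
     integral {0..N} (\<lambda>s. integral {0..N} (\<lambda>t. ?k s t * (norm (f t - f s))\<^sup>2))"
    by (subst I2, intro continuous_intros ck cf) simp
  finally show ?thesis by simp
qed

end


section \<open>Quantitative Gearhart--Pruess theorem\<close>

context cstruct
begin

text \<open>The periodic Lipschitz condition cancels the singularity of the Dirichlet kernel at both ends
  of the period, so the error term is bounded independently of n, while the main terms grow
  linearly in n.\<close>

lemma periodic_plancherel_transfer:
  assumes N: "N > 0" and v: "continuous_on {0..N} v" and g: "continuous_on {0..N} g"
    and lip: "\<And>s t. s \<in> {0..N} \<Longrightarrow> t \<in> {0..N} \<Longrightarrow> norm (v t - v s) \<le> lam * \<bar>t - s\<bar>" and lam: "lam \<ge> 0"
    and v0: "v 0 = 0" "v N = 0"
    and le: "\<And>k. norm (integral {0..N} (\<lambda>t. ee (- (k * (t / N))) \<odot> v t)) \<le> C * norm (integral {0..N} (\<lambda>t. ee (- (k * (t / N))) \<odot> g t))"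
  shows "integral {0..N} (\<lambda>t. (norm (v t))\<^sup>2) \<le> C\<^sup>2 * integral {0..N} (\<lambda>t. (norm (g t))\<^sup>2)"
proof (rule ccontr)
  define Iv where "Iv = integral {0..N} (\<lambda>t. (norm (v t))\<^sup>2)"
  define Ig where "Ig = integral {0..N} (\<lambda>t. (norm (g t))\<^sup>2)"
  define E where "E = (2 * lam * N)\<^sup>2"
  assume "\<not> ?thesis"
  then have gap: "Iv - C\<^sup>2 * Ig > 0" by (simp add: Iv_def Ig_def)
  let ?k = "\<lambda>n s t. (cmod (dirichlet n ((s - t) / N)))\<^sup>2"
  have kv: "?k n s t * (norm (v t - v s))\<^sup>2 \<le> E" if st: "s \<in> {0..N}" "t \<in> {0..N}" for n s t
  proof -
    define u where "u = \<bar>s - t\<bar> / N"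
    have u: "0 \<le> u" "u \<le> 1" using st N by (auto simp: u_def)
    have d: "cmod (dirichlet n ((s - t) / N)) = cmod (dirichlet n u)"
      using dirichlet_minus[of n "(s - t) / N"] N by (auto simp: u_def abs_if minus_divide_left)
    have 1: "norm (v t - v s) \<le> lam * N * u" using lip[OF st] N by (simp add: u_def abs_minus_commute)
    \<comment> \<open>Going through the endpoints, where v vanishes, shows that v is Lipschitz for
      the distance on a circle of length N.\<close>
    have 2: "norm (v t - v s) \<le> lam * N * (1 - u)"
    proof -
      have *: "norm (v q - v p) \<le> lam * (N - (q - p))" if pq: "p \<in> {0..N}" "q \<in> {0..N}" "p \<le> q" for p q
      proof -
        have "norm (v q - v p) \<le> norm (v q) + norm (v p)" by (rule norm_triangle_ineq4)
        also have "norm (v q) \<le> lam * (N - q)" using lip[of N q] pq v0 N by simp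
        also have "norm (v p) \<le> lam * p" using lip[of 0 p] pq v0 N by simp
        finally show ?thesis by (simp add: algebra_simps)
      qed
      have eq: "lam * N * (1 - u) = lam * (N - \<bar>s - t\<bar>)" using N by (simp add: u_def algebra_simps)
      show ?thesis unfolding eq using *[of s t] *[of t s] st by (cases "s \<le> t") (auto simp: norm_minus_commute)
    qed
    have "norm (v t - v s) \<le> lam * N * min u (1 - u)" using 1 2 by (auto simp: min_def)
    then have "cmod (dirichlet n u) * norm (v t - v s) \<le> cmod (dirichlet n u) * (lam * N * min u (1 - u))"
      by (intro mult_left_mono) auto
    also have "\<dots> = lam * N * (cmod (dirichlet n u) * min u (1 - u))" by simp
    also have "\<dots> \<le> lam * N * 2" using dirichlet_bound[OF u, of n] lam N by (intro mult_left_mono) auto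
    finally have "(cmod (dirichlet n u) * norm (v t - v s))\<^sup>2 \<le> (lam * N * 2)\<^sup>2" by (intro power_mono) auto
    then show ?thesis by (simp add: d E_def power_mult_distrib mult_ac)
  qed
  have cfst: "continuous_on (cbox (0, 0) (N, N)) (\<lambda>p. f (fst p))" "continuous_on (cbox (0, 0) (N, N)) (\<lambda>p. f (snd p))"
    if "continuous_on {0..N} f" for f :: "real \<Rightarrow> 'a"
    by (rule continuous_on_compose2[OF that], auto intro!: continuous_intros simp: cbox_Pair_eq)+
  have inner_int: "(\<lambda>s. integral {0..N} (\<lambda>t. ?k n s t * (norm (f t - f s))\<^sup>2)) integrable_on {0..N}"
    and inner_int': "s \<in> {0..N} \<Longrightarrow> (\<lambda>t. ?k n s t * (norm (f t - f s))\<^sup>2) integrable_on {0..N}"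
    if f: "continuous_on {0..N} f" for f :: "real \<Rightarrow> 'a" and n s
  proof -
    have c: "continuous_on (cbox (0, 0) (N, N)) (\<lambda>(s, t). ?k n s t * (norm (f t - f s))\<^sup>2)"
      unfolding case_prod_unfold using N by (intro continuous_intros cfst[OF f]) auto
    then have "continuous_on {0..N} (\<lambda>s. integral (cbox 0 N) (\<lambda>t. ?k n s t * (norm (f t - f s))\<^sup>2))"
      by (intro integral_continuous_on_param) (simp add: cbox_Pair_eq)
    then show "(\<lambda>s. integral {0..N} (\<lambda>t. ?k n s t * (norm (f t - f s))\<^sup>2)) integrable_on {0..N}"
      by (intro integrable_continuous_interval) simp
    show "s \<in> {0..N} \<Longrightarrow> (\<lambda>t. ?k n s t * (norm (f t - f s))\<^sup>2) integrable_on {0..N}"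
      using N by (intro integrable_continuous_interval continuous_intros f) auto
  qed
  have up: "integral {0..N} (\<lambda>s. integral {0..N} (\<lambda>t. ?k n s t * (norm (v t - v s))\<^sup>2)) \<le> E * N * N" for n
  proof -
    have "integral {0..N} (\<lambda>t. ?k n s t * (norm (v t - v s))\<^sup>2) \<le> E * N" if s: "s \<in> {0..N}" for s
    proof -
      have "integral {0..N} (\<lambda>t. ?k n s t * (norm (v t - v s))\<^sup>2) \<le> integral {0..N} (\<lambda>t. E)"
        using inner_int'[OF v s] kv[OF s] by (intro integral_le) auto
      then show ?thesis using N by (simp add: mult.commute)
    qed
    then have "integral {0..N} (\<lambda>s. integral {0..N} (\<lambda>t. ?k n s t * (norm (v t - v s))\<^sup>2)) \<le> integral {0..N} (\<lambda>s. E * N)"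
      using inner_int[OF v] by (intro integral_le) auto
    then show ?thesis using N by (simp add: mult_ac)
  qed
  have low: "0 \<le> integral {0..N} (\<lambda>s. integral {0..N} (\<lambda>t. ?k n s t * (norm (g t - g s))\<^sup>2))" for n
    using inner_int[OF g] inner_int'[OF g] by (intro integral_nonneg) auto
  define K where "K = E * N * N / 2"
  have key: "real n * N * (Iv - C\<^sup>2 * Ig) \<le> K" for n
  proof -
    have "real n * N * Iv - K \<le> (\<Sum>j<n. \<Sum>l<n. (norm (integral {0..N} (\<lambda>t. ee (- ((real j - real l) * (t / N))) \<odot> v t)))\<^sup>2)"
      unfolding fourier_identity[OF N v] Iv_def K_def using up[of n] by simp
    also have "\<dots> \<le> (\<Sum>j<n. \<Sum>l<n. C\<^sup>2 * (norm (integral {0..N} (\<lambda>t. ee (- ((real j - real l) * (t / N))) \<odot> g t)))\<^sup>2)"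
    proof (intro sum_mono)
      fix j l
      show "(norm (integral {0..N} (\<lambda>t. ee (- ((real j - real l) * (t / N))) \<odot> v t)))\<^sup>2 \<le> C\<^sup>2 * (norm (integral {0..N} (\<lambda>t. ee (- ((real j - real l) * (t / N))) \<odot> g t)))\<^sup>2"
        using power_mono[OF le[of "real j - real l"], of 2] by (simp only: power_mult_distrib norm_ge_zero simp_thms)
    qed
    also have "\<dots> = C\<^sup>2 * (\<Sum>j<n. \<Sum>l<n. (norm (integral {0..N} (\<lambda>t. ee (- ((real j - real l) * (t / N))) \<odot> g t)))\<^sup>2)"
      by (simp only: sum_distrib_left)
    also have "\<dots> \<le> C\<^sup>2 * (real n * N * Ig)"
    proof (intro mult_left_mono)
      show "(\<Sum>j<n. \<Sum>l<n. (norm (integral {0..N} (\<lambda>t. ee (- ((real j - real l) * (t / N))) \<odot> g t)))\<^sup>2) \<le> real n * N * Ig"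
        unfolding fourier_identity[OF N g] Ig_def using low[of n] by simp
    qed simp
    finally show ?thesis by (simp add: algebra_simps)
  qed
  \<comment> \<open>By \<open>gap\<close> the left side of \<open>key\<close> grows linearly in n,
    while K does not depend on n.\<close>
  obtain n :: nat where "real n > K / (N * (Iv - C\<^sup>2 * Ig))" using reals_Archimedean2 by blast
  then have "real n * (N * (Iv - C\<^sup>2 * Ig)) > K" using N gap by (simp add: pos_divide_less_eq)
  then show False using key[of n] by (simp add: mult.assoc)
qed

end

text \<open>The semigroup is meant to be already multiplied by \<open>exp (- w0 * t)\<close>, so the
  threshold is the imaginary axis. The resolvent bound enters as an a priori estimate on the kernel
  of P. The constants m, a and C are fixed here because the final rate and factor are to be
  functions of them alone.\<close>

locale stable_part = c0 J T D A for J :: "'a::{banach,real_inner} \<Rightarrow> 'a" and T D A +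
  fixes P :: "'a \<Rightarrow> 'a" and m a C :: real
  assumes P: "bounded_linear P" and PT: "\<And>t x. t \<ge> 0 \<Longrightarrow> P (T t x) = T t (P x)"
    and P_cm: "\<And>z x. P (z \<odot> x) = z \<odot> P x"
    and T_bound: "\<And>t x. t \<ge> 0 \<Longrightarrow> norm (T t x) \<le> m * exp (a * t) * norm x"
    and m: "m \<ge> 1" and a: "a \<ge> 0" and C: "C > 0"
    and est: "\<And>u z. u \<in> D \<Longrightarrow> P u = 0 \<Longrightarrow> Re z \<ge> 0 \<Longrightarrow> norm u \<le> C * norm (z \<odot> u - A u)"
begin

sublocale P: bounded_linear P by (rule P)

text \<open>At frequency k the coefficient V of the weighted, cut-off orbit solves
  \<open>z V - A V = G\<close> with z = b + 2 pi i k / N: integration by parts has no boundary terms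
  and moves the derivative onto the cutoff. The a priori estimate compares V with G for each k, and
  the transfer lemma passes to the energies.\<close>

lemma weighted_energy:
  assumes b: "b \<ge> 0" and x: "x \<in> D" "P x = 0" and N: "N > 0"
    and d: "\<And>t. t \<in> {0..N} \<Longrightarrow> (\<phi> has_real_derivative \<phi>' t) (at t within {0..N})"
    and c': "continuous_on {0..N} \<phi>'" and ends: "\<phi> 0 = 0" "\<phi> N = 0"
  shows "integral {0..N} (\<lambda>t. (\<phi> t * (exp (- (b * t)) * norm (T t x)))\<^sup>2) \<le> C\<^sup>2 * integral {0..N} (\<lambda>t. (\<phi>' t * (exp (- (b * t)) * norm (T t x)))\<^sup>2)"
proof -
  have c: "continuous_on {0..N} \<phi>" using d by (meson DERIV_continuous_on)
  define v where "v t = \<phi> t *\<^sub>R (exp (- (of_real b * of_real t)) \<odot> T t x)" for t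
  define g where "g t = \<phi>' t *\<^sub>R (exp (- (of_real b * of_real t)) \<odot> T t x)" for t
  have T_cont: "continuous_on {0..N} (\<lambda>t. T t y)" for y by (rule cont_on) auto
  interpret b: c0 J "\<lambda>t x. exp (- (of_real b * of_real t)) \<odot> T t x" D "\<lambda>x. A x - of_real b \<odot> x" by (rule rescale)
  define v' where "v' t = \<phi> t *\<^sub>R (exp (- (of_real b * of_real t)) \<odot> T t (A x - of_real b \<odot> x)) + \<phi>' t *\<^sub>R (exp (- (of_real b * of_real t)) \<odot> T t x)" for t
  have dv: "(v has_vector_derivative v' t) (at t within {0..N})" if t: "t \<in> {0..N}" for t
    unfolding v_def v'_def
    by (intro has_vector_derivative_scaleR d t has_vector_derivative_within_subset[OF b.T_deriv] x) (use t in auto)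
  have cv': "continuous_on {0..N} v'" unfolding v'_def by (intro continuous_intros c c' T_cont)
  \<comment> \<open>This Lipschitz constant depends on x and N, but the conclusion of the transfer
    does not contain it.\<close>
  obtain lam where lam: "\<And>t. t \<in> {0..N} \<Longrightarrow> norm (v' t) \<le> lam" "lam \<ge> 0"
  proof -
    have "bounded (v' ` {0..N})" using cv' by (intro compact_imp_bounded compact_continuous_image) auto
    then obtain lam where "\<forall>t\<in>{0..N}. norm (v' t) \<le> lam" by (auto simp: bounded_iff)
    then show ?thesis by (intro that[of "max lam 0"]) (auto simp: le_max_iff_disj)
  qed
  have lip: "norm (v t - v s) \<le> lam * \<bar>t - s\<bar>" if "s \<in> {0..N}" "t \<in> {0..N}" for s t
  proof -
    have "norm (v t - v s) \<le> lam * norm (t - s)"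
    proof (rule differentiable_bound[OF _ _ _ that(2,1)])
      show "convex {0..N}" by simp
      show "(v has_derivative (\<lambda>h. h *\<^sub>R v' r)) (at r within {0..N})" if "r \<in> {0..N}" for r
        using dv[OF that] by (simp add: has_vector_derivative_def)
      show "onorm (\<lambda>h. h *\<^sub>R v' r) \<le> lam" if "r \<in> {0..N}" for r
      proof (rule onorm_bound[OF lam(2)])
        show "norm (h *\<^sub>R v' r) \<le> lam * norm h" for h
          using mult_left_mono[OF lam(1)[OF that], of "\<bar>h\<bar>"] by (simp add: mult.commute)
      qed
    qed
    then show ?thesis by simp
  qed
  have main: "integral {0..N} (\<lambda>t. (norm (v t))\<^sup>2) \<le> C\<^sup>2 * integral {0..N} (\<lambda>t. (norm (g t))\<^sup>2)"
  proof (rule periodic_plancherel_transfer[OF N _ _ lip lam(2)])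
    show "continuous_on {0..N} v" "continuous_on {0..N} g" unfolding v_def g_def by (intro continuous_intros c c' T_cont)+
    show "v 0 = 0" "v N = 0" by (simp_all add: v_def ends)
    fix k :: real
    define z where "z = of_real b + 2 * of_real pi * \<i> * of_real (k / N)"
    interpret r: c0 J "\<lambda>t x. exp (- (z * of_real t)) \<odot> T t x" D "\<lambda>x. A x - z \<odot> x" by (rule rescale)
    have e: "ee (- (k * (t / N))) * exp (- (of_real b * of_real t)) = exp (- (z * of_real t))" for t
      by (simp add: exp_add[symmetric] z_def algebra_simps)
    define V where "V = integral {0..N} (\<lambda>t. \<phi> t *\<^sub>R (exp (- (z * of_real t)) \<odot> T t x))"
    define G where "G = integral {0..N} (\<lambda>t. \<phi>' t *\<^sub>R (exp (- (z * of_real t)) \<odot> T t x))"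
    have Vv: "integral {0..N} (\<lambda>t. ee (- (k * (t / N))) \<odot> v t) = V"
      and Gg: "integral {0..N} (\<lambda>t. ee (- (k * (t / N))) \<odot> g t) = G"
      unfolding v_def g_def V_def G_def by (simp_all only: cm_scaleR_right cm_cm e)
    have cV: "continuous_on {0..N} (\<lambda>t. \<psi> t *\<^sub>R (exp (- (z * of_real t)) \<odot> T t y))" if "continuous_on {0..N} \<psi>" for y \<psi>
      by (intro continuous_intros that T_cont)
    have VD: "V \<in> D" "A V - z \<odot> V = integral {0..N} (\<lambda>t. \<phi> t *\<^sub>R (exp (- (z * of_real t)) \<odot> T t (A x - z \<odot> x)))"
      unfolding V_def using r.weighted_integral_in_D[OF x(1) less_imp_le[OF N] c] by auto
    have "((\<lambda>t. \<phi> t *\<^sub>R (exp (- (z * of_real t)) \<odot> T t (A x - z \<odot> x)) + \<phi>' t *\<^sub>R (exp (- (z * of_real t)) \<odot> T t x)) has_integral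
       (\<phi> N *\<^sub>R (exp (- (z * of_real N)) \<odot> T N x) - \<phi> 0 *\<^sub>R (exp (- (z * of_real 0)) \<odot> T 0 x))) {0..N}"
    proof (rule fundamental_theorem_of_calculus[OF less_imp_le[OF N]])
      fix t assume t: "t \<in> {0..N}"
      show "((\<lambda>t. \<phi> t *\<^sub>R (exp (- (z * of_real t)) \<odot> T t x)) has_vector_derivative
         (\<phi> t *\<^sub>R (exp (- (z * of_real t)) \<odot> T t (A x - z \<odot> x)) + \<phi>' t *\<^sub>R (exp (- (z * of_real t)) \<odot> T t x))) (at t within {0..N})"
        by (intro has_vector_derivative_scaleR d t has_vector_derivative_within_subset[OF r.T_deriv] x) (use t in auto)
    qed
    from integral_unique[OF this] have "(A V - z \<odot> V) + G = 0"
      unfolding VD(2) G_def by (subst integral_add[symmetric]) (auto intro!: integrable_continuous_interval cV c c' simp: ends)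
    then have zV: "z \<odot> V - A V = G" by (simp add: algebra_simps add_eq_0_iff)
    have "P V = integral {0..N} (\<lambda>t. P (\<phi> t *\<^sub>R (exp (- (z * of_real t)) \<odot> T t x)))"
      unfolding V_def using integral_linear[OF integrable_continuous_interval[OF cV[OF c]] P] by (simp add: o_def)
    also have "\<dots> = integral {0..N} (\<lambda>t. 0)"
      by (intro integral_cong) (simp add: P.scaleR P_cm PT x T_lin)
    finally have "P V = 0" by simp
    moreover have "Re z \<ge> 0" using b by (simp add: z_def)
    ultimately have "norm V \<le> C * norm G" using est[OF VD(1), of z] zV by simp
    then show "norm (integral {0..N} (\<lambda>t. ee (- (k * (t / N))) \<odot> v t)) \<le> C * norm (integral {0..N} (\<lambda>t. ee (- (k * (t / N))) \<odot> g t))"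
      unfolding Vv Gg .
  qed
  have nv: "(norm (v t))\<^sup>2 = (\<phi> t * (exp (- (b * t)) * norm (T t x)))\<^sup>2" "(norm (g t))\<^sup>2 = (\<phi>' t * (exp (- (b * t)) * norm (T t x)))\<^sup>2" for t
    by (simp_all add: v_def g_def norm_exp_eq_Re power_mult_distrib)
  from main show ?thesis unfolding nv .
qed


text \<open>The first term is the energy on [0, 1] under the crude growth bound. In 32 = 16 * 2, the
  16 comes from the cutoff being at least 1/4 after time 1 and the 2 from the two parts of its
  derivative.\<close>

definition "energy_const = m\<^sup>2 * exp (2 * a) + 32 * C\<^sup>2 * (a + 1)\<^sup>2 * m\<^sup>2"
text \<open>The factor \<open>m\<^sup>2 * exp (2 * a)\<close> is the price of one unit time step; it
  multiplies 1 for times up to 1 and \<open>energy_const\<close> for later times.\<close>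

definition "growth_const = m\<^sup>2 * exp (2 * a) * (1 + energy_const)"
text \<open>Long enough for averaging to gain a factor 1/4 in the squared norm, and at least 1
  because \<open>energy_bound\<close> is stated for such times.\<close>

definition "decay_time = max 1 (4 * growth_const * energy_const)"
definition "decay_rate = ln 2 / decay_time"

lemma energy_const_pos: "energy_const > 0"
  unfolding energy_const_def using m by (intro add_pos_nonneg) auto

lemma growth_const_ge_1: "growth_const \<ge> 1"
proof -
  have "1 * 1 * 1 \<le> m\<^sup>2 * exp (2 * a) * (1 + energy_const)"
    using m a energy_const_pos by (intro mult_mono) auto
  then show ?thesis by (simp add: growth_const_def)
qed

lemma decay_rate_pos: "decay_rate > 0" by (simp add: decay_rate_def decay_time_def)

text \<open>The cutoff \<open>(1 - exp (-ct)) (1 - t/N)\<close> vanishes at both ends of the period. Its derivative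
  decays fast enough near 0 to absorb the crude growth bound of the semigroup; the remaining part
  is of order 1/N, so the a priori constant \<open>Kb\<close> disappears for large N.\<close>

lemma energy_bound:
  assumes b: "b \<ge> 0" and Kb: "\<And>t x. t \<ge> 0 \<Longrightarrow> x \<in> D \<Longrightarrow> P x = 0 \<Longrightarrow> exp (- (b * t)) * norm (T t x) \<le> Kb * norm x"
    and x: "x \<in> D" "P x = 0" and \<tau>: "\<tau> \<ge> 1"
  shows "integral {0..\<tau>} (\<lambda>t. (exp (- (b * t)) * norm (T t x))\<^sup>2) \<le> energy_const * (norm x)\<^sup>2"
proof -
  define e where "e t = exp (- (b * t)) * norm (T t x)" for t
  \<comment> \<open>With c = a + 1 the factor \<open>exp (- (c * t))\<close> turns the growth
    \<open>exp (a * t)\<close> into \<open>exp (- t)\<close>.\<close>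
  define c where "c = a + 1"
  have c: "c \<ge> 1" using a by (simp add: c_def)
  \<comment> \<open>The first entry keeps \<open>1 - t / N\<close> at least 1/2 up to time \<tau>;
    the second makes the contribution of Kb at most \<open>(norm x)\<^sup>2\<close>.\<close>
  define N where "N = max (2 * \<tau>) (2 * Kb\<^sup>2)"
  have N: "N \<ge> 2 * \<tau>" "N \<ge> 2 * Kb\<^sup>2" "N \<ge> 2" "N > 0" using \<tau> by (auto simp: N_def)
  have ce: "continuous_on {0..q} e" for q unfolding e_def by (intro continuous_intros cont_on) auto
  have cei: "continuous_on {p..q} (\<lambda>t. (e t)\<^sup>2)" if "p \<ge> 0" for p q
    by (intro continuous_intros continuous_on_subset[OF ce[of q]]) (use that in auto)
  have ei: "(\<lambda>t. (e t)\<^sup>2) integrable_on {p..q}" if "p \<ge> 0" for p q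
    by (intro integrable_continuous_interval cei that)
  have e_m: "e t \<le> m * exp (a * t) * norm x" if "t \<ge> 0" for t
  proof -
    have "e t \<le> 1 * norm (T t x)" unfolding e_def using b that by (intro mult_right_mono) auto
    then show ?thesis using T_bound[OF that, of x] by simp
  qed
  have e0: "e t \<ge> 0" for t by (simp add: e_def)
  define \<phi> where "\<phi> t = (1 - exp (- (c * t))) * (1 - t / N)" for t
  define \<phi>' where "\<phi>' t = c * exp (- (c * t)) * (1 - t / N) - (1 - exp (- (c * t))) / N" for t
  have cphi: "continuous_on S \<phi>" "continuous_on S \<phi>'" for S
    unfolding \<phi>_def \<phi>'_def using N by (auto intro!: continuous_intros)
  have E: "integral {0..N} (\<lambda>t. (\<phi> t * e t)\<^sup>2) \<le> C\<^sup>2 * integral {0..N} (\<lambda>t. (\<phi>' t * e t)\<^sup>2)"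
    unfolding e_def
  proof (rule weighted_energy[OF b x N(4)])
    show "(\<phi> has_real_derivative \<phi>' t) (at t within {0..N})" for t
      unfolding \<phi>_def \<phi>'_def using N by (auto intro!: derivative_eq_intros)
    show "continuous_on {0..N} \<phi>'" by (rule cphi)
    show "\<phi> 0 = 0" "\<phi> N = 0" using N by (auto simp: \<phi>_def)
  qed
  have upper: "integral {0..N} (\<lambda>t. (\<phi>' t * e t)\<^sup>2) \<le> 2 * c\<^sup>2 * m\<^sup>2 * (norm x)\<^sup>2"
  proof -
    have pt: "(\<phi>' t * e t)\<^sup>2 \<le> c\<^sup>2 * m\<^sup>2 * (norm x)\<^sup>2 * (2 * exp (- (2 * t))) + 2 * Kb\<^sup>2 * (norm x)\<^sup>2 / N\<^sup>2" if t: "t \<in> {0..N}" for t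
    proof -
      have "0 \<le> 1 - t / N" "1 - t / N \<le> 1" using t N by auto
      moreover have "0 \<le> 1 - exp (- (c * t))" "1 - exp (- (c * t)) \<le> 1" using t c by auto
      ultimately have "c * exp (- (c * t)) * (1 - t / N) \<le> c * exp (- (c * t)) * 1" "c * exp (- (c * t)) * (1 - t / N) \<ge> 0"
        "(1 - exp (- (c * t))) / N \<le> 1 / N" "(1 - exp (- (c * t))) / N \<ge> 0"
        using c N by (auto intro!: mult_left_mono divide_right_mono)
      then have "\<bar>\<phi>' t\<bar> \<le> c * exp (- (c * t)) + 1 / N" unfolding \<phi>'_def using N by (auto simp: abs_le_iff)
      then have "\<bar>\<phi>' t * e t\<bar> \<le> (c * exp (- (c * t)) + 1 / N) * e t" using e0 by (simp add: abs_mult mult_right_mono)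
      also have "\<dots> = c * exp (- (c * t)) * e t + 1 / N * e t" by (simp add: algebra_simps)
      also have "\<dots> \<le> c * exp (- (c * t)) * (m * exp (a * t) * norm x) + 1 / N * (Kb * norm x)"
        using e_m[of t] Kb[OF _ x, of t] t c N by (intro add_mono mult_left_mono) (auto simp: e_def)
      also have "c * exp (- (c * t)) * (m * exp (a * t) * norm x) = c * m * norm x * exp (- t)"
        by (simp add: c_def exp_add[symmetric] algebra_simps)
      finally have "\<bar>\<phi>' t * e t\<bar>\<^sup>2 \<le> (c * m * norm x * exp (- t) + 1 / N * (Kb * norm x))\<^sup>2" by (intro power_mono) auto
      also have "\<dots> \<le> 2 * (c * m * norm x * exp (- t))\<^sup>2 + 2 * (1 / N * (Kb * norm x))\<^sup>2"
      proof -
        have "(p + q)\<^sup>2 \<le> 2 * p\<^sup>2 + 2 * q\<^sup>2" for p q :: real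
          using zero_le_power2[of "p - q"] by (simp add: power2_sum power2_diff)
        then show ?thesis .
      qed
      also have "\<dots> = c\<^sup>2 * m\<^sup>2 * (norm x)\<^sup>2 * (2 * exp (- (2 * t))) + 2 * Kb\<^sup>2 * (norm x)\<^sup>2 / N\<^sup>2"
        by (simp add: power_mult_distrib power_divide exp_double[symmetric])
      finally show ?thesis by simp
    qed
    have exp_int: "((\<lambda>t. 2 * exp (- (2 * t))) has_integral (- exp (- (2 * N)) - (- exp (- (2 * 0))))) {0..N}"
      using N by (intro fundamental_theorem_of_calculus)
        (auto intro!: derivative_eq_intros simp: has_real_derivative_iff_has_vector_derivative[symmetric])
    have "integral {0..N} (\<lambda>t. (\<phi>' t * e t)\<^sup>2) \<le> integral {0..N} (\<lambda>t. c\<^sup>2 * m\<^sup>2 * (norm x)\<^sup>2 * (2 * exp (- (2 * t))) + 2 * Kb\<^sup>2 * (norm x)\<^sup>2 / N\<^sup>2)"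
      using N by (intro integral_le integrable_continuous_interval continuous_intros cphi ce pt) auto
    also have "\<dots> = c\<^sup>2 * m\<^sup>2 * (norm x)\<^sup>2 * integral {0..N} (\<lambda>t. 2 * exp (- (2 * t))) + 2 * Kb\<^sup>2 * (norm x)\<^sup>2 / N\<^sup>2 * N"
      using N by (subst integral_add) (auto intro!: integrable_continuous_interval continuous_intros simp only: integral_mult_right, simp_all)
    also have "\<dots> \<le> c\<^sup>2 * m\<^sup>2 * (norm x)\<^sup>2 * 1 + 1 * (norm x)\<^sup>2"
    proof (intro add_mono mult_left_mono)
      show "integral {0..N} (\<lambda>t. 2 * exp (- (2 * t))) \<le> 1" using integral_unique[OF exp_int] by simp
      have "2 * Kb\<^sup>2 * (norm x)\<^sup>2 / N\<^sup>2 * N = (2 * Kb\<^sup>2 / N) * (norm x)\<^sup>2" using N by (simp add: power2_eq_square)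
      also have "\<dots> \<le> 1 * (norm x)\<^sup>2" using N by (intro mult_right_mono) auto
      finally show "2 * Kb\<^sup>2 * (norm x)\<^sup>2 / N\<^sup>2 * N \<le> 1 * (norm x)\<^sup>2" .
    qed simp
    also have "\<dots> \<le> c\<^sup>2 * m\<^sup>2 * (norm x)\<^sup>2 + (c\<^sup>2 * m\<^sup>2) * (norm x)\<^sup>2"
    proof -
      have "1 * 1 \<le> c\<^sup>2 * m\<^sup>2" using c m by (intro mult_mono) auto
      then have "1 * (norm x)\<^sup>2 \<le> (c\<^sup>2 * m\<^sup>2) * (norm x)\<^sup>2" by (intro mult_right_mono) auto
      then show ?thesis by simp
    qed
    finally show ?thesis by simp
  qed
  have lower: "integral {1..\<tau>} (\<lambda>t. (e t)\<^sup>2) \<le> 16 * integral {0..N} (\<lambda>t. (\<phi> t * e t)\<^sup>2)"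
  proof -
    have "integral {1..\<tau>} (\<lambda>t. (e t)\<^sup>2) \<le> integral {1..\<tau>} (\<lambda>t. 16 * (\<phi> t * e t)\<^sup>2)"
    proof (rule integral_le)
      fix t assume t: "t \<in> {1..\<tau>}"
      have "2 \<le> exp (1::real)" using exp_ge_add_one_self[of 1] by simp
      then have "exp (- 1) \<le> (1/2::real)" by (simp add: exp_minus field_simps)
      moreover have "1 * 1 \<le> c * t" using t c by (intro mult_mono) auto
      then have "exp (- (c * t)) \<le> exp (- 1)" by simp
      ultimately have "1 - exp (- (c * t)) \<ge> 1/2" by linarith
      moreover have "1 - t / N \<ge> 1/2" using t N by (simp add: field_simps)
      ultimately have "(1/2) * (1/2) \<le> \<phi> t" unfolding \<phi>_def using t c by (intro mult_mono) auto
      then have "(1/4 * e t)\<^sup>2 \<le> (\<phi> t * e t)\<^sup>2" using e0 by (intro power_mono mult_right_mono) auto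
      then show "(e t)\<^sup>2 \<le> 16 * (\<phi> t * e t)\<^sup>2" by (simp add: power_mult_distrib power_divide)
    qed (use \<tau> in \<open>auto intro!: integrable_continuous_interval continuous_intros cphi continuous_on_subset[OF ce]\<close>)
    also have "\<dots> = 16 * integral {1..\<tau>} (\<lambda>t. (\<phi> t * e t)\<^sup>2)" by simp
    also have "\<dots> \<le> 16 * integral {0..N} (\<lambda>t. (\<phi> t * e t)\<^sup>2)"
      using \<tau> N by (intro mult_left_mono integral_subset_le integrable_continuous_interval continuous_intros cphi continuous_on_subset[OF ce[of N]]) auto
    finally show ?thesis .
  qed
  have first: "integral {0..1} (\<lambda>t. (e t)\<^sup>2) \<le> m\<^sup>2 * exp (2 * a) * (norm x)\<^sup>2"
  proof -
    have "integral {0..1} (\<lambda>t. (e t)\<^sup>2) \<le> integral {0..1::real} (\<lambda>t. m\<^sup>2 * exp (2 * a) * (norm x)\<^sup>2)"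
    proof (rule integral_le)
      fix t :: real assume t: "t \<in> {0..1}"
      have "a * t \<le> a" using t a mult_left_mono[of t 1 a] by simp
      then have "m * exp (a * t) * norm x \<le> m * exp a * norm x" using m by (intro mult_right_mono mult_left_mono) auto
      then have "(e t)\<^sup>2 \<le> (m * exp a * norm x)\<^sup>2" using e_m[of t] t e0[of t] by (intro power_mono) auto
      then show "(e t)\<^sup>2 \<le> m\<^sup>2 * exp (2 * a) * (norm x)\<^sup>2" by (simp add: power_mult_distrib exp_double)
    qed (auto intro!: ei)
    then show ?thesis by simp
  qed
  have "integral {0..\<tau>} (\<lambda>t. (e t)\<^sup>2) = integral {0..1} (\<lambda>t. (e t)\<^sup>2) + integral {1..\<tau>} (\<lambda>t. (e t)\<^sup>2)"
    using \<tau> by (intro Henstock_Kurzweil_Integration.integral_combine[symmetric] ei) auto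
  also have "integral {1..\<tau>} (\<lambda>t. (e t)\<^sup>2) \<le> 16 * (C\<^sup>2 * (2 * c\<^sup>2 * m\<^sup>2 * (norm x)\<^sup>2))"
    using lower E mult_left_mono[OF upper, of "C\<^sup>2"] by simp
  finally have "integral {0..\<tau>} (\<lambda>t. (e t)\<^sup>2) \<le> m\<^sup>2 * exp (2 * a) * (norm x)\<^sup>2 + 16 * (C\<^sup>2 * (2 * c\<^sup>2 * m\<^sup>2 * (norm x)\<^sup>2))"
    using first by linarith
  also have "\<dots> = energy_const * (norm x)\<^sup>2" by (simp add: energy_const_def c_def algebra_simps)
  finally show ?thesis by (simp add: e_def)
qed


section \<open>Datko's argument: from energy bounds to exponential decay\<close>

lemma T_invariant: "x \<in> D \<Longrightarrow> P x = 0 \<Longrightarrow> t \<ge> 0 \<Longrightarrow> T t x \<in> D \<and> P (T t x) = 0"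
  using T_in_D PT by (simp add: T_lin)

text \<open>The norm at time t is controlled by the norm at every time in [t - 1, t], so averaging
  over that window bounds it by the energy. The resulting constant no longer contains Kb.\<close>

lemma uniform_bound:
  assumes b: "b \<ge> 0" and Kb: "\<And>t x. t \<ge> 0 \<Longrightarrow> x \<in> D \<Longrightarrow> P x = 0 \<Longrightarrow> exp (- (b * t)) * norm (T t x) \<le> Kb * norm x"
    and x: "x \<in> D" "P x = 0" and t: "t \<ge> 0"
  shows "(exp (- (b * t)) * norm (T t x))\<^sup>2 \<le> growth_const * (norm x)\<^sup>2"
proof -
  define e where "e t = exp (- (b * t)) * norm (T t x)" for t
  have e0: "e s \<ge> 0" for s by (simp add: e_def)
  have step: "(e s)\<^sup>2 \<le> m\<^sup>2 * exp (2 * a) * (e r)\<^sup>2" if r: "0 \<le> r" "r \<le> s" "s \<le> r + 1" for r s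
  proof -
    have "norm (T s x) = norm (T (s - r) (T r x))" using T_add[of "s - r" r x] r by simp
    also have "\<dots> \<le> m * exp (a * (s - r)) * norm (T r x)" using T_bound r by simp
    also have "\<dots> \<le> m * exp a * norm (T r x)"
      using m a r mult_left_mono[of "s - r" 1 a] by (intro mult_right_mono mult_left_mono) auto
    finally have "exp (- (b * s)) * norm (T s x) \<le> exp (- (b * r)) * (m * exp a * norm (T r x))"
      using b r m by (intro mult_mono) (auto intro: mult_left_mono)
    then have "e s \<le> m * exp a * e r" by (simp add: e_def mult_ac)
    then have "(e s)\<^sup>2 \<le> (m * exp a * e r)\<^sup>2" using e0 by (intro power_mono) auto
    then show ?thesis by (simp add: power_mult_distrib exp_double)
  qed
  have me: "m\<^sup>2 * exp (2 * a) \<ge> 0" by simp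
  show ?thesis
  proof (cases "t \<le> 1")
    case True
    have "(e t)\<^sup>2 \<le> m\<^sup>2 * exp (2 * a) * (e 0)\<^sup>2" using step[of 0 t] t True by simp
    also have "\<dots> = m\<^sup>2 * exp (2 * a) * 1 * (norm x)\<^sup>2" by (simp add: e_def)
    also have "\<dots> \<le> growth_const * (norm x)\<^sup>2"
      unfolding growth_const_def using energy_const_pos by (intro mult_right_mono mult_left_mono) auto
    finally show ?thesis by (simp add: e_def)
  next
    case False
    have ce: "continuous_on S (\<lambda>t. (e t)\<^sup>2)" if "S \<subseteq> {0..}" for S
      unfolding e_def using that by (intro continuous_intros cont_on)
    have "(e t)\<^sup>2 = integral {t-1..t} (\<lambda>s. (e t)\<^sup>2)" by simp
    also have "\<dots> \<le> integral {t-1..t} (\<lambda>s. m\<^sup>2 * exp (2 * a) * (e s)\<^sup>2)"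
      using False by (intro integral_le integrable_continuous_interval continuous_on_mult continuous_on_const ce step) auto
    also have "\<dots> = m\<^sup>2 * exp (2 * a) * integral {t-1..t} (\<lambda>s. (e s)\<^sup>2)" by simp
    also have "integral {t-1..t} (\<lambda>s. (e s)\<^sup>2) \<le> integral {0..t} (\<lambda>s. (e s)\<^sup>2)"
      using False by (intro integral_subset_le integrable_continuous_interval ce) auto
    also have "\<dots> \<le> energy_const * (norm x)\<^sup>2" unfolding e_def using False by (intro energy_bound[OF b Kb x]) auto
    finally have "(e t)\<^sup>2 \<le> m\<^sup>2 * exp (2 * a) * (energy_const * (norm x)\<^sup>2)" by (simp add: mult_left_mono)
    also have "\<dots> = m\<^sup>2 * exp (2 * a) * energy_const * (norm x)\<^sup>2" by simp
    also have "\<dots> \<le> growth_const * (norm x)\<^sup>2"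
      unfolding growth_const_def using energy_const_pos by (intro mult_right_mono mult_left_mono) auto
    finally show ?thesis by (simp add: e_def)
  qed
qed

text \<open>Started at time s, \<open>uniform_bound\<close> controls the value at t by the value at
  s, for every s in [0, t]. Integrating over s bounds t times the squared value at t by the
  energy.\<close>

lemma half_decay:
  assumes b: "b \<ge> 0" and Kb: "\<And>t x. t \<ge> 0 \<Longrightarrow> x \<in> D \<Longrightarrow> P x = 0 \<Longrightarrow> exp (- (b * t)) * norm (T t x) \<le> Kb * norm x"
    and x: "x \<in> D" "P x = 0"
  shows "exp (- (b * decay_time)) * norm (T decay_time x) \<le> 1/2 * norm x"
proof -
  define e where "e t = exp (- (b * t)) * norm (T t x)" for t
  define t where "t = decay_time"
  have t: "t \<ge> 1" "t \<ge> 4 * growth_const * energy_const" by (auto simp: t_def decay_time_def)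
  have ce: "continuous_on {0..t} (\<lambda>t. (e t)\<^sup>2)" unfolding e_def by (intro continuous_intros cont_on) auto
  have step: "(e t)\<^sup>2 \<le> growth_const * (e s)\<^sup>2" if s: "s \<in> {0..t}" for s
  proof -
    have W: "T s x \<in> D" "P (T s x) = 0" using T_invariant[OF x, of s] s by auto
    have "T t x = T (t - s) (T s x)" using T_add[of "t - s" s x] s by simp
    moreover have "exp (- (b * t)) = exp (- (b * s)) * exp (- (b * (t - s)))" by (simp add: exp_add[symmetric] algebra_simps)
    ultimately have "(e t)\<^sup>2 = (exp (- (b * s)))\<^sup>2 * (exp (- (b * (t - s))) * norm (T (t - s) (T s x)))\<^sup>2"
      by (simp add: e_def power_mult_distrib)
    also have "\<dots> \<le> (exp (- (b * s)))\<^sup>2 * (growth_const * (norm (T s x))\<^sup>2)"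
      using s by (intro mult_left_mono uniform_bound[OF b Kb W]) auto
    finally show ?thesis by (simp add: e_def power_mult_distrib mult_ac)
  qed
  have "t * (e t)\<^sup>2 = integral {0..t} (\<lambda>s. (e t)\<^sup>2)" using t by simp
  also have "\<dots> \<le> integral {0..t} (\<lambda>s. growth_const * (e s)\<^sup>2)"
    by (intro integral_le integrable_continuous_interval continuous_on_mult continuous_on_const ce step)
  also have "\<dots> = growth_const * integral {0..t} (\<lambda>s. (e s)\<^sup>2)" by simp
  also have "\<dots> \<le> growth_const * (energy_const * (norm x)\<^sup>2)"
    unfolding e_def using t growth_const_ge_1 by (intro mult_left_mono energy_bound[OF b Kb x]) auto
  also have "\<dots> = growth_const * energy_const * (norm x)\<^sup>2" by simp
  also have "\<dots> \<le> t / 4 * (norm x)\<^sup>2" using t by (intro mult_right_mono) auto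
  finally have "t * (e t)\<^sup>2 \<le> t * (1/2 * norm x)\<^sup>2" by (simp add: power_mult_distrib power_divide)
  then have "(e t)\<^sup>2 \<le> (1/2 * norm x)\<^sup>2" using t by simp
  then have "e t \<le> 1/2 * norm x" by (rule power2_le_imp_le) simp
  then show ?thesis by (simp add: e_def t_def)
qed

text \<open>Iterates the halving over multiples of \<open>decay_time\<close> and treats the
  remaining time by \<open>uniform_bound\<close>.\<close>

lemma decay_step:
  assumes b: "b \<ge> 0" and Kb: "\<And>t x. t \<ge> 0 \<Longrightarrow> x \<in> D \<Longrightarrow> P x = 0 \<Longrightarrow> exp (- (b * t)) * norm (T t x) \<le> Kb * norm x"
    and x: "x \<in> D" "P x = 0" and t: "t \<ge> 0"
  shows "exp (- (b * t)) * norm (T t x) \<le> 2 * sqrt growth_const * exp (- (decay_rate * t)) * norm x"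
proof -
  let ?s = decay_time
  have s: "?s \<ge> 1" by (simp add: decay_time_def)
  have pow: "exp (- (b * (real n * ?s))) * norm (T (real n * ?s) x) \<le> (1/2) ^ n * norm x" for n
  proof (induction n)
    case (Suc n)
    have W: "T (real n * ?s) x \<in> D" "P (T (real n * ?s) x) = 0" using T_invariant[OF x, of "real n * ?s"] s by auto
    have "T (real (Suc n) * ?s) x = T ?s (T (real n * ?s) x)"
      using T_add[of ?s "real n * ?s" x] s by (simp add: algebra_simps)
    moreover have "exp (- (b * (real (Suc n) * ?s))) = exp (- (b * (real n * ?s))) * exp (- (b * ?s))"
      by (simp add: exp_add[symmetric] algebra_simps)
    ultimately have "exp (- (b * (real (Suc n) * ?s))) * norm (T (real (Suc n) * ?s) x)
      = exp (- (b * (real n * ?s))) * (exp (- (b * ?s)) * norm (T ?s (T (real n * ?s) x)))" by simp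
    also have "\<dots> \<le> exp (- (b * (real n * ?s))) * (1/2 * norm (T (real n * ?s) x))"
      by (intro mult_left_mono half_decay[OF b Kb W]) auto
    also have "\<dots> \<le> 1/2 * ((1/2) ^ n * norm x)" using Suc by simp
    finally show ?case by simp
  qed simp
  define n where "n = nat \<lfloor>t / ?s\<rfloor>"
  have n: "real n \<le> t / ?s" "t / ?s < real n + 1" using t s by (auto simp: n_def)
  have r: "t - real n * ?s \<ge> 0" using n s by (simp add: field_simps)
  have W: "T (real n * ?s) x \<in> D" "P (T (real n * ?s) x) = 0" using T_invariant[OF x, of "real n * ?s"] s by auto
  have sq: "exp (- (b * q)) * norm (T q y) \<le> sqrt growth_const * norm y" if "y \<in> D" "P y = 0" "q \<ge> 0" for q y
  proof -
    have "(exp (- (b * q)) * norm (T q y))\<^sup>2 \<le> growth_const * (norm y)\<^sup>2"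
      by (rule uniform_bound[OF b Kb that])
    also have "\<dots> = (sqrt growth_const * norm y)\<^sup>2" using growth_const_ge_1 by (simp add: power_mult_distrib)
    finally have "(exp (- (b * q)) * norm (T q y))\<^sup>2 \<le> (sqrt growth_const * norm y)\<^sup>2" .
    then show ?thesis using growth_const_ge_1 by (elim power2_le_imp_le) simp
  qed
  have "T t x = T (t - real n * ?s) (T (real n * ?s) x)" using T_add[of "t - real n * ?s" "real n * ?s" x] r s by simp
  moreover have "exp (- (b * t)) = exp (- (b * (real n * ?s))) * exp (- (b * (t - real n * ?s)))"
    by (simp add: exp_add[symmetric] algebra_simps)
  ultimately have "exp (- (b * t)) * norm (T t x) = exp (- (b * (real n * ?s))) * (exp (- (b * (t - real n * ?s))) * norm (T (t - real n * ?s) (T (real n * ?s) x)))"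
    by simp
  also have "\<dots> \<le> exp (- (b * (real n * ?s))) * (sqrt growth_const * norm (T (real n * ?s) x))"
    by (intro mult_left_mono sq W r) auto
  also have "\<dots> = sqrt growth_const * (exp (- (b * (real n * ?s))) * norm (T (real n * ?s) x))" by simp
  also have "\<dots> \<le> sqrt growth_const * ((1/2) ^ n * norm x)"
    using growth_const_ge_1 by (intro mult_left_mono pow) auto
  also have "\<dots> \<le> sqrt growth_const * (2 * exp (- (decay_rate * t)) * norm x)"
  proof (intro mult_left_mono mult_right_mono)
    \<comment> \<open>Rounding the number of halvings down costs the factor 2.\<close>
    have "(1/2::real) ^ n = exp (- (real n * ln 2))" by (simp add: exp_minus exp_of_nat_mult power_one_over inverse_eq_divide)
    also have "\<dots> \<le> exp (ln 2 - decay_rate * t)"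
    proof -
      have "decay_rate * t = ln 2 * (t / ?s)" by (simp add: decay_rate_def)
      also have "\<dots> \<le> ln 2 * (real n + 1)" using n by (intro mult_left_mono) auto
      finally show ?thesis by (simp add: algebra_simps)
    qed
    also have "\<dots> = 2 * exp (- (decay_rate * t))" by (simp add: exp_diff exp_minus field_simps)
    finally show "(1/2) ^ n \<le> 2 * exp (- (decay_rate * t))" .
  qed (use growth_const_ge_1 in auto)
  finally show ?thesis by (simp add: mult_ac)
qed

text \<open>The gain in the exponent does not depend on the rate one starts from, hence finitely many
  steps lead from the crude growth rate to rate 0.\<close>

lemma bootstrap:
  "\<exists>K. \<forall>t\<ge>0. \<forall>x\<in>D. P x = 0 \<longrightarrow> exp (- (max 0 (a - real n * decay_rate) * t)) * norm (T t x) \<le> K * norm x"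
proof (induction n)
  case 0
  show ?case
  proof (intro exI[of _ m] allI ballI impI)
    fix t x assume t: "(0::real) \<le> t" and "x \<in> D" "P x = 0"
    have "exp (- (a * t)) * norm (T t x) \<le> exp (- (a * t)) * (m * exp (a * t) * norm x)"
      by (intro mult_left_mono T_bound t) auto
    also have "\<dots> = m * norm x" by (simp add: exp_minus)
    finally show "exp (- (max 0 (a - real 0 * decay_rate) * t)) * norm (T t x) \<le> m * norm x" using a by simp
  qed
next
  case (Suc n)
  \<comment> \<open>The clamp at 0 respects \<open>b \<ge> 0\<close>: a negative weight would leave
    the half-plane where the a priori estimate is available.\<close>
  define b where "b = max 0 (a - real n * decay_rate)"
  define b' where "b' = max 0 (a - real (Suc n) * decay_rate)"
  have bb: "b \<ge> 0" "b' \<ge> b - decay_rate" using decay_rate_pos by (auto simp: b_def b'_def max_def algebra_simps)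
  obtain K where K: "\<And>t x. t \<ge> 0 \<Longrightarrow> x \<in> D \<Longrightarrow> P x = 0 \<Longrightarrow> exp (- (b * t)) * norm (T t x) \<le> K * norm x"
    using Suc unfolding b_def by blast
  show ?case unfolding b'_def[symmetric]
  proof (intro exI[of _ "2 * sqrt growth_const"] allI ballI impI)
    fix t x assume t: "(0::real) \<le> t" and x: "x \<in> D" "P x = 0"
    have "exp (- (b' * t)) * norm (T t x) \<le> exp (- ((b - decay_rate) * t)) * norm (T t x)"
      using bb(2) t by (intro mult_right_mono) (auto intro: mult_right_mono)
    also have "\<dots> = exp (decay_rate * t) * (exp (- (b * t)) * norm (T t x))"
      by (simp add: exp_add[symmetric] algebra_simps)
    also have "\<dots> \<le> exp (decay_rate * t) * (2 * sqrt growth_const * exp (- (decay_rate * t)) * norm x)"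
      by (intro mult_left_mono decay_step[OF bb(1) K x t]) auto
    also have "\<dots> = 2 * sqrt growth_const * norm x" by (simp add: exp_minus)
    finally show "exp (- (b' * t)) * norm (T t x) \<le> 2 * sqrt growth_const * norm x" .
  qed
qed

text \<open>P commutes with the semigroup, so time averages of an orbit starting in the kernel stay
  in the kernel.\<close>

lemma kernel_D_dense:
  assumes "P x = 0"
  obtains y where "\<And>n::nat. y n \<in> D" "\<And>n. P (y n) = 0" "y \<longlonglongrightarrow> x"
proof -
  define y where "y n = (1 / (1 / real (Suc n))) *\<^sub>R integral {0..0 + 1 / real (Suc n)} (\<lambda>s. T s x)" for n
  have "P (integral {0..0 + 1 / real (Suc n)} (\<lambda>s. T s x)) = 0" for n
  proof -
    have "P (integral {0..0 + 1 / real (Suc n)} (\<lambda>s. T s x)) = integral {0..0 + 1 / real (Suc n)} (\<lambda>s. P (T s x))"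
      using integral_linear[OF T_int P, of 0 "0 + 1 / real (Suc n)" x] by (simp add: o_def)
    also have "\<dots> = integral {0..0 + 1 / real (Suc n)} (\<lambda>s. 0)" by (intro integral_cong) (simp add: PT assms T_lin)
    finally show ?thesis by simp
  qed
  then have "P (y n) = 0" for n by (simp only: y_def P.scaleR scaleR_zero_right)
  moreover have "y n \<in> D" for n unfolding y_def by (intro D_scaleR integral_in_D) auto
  moreover have "y \<longlonglongrightarrow> T 0 x"
  proof -
    have "filterlim (\<lambda>n. 1 / real (Suc n)) (at_right 0) sequentially"
      using LIMSEQ_inverse_real_of_nat unfolding filterlim_at by (simp add: inverse_eq_divide)
    from filterlim_compose[OF average_tendsto[OF cont[of x]] this] show ?thesis by (simp only: y_def[abs_def])
  qed
  ultimately show ?thesis by (intro that[of y]) simp_all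
qed

text \<open>Once enough steps have brought the weight down to 0, one further
  \<open>decay_step\<close> with weight 0 yields genuine decay at rate \<open>decay_rate\<close>.
  Density within the kernel removes the domain condition.\<close>

theorem uniform_exponential_decay:
  assumes x: "P x = 0" and t: "t \<ge> 0"
  shows "norm (T t x) \<le> 2 * sqrt growth_const * exp (- (decay_rate * t)) * norm x"
proof -
  obtain n :: nat where "real n > a / decay_rate" using reals_Archimedean2 by blast
  then have "a - real n * decay_rate \<le> 0" using decay_rate_pos by (simp add: field_simps)
  then have "max 0 (a - real n * decay_rate) = 0" by simp
  with bootstrap[of n] obtain K where K: "\<And>t x. t \<ge> 0 \<Longrightarrow> x \<in> D \<Longrightarrow> P x = 0 \<Longrightarrow> exp (- (0 * t)) * norm (T t x) \<le> K * norm x"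
    by auto
  have D: "norm (T t y) \<le> 2 * sqrt growth_const * exp (- (decay_rate * t)) * norm y" if "y \<in> D" "P y = 0" for y
  proof -
    have "exp (- (0 * t)) * norm (T t y) \<le> 2 * sqrt growth_const * exp (- (decay_rate * t)) * norm y"
      by (rule decay_step[OF order_refl K that t])
    then show ?thesis by simp
  qed
  obtain y where y: "\<And>n::nat. y n \<in> D" "\<And>n. P (y n) = 0" "y \<longlonglongrightarrow> x" using kernel_D_dense[OF x] by blast
  interpret Tt: bounded_linear "T t" by (rule T_bl[OF t])
  show ?thesis
  proof (rule tendsto_le)
    show "(\<lambda>n. norm (T t (y n))) \<longlonglongrightarrow> norm (T t x)" by (intro tendsto_norm Tt.tendsto y)
    show "(\<lambda>n. 2 * sqrt growth_const * exp (- (decay_rate * t)) * norm (y n)) \<longlonglongrightarrow> 2 * sqrt growth_const * exp (- (decay_rate * t)) * norm x"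
      by (intro tendsto_intros y)
  qed (use D y in auto)
qed

end


section \<open>Decay and the reduced resolvent\<close>

text \<open>The condition under the definite description in \<open>reduced_resolvent\<close>. Working with it
  avoids transporting a definite description that is not known to be uniquely satisfied.\<close>

definition reduced_solution ::
  "('a::real_normed_vector \<Rightarrow> 'a) \<Rightarrow> 'a set \<Rightarrow> ('a \<Rightarrow> 'a) \<Rightarrow> ('a \<Rightarrow> 'a) \<Rightarrow> complex \<Rightarrow> 'a \<Rightarrow> 'a \<Rightarrow> bool" where
  "reduced_solution J D A P z x y \<longleftrightarrow> y \<in> D \<and> y \<in> range (\<lambda>u. u - P u) \<and> cmul J z y - A y = x - P x"

lemma exp_rate_le:
  fixes p q c :: real
  assumes le: "\<And>t. t \<ge> 0 \<Longrightarrow> exp (p * t) \<le> c * exp (q * t)"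
  shows "p \<le> q"
proof (rule ccontr)
  assume "\<not> p \<le> q"
  then have pq: "p - q > 0" by simp
  have c: "c \<ge> 1" using le[of 0] by simp
  define t where "t = (ln c + 1) / (p - q)"
  have "t \<ge> 0" using c pq by (simp add: t_def)
  from le[OF this] have "exp (p * t) * exp (- (q * t)) \<le> c * exp (q * t) * exp (- (q * t))"
    by (intro mult_right_mono) auto
  then have "exp ((p - q) * t) \<le> c" by (simp add: mult.assoc exp_add[symmetric] algebra_simps)
  moreover have "(p - q) * t = ln c + 1" using pq by (simp add: t_def)
  ultimately have "exp (ln c + 1) \<le> exp (ln c)" using c by simp
  then show False by simp
qed

context spectral
begin

lemma P_lin: "P (x - y) = P x - P y" "P 0 = 0" "P (x + y) = P x + P y"
proof -
  interpret bounded_linear P by (rule cboundedD[OF P_cbounded])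
  show "P (x - y) = P x - P y" "P 0 = 0" "P (x + y) = P x + P y" by (simp_all add: diff zero add)
qed

lemma range_complement_iff: "u \<in> range (\<lambda>v. v - P v) \<longleftrightarrow> P u = 0"
proof
  assume "P u = 0"
  then show "u \<in> range (\<lambda>v. v - P v)" by (intro image_eqI[of _ _ u]) auto
qed (auto simp: P_lin P_idem)

text \<open>Writing u = R w y for one resolvent point w expresses A u through u and y, and replaces
  the unbounded operator by R w, which commutes with P.\<close>

lemma P_A_zero:
  assumes "u \<in> D" "P u = 0" shows "P (A u) = 0"
proof -
  obtain w where w: "w \<in> \<rho>"
  proof -
    have "\<exists>w. w \<in> {z. Re z > w2} - \<Sigma>"
    proof (rule ccontr)
      assume "\<not> ?thesis"
      then have "{z. Re z > w2} \<subseteq> \<Sigma>" by blast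
      then have "finite {z. Re z > w2}" using fin finite_subset by blast
      then show False using uncountable_halfspace_Re_gt[of w2] countable_finite by blast
    qed
    then show ?thesis using that gap by blast
  qed
  define y where "y = w \<odot> u - A u"
  have "u = R w y" unfolding y_def using R_props(3)[OF w assms(1)] by simp
  then have "R w (P y) = 0" using P_commute[OF R_cb[OF w] R_commute[OF w], of y] assms(2) by simp
  then have "P y = 0" using R_props(2)[OF w, of "P y"] by (simp add: A_zero)
  moreover have "A u = w \<odot> u - y" by (simp add: y_def)
  ultimately show ?thesis using assms(2) cboundedD(3)[OF P_cbounded] by (simp add: P_lin)
qed

lemma reduced_solution_iff: "reduced_solution J D A P z x u \<longleftrightarrow> u \<in> D \<and> P u = 0 \<and> z \<odot> u - A u = x - P x"
  by (simp add: reduced_solution_def range_complement_iff)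

text \<open>A nonzero difference of two solutions would be an eigenvector for a point of the closed
  half-plane, which P both fixes and kills. Together with existence this identifies the value of
  \<open>reduced_resolvent\<close>.\<close>

lemma reduced_solution_unique:
  assumes z: "Re z \<ge> w0" and "reduced_solution J D A P z x u" "reduced_solution J D A P z x v"
  shows "v = u"
proof -
  have u: "u \<in> D" "P u = 0" "z \<odot> u - A u = x - P x" and v: "v \<in> D \<and> P v = 0 \<and> z \<odot> v - A v = x - P x"
    using assms(2,3) by (auto simp: reduced_solution_iff)
  have d: "v - u \<in> D" "P (v - u) = 0" using v u by (auto simp: D_diff P_lin)
  have "z \<odot> (v - u) - A (v - u) = (z \<odot> v - A v) - (z \<odot> u - A u)"
    using conjunct1[OF v] u(1) by (simp add: A_diff cm_diff_right algebra_simps)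
  also have "\<dots> = 0" using v u by simp
  finally have "A (v - u) = z \<odot> (v - u)" by simp
  then show "v = u" using P_eigenvector(2)[OF d(1), of z] d(2) z w2 by (cases "v - u = 0") auto
qed

end

context pert_family
begin

abbreviation "Pb \<beta> \<equiv> total_proj J D (Lb \<beta>) w0"
abbreviation "Qb \<beta> \<equiv> \<lambda>x. x - Pb \<beta> x"

lemma Pb_facts:
  assumes \<beta>: "\<beta> \<in> B"
  shows "cbounded J (Pb \<beta>)" "Pb \<beta> (Qb \<beta> x) = 0" "t \<ge> 0 \<Longrightarrow> Pb \<beta> (U \<beta> t x) = U \<beta> t (Pb \<beta> x)"
proof -
  obtain w2 where "spectral J D (Lb \<beta>) w0 w2" using spectral_gap[OF \<beta>] by blast
  then interpret sp: spectral J D "Lb \<beta>" w0 w2 .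
  interpret u: c0 J "U \<beta>" D "Lb \<beta>" by (rule U[OF \<beta>])
  show "cbounded J (Pb \<beta>)" by (rule sp.P_cbounded)
  show "Pb \<beta> (Qb \<beta> x) = 0" by (simp add: sp.P_lin sp.P_idem)
  show "t \<ge> 0 \<Longrightarrow> Pb \<beta> (U \<beta> t x) = U \<beta> t (Pb \<beta> x)"
    by (rule sp.P_commute[OF u.T_cb u.T_R_commute, symmetric])
qed

lemma Qb_bounded_linear: "\<beta> \<in> B \<Longrightarrow> bounded_linear (Qb \<beta>)"
  by (intro bounded_linear_sub bounded_linear_ident cboundedD(1)[OF Pb_facts(1)])

text \<open>An eigenvector for a spectral point in the strip lies in the kernel of the projection,
  so its exact exponential growth is limited by \<omega>. The factor \<open>k \<beta>\<close> stands
  for the norm of \<open>Qb \<beta>\<close>, which is not yet bounded uniformly.\<close>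

lemma strip_free:
  assumes dec: "\<And>\<tau> \<beta> x. \<tau> \<ge> 0 \<Longrightarrow> \<beta> \<in> B \<Longrightarrow> norm (U \<beta> \<tau> (Qb \<beta> x)) \<le> M1 * exp (\<omega> * \<tau>) * (k \<beta> * norm x)"
    and \<beta>: "\<beta> \<in> B" and z: "Re z > w" "Re z > \<omega>" "Re z < w0"
  shows "z \<in> \<rho>b \<beta>"
proof (rule ccontr)
  assume nz: "z \<notin> \<rho>b \<beta>"
  obtain v where v: "v \<in> D" "norm v = 1" "Lb \<beta> v = z \<odot> v" using spectrum_eigenvector[OF \<beta> z(1) nz] by blast
  obtain w2 where "spectral J D (Lb \<beta>) w0 w2" using spectral_gap[OF \<beta>] by blast
  then interpret sp: spectral J D "Lb \<beta>" w0 w2 .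
  interpret u: c0 J "U \<beta>" D "Lb \<beta>" by (rule U[OF \<beta>])
  have "Pb \<beta> v = 0" using sp.P_foreign_eigenvector[OF v(1,3)] z(3) by (simp add: sp.Sigma_iff)
  then have "exp (Re z * t) \<le> (M1 * k \<beta>) * exp (\<omega> * t)" if "t \<ge> 0" for t
    using dec[OF that \<beta>, of v] u.eigenvector_semigroup[OF v(1,3) that] v(2) by (simp add: norm_exp_eq_Re mult_ac)
  from exp_rate_le[OF this] show False using z(2) by simp
qed

text \<open>Needed because the decay estimate carries the norm of \<open>Qb \<beta>\<close> on its
  right-hand side. The strip between \<open>max w \<omega>\<close> and w0 is free for all
  parameters, so b, the centre and the radius can be chosen once.\<close>

lemma decay_imp_projection_bound:
  assumes dec: "\<And>\<tau> \<beta> x. \<tau> \<ge> 0 \<Longrightarrow> \<beta> \<in> B \<Longrightarrow> norm (U \<beta> \<tau> (Qb \<beta> x)) \<le> M1 * exp (\<omega> * \<tau>) * (k \<beta> * norm x)"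
    and \<omega>: "\<omega> < w0"
  obtains c where "c > 0" "\<And>\<beta> x. \<beta> \<in> B \<Longrightarrow> norm (Qb \<beta> x) \<le> c * norm x"
proof -
  define w2 where "w2 = max w \<omega>"
  have w2: "w2 < w0" "w2 \<ge> w" "w2 \<ge> \<omega>" using w \<omega> by (auto simp: w2_def)
  define b where "b = (w2 + w0) / 2"
  have b: "w2 < b" "b < w0" "w < b" using w2 by (auto simp: b_def)
  have free: "z \<in> \<rho>b \<beta>" if "\<beta> \<in> B" "Re z > w2" "Re z < w0" for \<beta> z
    using that w2 by (intro strip_free[OF dec that(1)]) auto
  obtain R0 where R0: "\<And>\<beta> z. \<beta> \<in> B \<Longrightarrow> Re z \<ge> b \<Longrightarrow> z \<notin> \<rho>b \<beta> \<Longrightarrow> cmod z \<le> R0"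
    using spectrum_bounded[OF b(3)] by metis
  obtain C where C: "C > b" "\<And>z. Re z \<ge> w0 \<Longrightarrow> cmod z \<le> R0 \<Longrightarrow> cmod (z - of_real C) < C - b"
    using half_plane_disc[OF b(2)] by metis
  let ?G = "sphere (complex_of_real C) (C - b)"
  have sp: "spectral J D (Lb \<beta>) w0 w2" if \<beta>: "\<beta> \<in> B" for \<beta>
  proof -
    obtain w2' where "spectral J D (Lb \<beta>) w0 w2'" using spectral_gap[OF \<beta>] by blast
    then interpret s: spectral J D "Lb \<beta>" w0 w2' .
    show ?thesis
    proof (intro spectral.intro spectral_axioms.intro Lb_coper \<beta> w2 s.fin)
      show "{z. w2 < Re z} - Sigma_set J D (Lb \<beta>) w0 \<subseteq> \<rho>b \<beta>"
        using free[OF \<beta>] by (force simp: s.Sigma_iff not_less)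
    qed
  qed
  have inball: "Sigma_set J D (Lb \<beta>) w0 \<subseteq> ball (of_real C) (C - b)" if \<beta>: "\<beta> \<in> B" for \<beta>
  proof
    fix z assume z: "z \<in> Sigma_set J D (Lb \<beta>) w0"
    interpret s: spectral J D "Lb \<beta>" w0 w2 by (rule sp[OF \<beta>])
    have "cmod z \<le> R0" using R0[OF \<beta>] z b by (auto simp: s.Sigma_iff)
    then show "z \<in> ball (of_real C) (C - b)" using C(2) z by (auto simp: s.Sigma_iff dist_norm norm_minus_commute)
  qed
  have circ: "Pb \<beta> x = riesz_proj J D (Lb \<beta>) (of_real C) (C - b) x" "?G \<subseteq> \<rho>b \<beta>" if \<beta>: "\<beta> \<in> B" for \<beta> x
    using spectral.P_circle[OF sp[OF \<beta>] b(1) refl _ inball[OF \<beta>]] C(1) by auto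
  obtain c where c: "c > 0" "\<And>\<beta> z x. \<beta> \<in> B \<Longrightarrow> z \<in> ?G \<Longrightarrow> norm (resolvent J D (Lb \<beta>) z x) \<le> c * norm x"
  proof (rule uniform_resolvent_bound[OF b(3), of ?G])
    show "Re z \<ge> b" if "z \<in> ?G" for z
      using that abs_Re_le_cmod[of "complex_of_real C - z"] by (auto simp: dist_norm abs_le_iff)
  qed (use circ in auto)
  show ?thesis
  proof (rule that[of "1 + (C - b) * c"])
    show "1 + (C - b) * c > 0" using C c by (simp add: add_pos_pos)
    fix \<beta> x assume \<beta>: "\<beta> \<in> B"
    have "norm (Pb \<beta> x) \<le> (C - b) * c * norm x"
      unfolding circ(1)[OF \<beta>] using C(1) by (intro coper.riesz_norm_le[OF Lb_coper[OF \<beta>]] c(2) \<beta> circ(2)) auto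
    then show "norm (Qb \<beta> x) \<le> (1 + (C - b) * c) * norm x"
      using norm_triangle_ineq4[of x "Pb \<beta> x"] by (simp add: algebra_simps)
  qed
qed

lemma reduced_solution_unique_family:
  assumes "\<beta> \<in> B" "Re z \<ge> w0" "reduced_solution J D (Lb \<beta>) (Pb \<beta>) z x u" "reduced_solution J D (Lb \<beta>) (Pb \<beta>) z x v"
  shows "v = u"
proof -
  obtain w2 where "spectral J D (Lb \<beta>) w0 w2" using spectral_gap[OF assms(1)] by blast
  then show ?thesis using spectral.reduced_solution_unique assms(2-4) by blast
qed

text \<open>The solution is the Laplace transform of the orbit of \<open>Qb \<beta> x\<close>; for
  Re z \<ge> w0 the margin \<open>w0 - \<omega>\<close> makes it converge and appears in the
  denominator of C.\<close>

lemma decay_imp_reduced_solution: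
  assumes \<omega>: "\<omega> < w0" and M1: "M1 \<ge> 1"
    and dec: "\<And>\<tau> \<beta>. \<tau> \<ge> 0 \<Longrightarrow> \<beta> \<in> B \<Longrightarrow> onorm (U \<beta> \<tau> \<circ> Qb \<beta>) \<le> M1 * exp (\<omega> * \<tau>) * onorm (Qb \<beta>)"
  shows "\<exists>C>0. \<forall>z \<beta> x. Re z \<ge> w0 \<longrightarrow> \<beta> \<in> B \<longrightarrow> (\<exists>u. reduced_solution J D (Lb \<beta>) (Pb \<beta>) z x u \<and> norm u \<le> C * norm x)"
proof -
  have dec': "norm (U \<beta> \<tau> (Qb \<beta> x)) \<le> M1 * exp (\<omega> * \<tau>) * (onorm (Qb \<beta>) * norm x)" if "\<tau> \<ge> 0" "\<beta> \<in> B" for \<tau> \<beta> x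
  proof -
    interpret u: c0 J "U \<beta>" D "Lb \<beta>" by (rule U[OF that(2)])
    have "bounded_linear (U \<beta> \<tau> \<circ> Qb \<beta>)"
      unfolding o_def by (rule bounded_linear_compose[OF u.T_bl[OF that(1)] Qb_bounded_linear[OF that(2)]])
    from onorm[OF this, of x] have "norm (U \<beta> \<tau> (Qb \<beta> x)) \<le> onorm (U \<beta> \<tau> \<circ> Qb \<beta>) * norm x" by simp
    also have "\<dots> \<le> M1 * exp (\<omega> * \<tau>) * onorm (Qb \<beta>) * norm x" by (intro mult_right_mono dec that) auto
    finally show ?thesis by (simp add: mult.assoc)
  qed
  obtain c where c: "c > 0" "\<And>\<beta> x. \<beta> \<in> B \<Longrightarrow> norm (Qb \<beta> x) \<le> c * norm x"
    using decay_imp_projection_bound[OF dec' \<omega>] by metis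
  have oc: "onorm (Qb \<beta>) \<le> c" if "\<beta> \<in> B" for \<beta> using c that by (intro onorm_bound) auto
  define C where "C = M1 * c / (w0 - \<omega>)"
  have "\<exists>u. reduced_solution J D (Lb \<beta>) (Pb \<beta>) z x u \<and> norm u \<le> C * norm x" if z: "Re z \<ge> w0" and \<beta>: "\<beta> \<in> B" for z \<beta> x
  proof -
    obtain w2 where "spectral J D (Lb \<beta>) w0 w2" using spectral_gap[OF \<beta>] by blast
    then interpret sp: spectral J D "Lb \<beta>" w0 w2 .
    interpret u: c0 J "U \<beta>" D "Lb \<beta>" by (rule U[OF \<beta>])
    interpret r: c0 J "\<lambda>t x. exp (- (z * of_real t)) \<odot> U \<beta> t x" D "\<lambda>x. Lb \<beta> x - z \<odot> x" by (rule u.rescale)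
    interpret Pl: bounded_linear "Pb \<beta>" by (rule cboundedD(1)[OF Pb_facts(1)[OF \<beta>]])
    define y where "y = Qb \<beta> x"
    have dy: "norm (exp (- (z * of_real t)) \<odot> U \<beta> t y) \<le> (M1 * c * norm x) * exp (- (w0 - \<omega>) * t)" if t: "t \<ge> 0" for t
    proof -
      have "norm (exp (- (z * of_real t)) \<odot> U \<beta> t y) = exp (- (Re z * t)) * norm (U \<beta> t y)" by (simp add: norm_exp_eq_Re)
      also have "\<dots> \<le> exp (- (w0 * t)) * (M1 * exp (\<omega> * t) * (c * norm x))"
      proof (intro mult_mono)
        show "exp (- (Re z * t)) \<le> exp (- (w0 * t))" using z t by (simp add: mult_right_mono)
        have "norm (U \<beta> t y) \<le> M1 * exp (\<omega> * t) * (onorm (Qb \<beta>) * norm x)" unfolding y_def by (rule dec'[OF t \<beta>])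
        also have "\<dots> \<le> M1 * exp (\<omega> * t) * (c * norm x)"
          using M1 by (intro mult_left_mono mult_right_mono oc \<beta>) auto
        finally show "norm (U \<beta> t y) \<le> M1 * exp (\<omega> * t) * (c * norm x)" .
      qed auto
      also have "\<dots> = (M1 * c * norm x) * exp (- (w0 - \<omega>) * t)"
        by (simp add: exp_add[symmetric] algebra_simps)
      finally show ?thesis .
    qed
    have w0\<omega>: "w0 - \<omega> > 0" using \<omega> by simp
    have Py: "Pb \<beta> y = 0" unfolding y_def by (rule Pb_facts(2)[OF \<beta>])
    obtain u where u: "u \<in> D" "Lb \<beta> u - z \<odot> u = - y" "norm u \<le> (M1 * c * norm x) / (w0 - \<omega>)"
      "(\<lambda>n::nat. integral {0..real n} (\<lambda>t. exp (- (z * of_real t)) \<odot> U \<beta> t y)) \<longlonglongrightarrow> u"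
      using r.decay_solution[OF dy w0\<omega>] by blast
    \<comment> \<open>The truncated Laplace integrals lie in the kernel of the projection, hence so
      does their limit u; this is the range condition in \<open>reduced_solution\<close>.\<close>
    have "Pb \<beta> (integral {0..real n} (\<lambda>t. exp (- (z * of_real t)) \<odot> U \<beta> t y)) = 0" for n
    proof -
      have "Pb \<beta> (integral {0..real n} (\<lambda>t. exp (- (z * of_real t)) \<odot> U \<beta> t y)) = integral {0..real n} (\<lambda>t. Pb \<beta> (exp (- (z * of_real t)) \<odot> U \<beta> t y))"
        using integral_linear[OF r.T_int Pl.bounded_linear_axioms, of 0 "real n" y] by (simp add: o_def)
      also have "\<dots> = integral {0..real n} (\<lambda>t. 0)"
        by (intro integral_cong) (simp add: cboundedD(3)[OF Pb_facts(1)[OF \<beta>]] Pb_facts(3)[OF \<beta>] Py u.T_lin)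
      finally show ?thesis by simp
    qed
    then have "Pb \<beta> u = 0" using LIMSEQ_unique[OF Pl.tendsto[OF u(4)], of 0] by simp
    moreover have "z \<odot> u - Lb \<beta> u = x - Pb \<beta> x" using u(2) by (simp add: y_def algebra_simps)
    ultimately have "reduced_solution J D (Lb \<beta>) (Pb \<beta>) z x u" using u(1) by (simp add: sp.reduced_solution_iff)
    then show ?thesis using u(3) by (intro exI[of _ u]) (simp add: C_def)
  qed
  moreover have "C > 0" using M1 c \<omega> by (simp add: C_def)
  ultimately show ?thesis by blast
qed

text \<open>The bound is assumed for given reduced solutions, because the vectors on which it is
  tested are solutions by construction.\<close>

lemma reduced_solution_imp_decay:
  assumes C: "C > 0" and bd: "\<And>z \<beta> x u. Re z \<ge> w0 \<Longrightarrow> \<beta> \<in> B \<Longrightarrow> reduced_solution J D (Lb \<beta>) (Pb \<beta>) z x u \<Longrightarrow> norm u \<le> C * norm x"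
  shows "\<exists>\<omega><w0. \<exists>M\<ge>1. \<forall>\<tau>\<ge>0. \<forall>\<beta>\<in>B. onorm (U \<beta> \<tau> \<circ> Qb \<beta>) \<le> M * exp (\<omega> * \<tau>) * onorm (Qb \<beta>)"
proof -
  obtain m a where ma: "m \<ge> 1" "a \<ge> 0" "\<And>\<beta> t x. \<beta> \<in> B \<Longrightarrow> t \<ge> 0 \<Longrightarrow> norm (U \<beta> t x) \<le> m * exp (a * t) * norm x"
    using uniform_growth by blast
  \<comment> \<open>Multiplication by \<open>exp (- w0 * t)\<close> may raise the growth rate;
    adding the modulus of w0 covers this and keeps the rate nonnegative, as
    \<open>stable_part\<close> requires.\<close>
  define a' where "a' = a + \<bar>w0\<bar>"
  have a': "a' \<ge> 0" using ma by (simp add: a'_def)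
  have sp: "stable_part J (\<lambda>t x. exp (- (of_real w0 * of_real t)) \<odot> U \<beta> t x) D (\<lambda>x. Lb \<beta> x - of_real w0 \<odot> x) (Pb \<beta>) m a' C"
    if \<beta>: "\<beta> \<in> B" for \<beta>
  proof -
    obtain w2 where "spectral J D (Lb \<beta>) w0 w2" using spectral_gap[OF \<beta>] by blast
    then interpret s: spectral J D "Lb \<beta>" w0 w2 .
    interpret u: c0 J "U \<beta>" D "Lb \<beta>" by (rule U[OF \<beta>])
    note Pcm = cboundedD(3)[OF Pb_facts(1)[OF \<beta>]]
    show ?thesis
    proof (intro stable_part.intro stable_part_axioms.intro u.rescale cboundedD(1)[OF Pb_facts(1)[OF \<beta>]] Pcm ma a' C)
      show "Pb \<beta> (exp (- (of_real w0 * of_real t)) \<odot> U \<beta> t x) = exp (- (of_real w0 * of_real t)) \<odot> U \<beta> t (Pb \<beta> x)"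
        if "t \<ge> 0" for t x
        using Pb_facts(3)[OF \<beta> that] by (simp add: Pcm)
      show "norm (exp (- (of_real w0 * of_real t)) \<odot> U \<beta> t x) \<le> m * exp (a' * t) * norm x" if t: "t \<ge> 0" for t x
      proof -
        have "norm (exp (- (of_real w0 * of_real t)) \<odot> U \<beta> t x) = exp (- (w0 * t)) * norm (U \<beta> t x)"
          by (simp add: norm_exp_eq_Re)
        also have "\<dots> \<le> exp (\<bar>w0\<bar> * t) * (m * exp (a * t) * norm x)"
        proof (intro mult_mono ma \<beta> t)
          have "- (w0 * t) \<le> \<bar>w0\<bar> * t" using t mult_right_mono[of "- w0" "\<bar>w0\<bar>" t] by simp
          then show "exp (- (w0 * t)) \<le> exp (\<bar>w0\<bar> * t)" by simp
        qed auto
        also have "\<dots> = m * (exp (\<bar>w0\<bar> * t) * exp (a * t)) * norm x" by simp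
        also have "exp (\<bar>w0\<bar> * t) * exp (a * t) = exp (a' * t)" unfolding a'_def exp_add[symmetric] by (simp add: algebra_simps)
        finally show ?thesis .
      qed
      show "norm u \<le> C * norm (z \<odot> u - (Lb \<beta> u - of_real w0 \<odot> u))" if u: "u \<in> D" "Pb \<beta> u = 0" "Re z \<ge> 0" for u z
      proof -
        define \<zeta> where "\<zeta> = z + of_real w0"
        have \<zeta>: "Re \<zeta> \<ge> w0" using u(3) by (simp add: \<zeta>_def)
        have eq: "z \<odot> u - (Lb \<beta> u - of_real w0 \<odot> u) = \<zeta> \<odot> u - Lb \<beta> u" by (simp add: \<zeta>_def cm_add_left)
        \<comment> \<open>By \<open>P_A_zero\<close> the datum is again in the kernel, so
          subtracting its projection changes nothing and u is its own reduced solution.\<close>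
        have "Pb \<beta> (\<zeta> \<odot> u - Lb \<beta> u) = 0"
          using s.P_A_zero[OF u(1,2)] u(2) by (simp add: s.P_lin(1) Pcm)
        then have "reduced_solution J D (Lb \<beta>) (Pb \<beta>) \<zeta> (\<zeta> \<odot> u - Lb \<beta> u) u"
          using u by (simp add: s.reduced_solution_iff)
        then show ?thesis using bd[OF \<zeta> \<beta>] by (simp only: eq)
      qed
    qed
  qed
  define g where "g = stable_part.growth_const m a' C"
  define d where "d = stable_part.decay_rate m a' C"
  have main: "onorm (U \<beta> \<tau> \<circ> Qb \<beta>) \<le> 2 * sqrt g * exp ((w0 - d) * \<tau>) * onorm (Qb \<beta>) \<and> g \<ge> 1 \<and> d > 0"
    if \<beta>: "\<beta> \<in> B" and \<tau>: "\<tau> \<ge> 0" for \<beta> \<tau>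
  proof -
    interpret st: stable_part J "\<lambda>t x. exp (- (of_real w0 * of_real t)) \<odot> U \<beta> t x" D "\<lambda>x. Lb \<beta> x - of_real w0 \<odot> x" "Pb \<beta>" m a' C
      by (rule sp[OF \<beta>])
    have gd: "g \<ge> 1" "d > 0" using st.growth_const_ge_1 st.decay_rate_pos by (auto simp: g_def d_def)
    have "norm ((U \<beta> \<tau> \<circ> Qb \<beta>) x) \<le> 2 * sqrt g * exp ((w0 - d) * \<tau>) * onorm (Qb \<beta>) * norm x" for x
    proof -
      have "exp (- (w0 * \<tau>)) * norm (U \<beta> \<tau> (Qb \<beta> x)) \<le> 2 * sqrt g * exp (- (d * \<tau>)) * norm (Qb \<beta> x)"
        using st.uniform_exponential_decay[OF Pb_facts(2)[OF \<beta>, of x] \<tau>] by (simp add: norm_exp_eq_Re g_def d_def)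
      then have "exp (w0 * \<tau>) * (exp (- (w0 * \<tau>)) * norm (U \<beta> \<tau> (Qb \<beta> x))) \<le> exp (w0 * \<tau>) * (2 * sqrt g * exp (- (d * \<tau>)) * norm (Qb \<beta> x))"
        by (intro mult_left_mono) auto
      then have "norm (U \<beta> \<tau> (Qb \<beta> x)) \<le> 2 * sqrt g * exp ((w0 - d) * \<tau>) * norm (Qb \<beta> x)"
        by (simp add: mult.assoc[symmetric] exp_add[symmetric] left_diff_distrib) (simp add: exp_diff exp_minus field_simps)
      also have "\<dots> \<le> 2 * sqrt g * exp ((w0 - d) * \<tau>) * (onorm (Qb \<beta>) * norm x)"
        using gd by (intro mult_left_mono onorm Qb_bounded_linear \<beta>) auto
      finally show ?thesis by (simp add: mult.assoc)
    qed
    then have "onorm (U \<beta> \<tau> \<circ> Qb \<beta>) \<le> 2 * sqrt g * exp ((w0 - d) * \<tau>) * onorm (Qb \<beta>)"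
      using gd onorm_pos_le[OF Qb_bounded_linear[OF \<beta>]] by (intro onorm_bound) auto
    then show ?thesis using gd by blast
  qed
  show ?thesis
  proof (cases "B = {}")
    case True
    then show ?thesis by (intro exI[of _ "w0 - 1"] conjI exI[of _ 1]) auto
  next
    case False
    then obtain \<beta> where "\<beta> \<in> B" by blast
    then have gd: "g \<ge> 1" "d > 0" using main[of \<beta> 0] by auto
    then have "sqrt g \<ge> 1" by simp
    then have "2 * sqrt g \<ge> 1" by linarith
    then show ?thesis using main gd by (intro exI[of _ "w0 - d"] conjI exI[of _ "2 * sqrt g"]) auto
  qed
qed

end


section \<open>Transport to a copy of the Hilbert space\<close>

text \<open>A type variable of sort \<open>{real_inner, complete_space}\<close> is not recognised as an instance of
  \<open>banach\<close>, which the integration library requires; a copy of the type can be made an instance.\<close>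

typedef 'a hilbert_copy = "UNIV :: 'a set" morphisms un mk ..

lemmas un_mk [simp] = mk_inverse[OF UNIV_I] and mk_un [simp] = un_inverse
  and mk_eq_iff [simp] = mk_inject[OF UNIV_I UNIV_I]

instantiation hilbert_copy :: (real_inner) real_inner
begin

definition "0 = mk 0"
definition "x + y = mk (un x + un y)"
definition "x - y = mk (un x - un y)"
definition "- x = mk (- un x)"
definition "r *\<^sub>R x = mk (r *\<^sub>R un x)"
definition "norm x = norm (un x)"
definition "sgn x = mk (sgn (un x))"
definition "dist x y = dist (un x) (un y)"
definition "inner x y = inner (un x) (un y)"
definition "(uniformity :: ('a hilbert_copy \<times> 'a hilbert_copy) filter) = (INF e\<in>{0<..}. principal {(x, y). dist x y < e})"
definition "open (U :: 'a hilbert_copy set) \<longleftrightarrow> (\<forall>x\<in>U. \<forall>\<^sub>F (x', y) in uniformity. x' = x \<longrightarrow> y \<in> U)"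

instance
proof
  fix x y z :: "'a hilbert_copy" and r s :: real and U :: "'a hilbert_copy set"
  show "x + y + z = x + (y + z)" "x + y = y + x" "0 + x = x" "- x + x = 0" "x - y = x + - y"
    by (simp_all add: plus_hilbert_copy_def zero_hilbert_copy_def minus_hilbert_copy_def uminus_hilbert_copy_def add_ac)
  show "r *\<^sub>R (x + y) = r *\<^sub>R x + r *\<^sub>R y" "(r + s) *\<^sub>R x = r *\<^sub>R x + s *\<^sub>R x" "r *\<^sub>R s *\<^sub>R x = (r * s) *\<^sub>R x" "1 *\<^sub>R x = x"
    by (simp_all add: plus_hilbert_copy_def scaleR_hilbert_copy_def scaleR_add_right scaleR_add_left)
  show "dist x y = norm (x - y)" by (simp add: dist_hilbert_copy_def norm_hilbert_copy_def minus_hilbert_copy_def dist_norm)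
  show "sgn x = inverse (norm x) *\<^sub>R x" by (simp add: sgn_hilbert_copy_def norm_hilbert_copy_def scaleR_hilbert_copy_def sgn_div_norm)
  show "uniformity = (INF e\<in>{0<..}. principal {(x, y). dist (x :: 'a hilbert_copy) y < e})" by (rule uniformity_hilbert_copy_def)
  show "open U = (\<forall>x\<in>U. \<forall>\<^sub>F (x', y) in uniformity. x' = x \<longrightarrow> y \<in> U)" by (rule open_hilbert_copy_def)
  show "inner x y = inner y x" "0 \<le> inner x x" by (simp_all add: inner_hilbert_copy_def inner_commute)
  show "inner (x + y) z = inner x z + inner y z" "inner (r *\<^sub>R x) y = r * inner x y"
    by (simp_all add: inner_hilbert_copy_def plus_hilbert_copy_def scaleR_hilbert_copy_def inner_add_left)
  show "inner x x = 0 \<longleftrightarrow> x = 0" by (simp add: inner_hilbert_copy_def zero_hilbert_copy_def) (metis mk_un un_mk)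
  show "norm x = sqrt (inner x x)" by (simp add: norm_hilbert_copy_def inner_hilbert_copy_def norm_eq_sqrt_inner)
qed

end

lemma un_simps [simp]: "un (x + y) = un x + un y" "un (x - y) = un x - un y" "un (- x) = - un x" "un 0 = 0"
    "un (r *\<^sub>R x) = r *\<^sub>R un x" "norm (un x) = norm x" "inner (un x) (un y) = inner x y"
  and mk_simps: "mk (a + b) = mk a + mk b" "mk (a - b) = mk a - mk b" "mk (- a) = - mk a" "mk 0 = 0"
    "mk (r *\<^sub>R a) = r *\<^sub>R mk a" and norm_mk [simp]: "norm (mk a) = norm a" and inner_mk [simp]: "inner (mk a) (mk b) = inner a b"
  by (simp_all add: plus_hilbert_copy_def zero_hilbert_copy_def minus_hilbert_copy_def uminus_hilbert_copy_def
      scaleR_hilbert_copy_def norm_hilbert_copy_def inner_hilbert_copy_def)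

lemma un_bounded_linear: "bounded_linear un"
  by (rule bounded_linear_intro[where K = 1]) simp_all

lemma mk_bounded_linear: "bounded_linear mk"
  by (rule bounded_linear_intro[where K = 1]) (simp_all add: mk_simps)

instance hilbert_copy :: ("{real_inner, complete_space}") complete_space
proof
  fix X :: "nat \<Rightarrow> 'a hilbert_copy" assume "Cauchy X"
  then have "Cauchy (\<lambda>n. un (X n))" by (rule bounded_linear.Cauchy[OF un_bounded_linear])
  then obtain l where "(\<lambda>n. un (X n)) \<longlonglongrightarrow> l" using Cauchy_convergent_iff convergent_def by blast
  from bounded_linear.tendsto[OF mk_bounded_linear this] show "convergent X" by (auto simp: convergent_def)
qed

instance hilbert_copy :: ("{real_inner, complete_space}") banach ..

lemma un_image_mk [simp]: "un x \<in> A \<longleftrightarrow> x \<in> mk ` A"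
  by (metis image_eqI image_iff mk_un un_mk)

lemma mk_in_image [simp]: "mk a \<in> mk ` A \<longleftrightarrow> a \<in> A"
  using un_image_mk[of "mk a" A] by simp

definition lift :: "('a \<Rightarrow> 'a) \<Rightarrow> 'a hilbert_copy \<Rightarrow> 'a hilbert_copy" where "lift f x = mk (f (un x))"

lemma lift_mk [simp]: "lift f (mk a) = mk (f a)" and un_lift [simp]: "un (lift f x) = f (un x)"
  by (simp_all add: lift_def)

lemma lift_bounded_linear: "bounded_linear f \<Longrightarrow> bounded_linear (lift f)"
  unfolding lift_def[abs_def]
  by (intro bounded_linear_compose[OF mk_bounded_linear] bounded_linear_compose[OF _ un_bounded_linear])

lemma tendsto_mk_iff: "((\<lambda>x. mk (f x)) \<longlongrightarrow> mk l) F \<longleftrightarrow> (f \<longlongrightarrow> l) F"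
  using bounded_linear.tendsto[OF mk_bounded_linear, of f l F] bounded_linear.tendsto[OF un_bounded_linear, of "\<lambda>x. mk (f x)" "mk l" F]
  by auto

lemma cmul_lift: "cmul (lift J) z (mk x) = mk (cmul J z x)"
  by (simp add: cmul_def mk_simps)

lemma complex_structure_lift:
  assumes "complex_structure J" shows "complex_structure (lift J)"
proof -
  have l: "linear J" and jj: "\<And>x. J (J x) = - x" and i: "\<And>x y. inner (J x) (J y) = inner x y"
    using assms by (auto simp: complex_structure_def)
  interpret linear J by (rule l)
  have "linear (lift J)" by (rule linearI) (simp_all add: lift_def add scale mk_simps)
  then show ?thesis by (simp add: complex_structure_def lift_def jj i mk_simps)
qed

lemma cbounded_lift: "cbounded J f \<Longrightarrow> cbounded (lift J) (lift f)"
  by (auto simp: cbounded_def lift_bounded_linear) (simp add: lift_def)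

lemma C0_semigroup_lift:
  assumes "C0_semigroup J S" shows "C0_semigroup (lift J) (\<lambda>t. lift (S t))"
  unfolding C0_semigroup_def
proof (intro conjI allI impI)
  note S = assms[unfolded C0_semigroup_def]
  show "cbounded (lift J) (lift (S t))" if "t \<ge> 0" for t using S that by (auto intro: cbounded_lift)
  show "lift (S 0) = id" using S by (auto simp: lift_def)
  show "lift (S (t + s)) = lift (S t) \<circ> lift (S s)" if "t \<ge> 0" "s \<ge> 0" for t s using S that by (auto simp: lift_def)
  show "((\<lambda>t. lift (S t) x) \<longlongrightarrow> x) (at_right 0)" for x
    using S tendsto_mk_iff[of "\<lambda>t. S t (un x)" "un x"] by (simp add: lift_def)
qed

lemma generator_lift:
  assumes "generator S D L" shows "generator (\<lambda>t. lift (S t)) (mk ` D) (lift L)"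
proof -
  have D: "D = {x. \<exists>y. ((\<lambda>t. (1 / t) *\<^sub>R (S t x - x)) \<longlongrightarrow> y) (at_right 0)}"
    and L: "\<And>x. x \<in> D \<Longrightarrow> ((\<lambda>t. (1 / t) *\<^sub>R (S t x - x)) \<longlongrightarrow> L x) (at_right 0)"
    using assms by (auto simp: generator_def)
  have iff: "((\<lambda>t. (1 / t) *\<^sub>R (lift (S t) x - x)) \<longlongrightarrow> y) (at_right 0) \<longleftrightarrow> ((\<lambda>t. (1 / t) *\<^sub>R (S t (un x) - un x)) \<longlongrightarrow> un y) (at_right 0)" for x y
    using tendsto_mk_iff[of "\<lambda>t. (1 / t) *\<^sub>R (S t (un x) - un x)" "un y"] by (simp add: lift_def mk_simps)
  have "x \<in> mk ` D \<longleftrightarrow> (\<exists>y. ((\<lambda>t. (1 / t) *\<^sub>R (lift (S t) x - x)) \<longlongrightarrow> y) (at_right 0))" for x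
  proof -
    have "x \<in> mk ` D \<longleftrightarrow> (\<exists>y. ((\<lambda>t. (1 / t) *\<^sub>R (S t (un x) - un x)) \<longlongrightarrow> y) (at_right 0))"
      unfolding un_image_mk[symmetric] by (subst D) simp
    also have "\<dots> \<longleftrightarrow> (\<exists>y. ((\<lambda>t. (1 / t) *\<^sub>R (S t (un x) - un x)) \<longlongrightarrow> un y) (at_right 0))" by (metis un_mk)
    finally show ?thesis by (simp only: iff)
  qed
  moreover have "((\<lambda>t. (1 / t) *\<^sub>R (lift (S t) x - x)) \<longlongrightarrow> lift L x) (at_right 0)" if "x \<in> mk ` D" for x
    unfolding iff un_lift by (rule L) (use that in simp)
  ultimately show ?thesis unfolding generator_def by blast
qed

lemma compact_operator_lift:
  fixes K :: "'a::real_inner \<Rightarrow> 'a"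
  assumes "compact_operator K" shows "compact_operator (lift K)"
proof -
  let ?X = "closure (K ` ball 0 1)"
  have X: "compact (mk ` ?X)"
    using assms by (intro compact_continuous_image linear_continuous_on mk_bounded_linear) (simp add: compact_operator_def)
  have "lift K ` ball 0 1 \<subseteq> mk ` ?X"
  proof
    fix y assume "y \<in> lift K ` ball 0 1"
    then obtain x where "norm x < 1" "y = mk (K (un x))" by (auto simp: lift_def)
    then have "un y \<in> K ` ball 0 1" by simp
    then have "un y \<in> ?X" by (rule subsetD[OF closure_subset])
    then show "y \<in> mk ` ?X" by simp
  qed
  then have "closure (lift K ` ball 0 1) \<subseteq> mk ` ?X" using compact_imp_closed[OF X] by (rule closure_minimal)
  then have "closure (lift K ` ball 0 1) = mk ` ?X \<inter> closure (lift K ` ball 0 1)" by blast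
  then show ?thesis unfolding compact_operator_def using compact_Int_closed[OF X closed_closure] by metis
qed

lemma Blinfun_lift_continuous:
  fixes K :: "'b::topological_space \<Rightarrow> 'a::real_inner \<Rightarrow> 'a"
  assumes "continuous_on B (\<lambda>\<beta>. Blinfun (K \<beta>))" "\<And>\<beta>. \<beta> \<in> B \<Longrightarrow> bounded_linear (K \<beta>)"
  shows "continuous_on B (\<lambda>\<beta>. Blinfun (lift (K \<beta>)))"
proof -
  have "continuous_on B (\<lambda>\<beta>. Blinfun mk o\<^sub>L (Blinfun (K \<beta>) o\<^sub>L Blinfun un))"
    by (intro continuous_intros assms(1))
  moreover have "Blinfun mk o\<^sub>L (Blinfun (K \<beta>) o\<^sub>L Blinfun un) = Blinfun (lift (K \<beta>))" if "\<beta> \<in> B" for \<beta>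
    by (rule blinfun_eqI)
       (simp add: bounded_linear_Blinfun_apply mk_bounded_linear un_bounded_linear assms(2)[OF that] lift_bounded_linear lift_def)
  ultimately show ?thesis by (simp cong: continuous_on_cong)
qed

lemma resolvent_set_lift:
  fixes J :: "'a::real_inner \<Rightarrow> 'a"
  shows "resolvent_set (lift J) (mk ` D) (lift A) = resolvent_set J D A"
    and "z \<in> resolvent_set J D A \<Longrightarrow> resolvent (lift J) (mk ` D) (lift A) z x = mk (resolvent J D A z (un x))"
proof -
  let ?f = "\<lambda>z x. cmul J z x - A x" and ?g = "\<lambda>z x. cmul (lift J) z x - lift A x"
  have g: "?g z (mk x) = mk (?f z x)" for z x by (simp add: cmul_lift mk_simps)
  have inj: "inj_on (?g z) (mk ` D) \<longleftrightarrow> inj_on (?f z) D" for z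
    by (simp only: inj_on_def ball_simps g mk_eq_iff)
  have im: "?g z ` mk ` D = mk ` ?f z ` D" for z unfolding image_image g ..
  have bij: "bij_betw (?g z) (mk ` D) UNIV \<longleftrightarrow> bij_betw (?f z) D UNIV" for z
  proof -
    have "mk ` ?f z ` D = UNIV \<longleftrightarrow> ?f z ` D = UNIV"
      by (metis UNIV_I UNIV_eq_I mk_in_image un_image_mk)
    then show ?thesis by (simp only: bij_betw_def inj im)
  qed
  have inv: "the_inv_into (mk ` D) (?g z) x = mk (the_inv_into D (?f z) (un x))" if "bij_betw (?f z) D UNIV" for z x
  proof -
    have i: "inj_on (?f z) D" "un x \<in> ?f z ` D" using that by (auto simp: bij_betw_def)
    have "?g z (mk (the_inv_into D (?f z) (un x))) = x" using f_the_inv_into_f[OF i] by (simp only: g) simp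
    moreover have "mk (the_inv_into D (?f z) (un x)) \<in> mk ` D" using the_inv_into_into[OF i] by simp
    ultimately show ?thesis using the_inv_into_f_eq[of "?g z" "mk ` D"] i(1) inj by blast
  qed
  have bl: "bounded_linear (the_inv_into (mk ` D) (?g z)) \<longleftrightarrow> bounded_linear (the_inv_into D (?f z))" if b: "bij_betw (?f z) D UNIV" for z
  proof
    assume "bounded_linear (the_inv_into D (?f z))"
    moreover have "the_inv_into (mk ` D) (?g z) = lift (the_inv_into D (?f z))"
    proof
      fix x
      show "the_inv_into (mk ` D) (?g z) x = lift (the_inv_into D (?f z)) x" unfolding inv[OF b] unfolding lift_def ..
    qed
    ultimately show "bounded_linear (the_inv_into (mk ` D) (?g z))" by (simp only: lift_bounded_linear)
  next
    assume h: "bounded_linear (the_inv_into (mk ` D) (?g z))"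
    have "bounded_linear (\<lambda>x. un (the_inv_into (mk ` D) (?g z) (mk x)))"
      by (intro bounded_linear_compose[OF un_bounded_linear] bounded_linear_compose[OF h mk_bounded_linear])
    then show "bounded_linear (the_inv_into D (?f z))" by (simp add: inv[OF b])
  qed
  show "resolvent_set (lift J) (mk ` D) (lift A) = resolvent_set J D A"
    unfolding resolvent_set_def using bij bl by blast
  show "z \<in> resolvent_set J D A \<Longrightarrow> resolvent (lift J) (mk ` D) (lift A) z x = mk (resolvent J D A z (un x))"
    unfolding resolvent_def resolvent_set_def using inv by blast
qed

lemma integral_mk:
  fixes f :: "real \<Rightarrow> 'a::real_inner"
  shows "integral S (\<lambda>t. mk (f t)) = mk (integral S f)"
proof (cases "f integrable_on S")
  case True
  then show ?thesis using integral_linear[OF True mk_bounded_linear] by (simp add: o_def)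
next
  \<comment> \<open>Both integrals take the default value 0, which \<open>mk\<close>
    preserves.\<close>
  case False
  then have "\<not> (\<lambda>t. mk (f t)) integrable_on S"
    using integrable_linear[OF _ un_bounded_linear, of "\<lambda>t. mk (f t)" S] by (auto simp: o_def)
  then show ?thesis using False by (simp add: not_integrable_integral mk_simps)
qed

lemma riesz_proj_lift:
  fixes J :: "'a::real_inner \<Rightarrow> 'a"
  assumes "sphere l r \<subseteq> resolvent_set J D A" "r > 0"
  shows "riesz_proj (lift J) (mk ` D) (lift A) l r = lift (riesz_proj J D A l r)"
proof
  fix x
  have "circlepath l r t \<in> resolvent_set J D A" for t
    using assms(1) circle_in_sphere[of r l t] assms(2) by (auto simp: circlepath[THEN fun_cong])
  then show "riesz_proj (lift J) (mk ` D) (lift A) l r x = lift (riesz_proj J D A l r) x"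
    by (simp add: riesz_proj_def lift_def resolvent_set_lift(2) cmul_lift integral_mk)
qed

text \<open>The radius is chosen by the same predicate on both sides, hence equal. The spectral
  hypothesis puts the circles into the resolvent set, where the lifted resolvent is known.\<close>

lemma total_proj_lift:
  fixes J :: "'a::{real_inner, complete_space} \<Rightarrow> 'a"
  assumes "spectral (lift J) (mk ` D) (lift A) w0 w2"
  shows "total_proj (lift J) (mk ` D) (lift A) w0 = lift (total_proj J D A w0)"
proof
  fix x
  interpret s: spectral "lift J" "mk ` D" "lift A" w0 w2 by (rule assms)
  have S: "Sigma_set (lift J) (mk ` D) (lift A) w0 = Sigma_set J D A w0"
    by (simp add: Sigma_set_def spectrum_op_def resolvent_set_lift)
  have r: "riesz_radius (lift J) (mk ` D) (lift A) w0 = riesz_radius J D A w0"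
    unfolding riesz_radius_def S resolvent_set_lift ..
  have "riesz_proj (lift J) (mk ` D) (lift A) l (riesz_radius J D A w0) = lift (riesz_proj J D A l (riesz_radius J D A w0))"
    if "l \<in> Sigma_set J D A w0" for l
    using riesz_proj_lift[of l "riesz_radius J D A w0" J D A] s.r0_sphere[of l] s.r0(1) that
    by (simp add: S r resolvent_set_lift)
  moreover have "(\<Sum>l\<in>I. mk (f l)) = mk (\<Sum>l\<in>I. f l)" for f :: "complex \<Rightarrow> 'a" and I
    using linear_sum[OF bounded_linear.linear[OF mk_bounded_linear], of f I] by simp
  ultimately show "total_proj (lift J) (mk ` D) (lift A) w0 x = lift (total_proj J D A w0) x"
    by (simp add: total_proj_def S r lift_def)
qed

lemma onorm_lift:
  fixes f :: "'a::real_inner \<Rightarrow> 'a"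
  shows "onorm (lift f) = onorm f"
proof -
  have "range (\<lambda>x. norm (lift f x) / norm x) = range (\<lambda>x. norm (f x) / norm x)"
  proof -
    have "range (\<lambda>x. norm (lift f x) / norm x) = (\<lambda>x. norm (f x) / norm x) ` range un"
      unfolding image_image by (simp add: lift_def)
    moreover have "range (un :: 'a hilbert_copy \<Rightarrow> 'a) = UNIV" by (metis surjI un_mk)
    ultimately show ?thesis by simp
  qed
  then show ?thesis by (simp add: onorm_def)
qed

lemma lift_id_minus: "(\<lambda>x. x - lift P x) = lift (\<lambda>x. x - P x)"
  by (auto simp: lift_def mk_simps)

lemma reduced_solution_lift:
  "reduced_solution (lift J) (mk ` D) (lift A) (lift P) z (mk x) (mk u) \<longleftrightarrow> reduced_solution J D A P z x u"
proof -
  have "mk u \<in> range (\<lambda>v. v - lift P v) \<longleftrightarrow> u \<in> range (\<lambda>v. v - P v)"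
    unfolding lift_id_minus by (auto simp: image_iff lift_def) (metis un_mk)+
  moreover have "cmul (lift J) z (mk u) - lift A (mk u) = mk x - lift P (mk x) \<longleftrightarrow> cmul J z u - A u = x - P x"
    by (simp add: cmul_lift flip: mk_simps)
  ultimately show ?thesis by (simp add: reduced_solution_def)
qed

theorem mainTheorem19:
  fixes J :: "'a::{real_inner, complete_space} \<Rightarrow> 'a"
    and S :: "real \<Rightarrow> 'a \<Rightarrow> 'a" and D :: "'a set" and L :: "'a \<Rightarrow> 'a"
    and B :: "(real ^ 'n) set" and L' :: "real ^ 'n \<Rightarrow> 'a \<Rightarrow> 'a"
    and Sb :: "real ^ 'n \<Rightarrow> real \<Rightarrow> 'a \<Rightarrow> 'a" and \<omega>0 :: real
  assumes "complex_structure J" and "infinite_dim_C J"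
    and "C0_semigroup J S" and "generator S D L"
    and "B \<noteq> {}" and "compact B"
    and "\<forall>\<beta>\<in>B. cbounded J (L' \<beta>) \<and> compact_operator (L' \<beta>)"
    and "continuous_on B (\<lambda>\<beta>. Blinfun (L' \<beta>))"
    and "\<forall>\<beta>\<in>B. C0_semigroup J (Sb \<beta>) \<and> generator (Sb \<beta>) D (\<lambda>x. L x + L' \<beta> x)"
    and "growth_bound S < ereal \<omega>0"
  shows "(\<exists>\<omega><\<omega>0. \<exists>M\<ge>1. \<forall>\<tau>\<ge>0. \<forall>\<beta>\<in>B.
            onorm (Sb \<beta> \<tau> \<circ> (\<lambda>x. x - total_proj J D (\<lambda>x. L x + L' \<beta> x) \<omega>0 x))
              \<le> M * exp (\<omega> * \<tau>) * onorm (\<lambda>x. x - total_proj J D (\<lambda>x. L x + L' \<beta> x) \<omega>0 x))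
         \<longleftrightarrow>
         (\<exists>C>0. \<forall>z \<beta> x. Re z \<ge> \<omega>0 \<longrightarrow> \<beta> \<in> B \<longrightarrow>
            norm (reduced_resolvent J D (\<lambda>x. L x + L' \<beta> x)
                    (total_proj J D (\<lambda>x. L x + L' \<beta> x) \<omega>0) z x) \<le> C * norm x)"
proof -
  \<comment> \<open>The growth bound is an infimum below \<omega>0, so some admissible rate lies
    strictly below \<omega>0.\<close>
  obtain w M where w: "w < \<omega>0" and M: "M \<ge> 1" and wM: "\<And>t. t \<ge> 0 \<Longrightarrow> onorm (S t) \<le> M * exp (w * t)"
    using assms(10) unfolding growth_bound_def Inf_less_iff by auto
  have S_bl: "bounded_linear (S t)" if "t \<ge> 0" for t
    using assms(3) that by (auto simp: C0_semigroup_def cbounded_def)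
  have sum: "(\<lambda>x. lift L x + lift (L' \<beta>) x) = lift (\<lambda>x. L x + L' \<beta> x)" for \<beta>
    by (auto simp: lift_def mk_simps)
  interpret F: pert_family "lift J" "\<lambda>t. lift (S t)" "mk ` D" "lift L" B "\<lambda>\<beta>. lift (L' \<beta>)" "\<lambda>\<beta> t. lift (Sb \<beta> t)" M w \<omega>0
  proof (intro pert_family.intro pert_family_axioms.intro c0.intro c0_axioms.intro cstruct.intro)
    show "complex_structure (lift J)" "complex_structure (lift J)" using assms(1) by (auto intro: complex_structure_lift)
    show "C0_semigroup (lift J) (\<lambda>t. lift (S t))" by (rule C0_semigroup_lift[OF assms(3)])
    show "generator (\<lambda>t. lift (S t)) (mk ` D) (lift L)" by (rule generator_lift[OF assms(4)])
    show "norm (lift (S t) x) \<le> M * exp (w * t) * norm x" if t: "t \<ge> 0" for t x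
    proof -
      have "norm (S t (un x)) \<le> onorm (S t) * norm (un x)" by (rule onorm[OF S_bl[OF t]])
      also have "\<dots> \<le> M * exp (w * t) * norm (un x)" by (intro mult_right_mono wM t) auto
      finally show ?thesis by (simp add: lift_def)
    qed
    show "continuous_on B (\<lambda>\<beta>. Blinfun (lift (L' \<beta>)))"
      by (rule Blinfun_lift_continuous[OF assms(8)]) (use assms(7) in \<open>auto simp: cbounded_def\<close>)
    show "C0_semigroup (lift J) (\<lambda>t. lift (Sb \<beta> t))" if "\<beta> \<in> B" for \<beta> using assms(9) that by (auto intro: C0_semigroup_lift)
    show "generator (\<lambda>t. lift (Sb \<beta> t)) (mk ` D) (\<lambda>x. lift L x + lift (L' \<beta>) x)" if "\<beta> \<in> B" for \<beta>
      unfolding sum using assms(9) that by (auto intro: generator_lift)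
  qed (use assms(6,7) M w in \<open>auto intro: cbounded_lift compact_operator_lift\<close>)
  define A where "A \<beta> = (\<lambda>x. L x + L' \<beta> x)" for \<beta>
  define P where "P \<beta> = total_proj J D (A \<beta>) \<omega>0" for \<beta>
  have FP: "total_proj (lift J) (mk ` D) (lift (A \<beta>)) \<omega>0 = lift (P \<beta>)" if \<beta>: "\<beta> \<in> B" for \<beta>
  proof -
    obtain w2 where "spectral (lift J) (mk ` D) (lift (A \<beta>)) \<omega>0 w2"
      using F.spectral_gap[OF \<beta>] unfolding sum A_def by blast
    then show ?thesis unfolding P_def by (rule total_proj_lift)
  qed
  have decay_iff: "onorm (lift (Sb \<beta> \<tau>) \<circ> F.Qb \<beta>) = onorm (Sb \<beta> \<tau> \<circ> (\<lambda>x. x - P \<beta> x))" "onorm (F.Qb \<beta>) = onorm (\<lambda>x. x - P \<beta> x)"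
    if \<beta>: "\<beta> \<in> B" for \<beta> \<tau>
  proof -
    have Q: "F.Qb \<beta> = lift (\<lambda>x. x - P \<beta> x)"
      unfolding sum A_def[symmetric] FP[OF \<beta>] by (rule lift_id_minus)
    have "lift (Sb \<beta> \<tau>) \<circ> lift (\<lambda>x. x - P \<beta> x) = lift (Sb \<beta> \<tau> \<circ> (\<lambda>x. x - P \<beta> x))" by (auto simp: lift_def)
    then show "onorm (lift (Sb \<beta> \<tau>) \<circ> F.Qb \<beta>) = onorm (Sb \<beta> \<tau> \<circ> (\<lambda>x. x - P \<beta> x))" "onorm (F.Qb \<beta>) = onorm (\<lambda>x. x - P \<beta> x)"
      unfolding Q by (simp_all only: onorm_lift)
  qed
  have sol_iff: "reduced_solution (lift J) (mk ` D) (F.Lb \<beta>) (F.Pb \<beta>) z (mk x) (mk u) \<longleftrightarrow> reduced_solution J D (A \<beta>) (P \<beta>) z x u"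
    if \<beta>: "\<beta> \<in> B" for \<beta> z x u
    unfolding sum A_def[symmetric] FP[OF \<beta>] by (rule reduced_solution_lift)
  \<comment> \<open>Uniqueness holds throughout the closed half-plane, but existence has to be
    supplied: one direction produces the solution as a Laplace transform, the other receives it with
    the estimate to be proved.\<close>
  have red: "reduced_resolvent J D (A \<beta>) (P \<beta>) z x = u"
    if \<beta>: "\<beta> \<in> B" and z: "Re z \<ge> \<omega>0" and u: "reduced_solution J D (A \<beta>) (P \<beta>) z x u" for \<beta> z x u
  proof -
    have uniq: "v = u" if "reduced_solution J D (A \<beta>) (P \<beta>) z x v" for v
    proof -
      have "mk v = mk u"
        using F.reduced_solution_unique_family[OF \<beta> z, of "mk x" "mk u" "mk v"] u that sol_iff[OF \<beta>] by blast
      then show ?thesis by (metis un_mk)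
    qed
    show ?thesis unfolding reduced_resolvent_def reduced_solution_def[symmetric] using u uniq by (rule the_equality)
  qed
  have "(\<exists>\<omega><\<omega>0. \<exists>M\<ge>1. \<forall>\<tau>\<ge>0. \<forall>\<beta>\<in>B. onorm (Sb \<beta> \<tau> \<circ> (\<lambda>x. x - P \<beta> x)) \<le> M * exp (\<omega> * \<tau>) * onorm (\<lambda>x. x - P \<beta> x))
     \<longleftrightarrow> (\<exists>C>0. \<forall>z \<beta> x. Re z \<ge> \<omega>0 \<longrightarrow> \<beta> \<in> B \<longrightarrow> norm (reduced_resolvent J D (A \<beta>) (P \<beta>) z x) \<le> C * norm x)" (is "?decay \<longleftrightarrow> ?bounded")
  proof
    assume ?decay
    then obtain \<omega> M1 where \<omega>: "\<omega> < \<omega>0" "M1 \<ge> 1"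
      "\<And>\<tau> \<beta>. \<tau> \<ge> 0 \<Longrightarrow> \<beta> \<in> B \<Longrightarrow> onorm (Sb \<beta> \<tau> \<circ> (\<lambda>x. x - P \<beta> x)) \<le> M1 * exp (\<omega> * \<tau>) * onorm (\<lambda>x. x - P \<beta> x)" by blast
    have "onorm (lift (Sb \<beta> \<tau>) \<circ> F.Qb \<beta>) \<le> M1 * exp (\<omega> * \<tau>) * onorm (F.Qb \<beta>)" if "\<tau> \<ge> 0" "\<beta> \<in> B" for \<tau> \<beta>
      using \<omega>(3)[OF that] unfolding decay_iff[OF that(2)] .
    then have "\<exists>C>0. \<forall>z \<beta> x. Re z \<ge> \<omega>0 \<longrightarrow> \<beta> \<in> B \<longrightarrow>
        (\<exists>u. reduced_solution (lift J) (mk ` D) (F.Lb \<beta>) (F.Pb \<beta>) z x u \<and> norm u \<le> C * norm x)"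
      by (rule F.decay_imp_reduced_solution[OF \<omega>(1,2)])
    then obtain C where C: "C > 0"
      "\<forall>z \<beta> x. Re z \<ge> \<omega>0 \<longrightarrow> \<beta> \<in> B \<longrightarrow> (\<exists>u. reduced_solution (lift J) (mk ` D) (F.Lb \<beta>) (F.Pb \<beta>) z x u \<and> norm u \<le> C * norm x)"
      by (elim exE conjE)
    have "norm (reduced_resolvent J D (A \<beta>) (P \<beta>) z x) \<le> C * norm x" if z: "Re z \<ge> \<omega>0" and \<beta>: "\<beta> \<in> B" for z \<beta> x
    proof -
      obtain u where u: "reduced_solution (lift J) (mk ` D) (F.Lb \<beta>) (F.Pb \<beta>) z (mk x) u" "norm u \<le> C * norm x"
        using C(2)[rule_format, OF z \<beta>, of "mk x"] by auto
      then have "reduced_solution J D (A \<beta>) (P \<beta>) z x (un u)" using sol_iff[OF \<beta>, of z x "un u"] by simp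
      from red[OF \<beta> z this] u(2) show ?thesis by simp
    qed
    then show ?bounded using C(1) by blast
  next
    assume ?bounded
    then obtain C where C: "C > 0"
      "\<And>z \<beta> x. Re z \<ge> \<omega>0 \<Longrightarrow> \<beta> \<in> B \<Longrightarrow> norm (reduced_resolvent J D (A \<beta>) (P \<beta>) z x) \<le> C * norm x" by blast
    have "norm u \<le> C * norm x" if "Re z \<ge> \<omega>0" "\<beta> \<in> B" "reduced_solution (lift J) (mk ` D) (F.Lb \<beta>) (F.Pb \<beta>) z x u" for z \<beta> x u
    proof -
      have "reduced_solution J D (A \<beta>) (P \<beta>) z (un x) (un u)" using sol_iff[OF that(2), of z "un x" "un u"] that(3) by simp
      from red[OF that(2,1) this] C(2)[OF that(1,2), of "un x"] show ?thesis by simp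
    qed
    then have "\<exists>\<omega><\<omega>0. \<exists>M\<ge>1. \<forall>\<tau>\<ge>0. \<forall>\<beta>\<in>B. onorm (lift (Sb \<beta> \<tau>) \<circ> F.Qb \<beta>) \<le> M * exp (\<omega> * \<tau>) * onorm (F.Qb \<beta>)"
      by (rule F.reduced_solution_imp_decay[OF C(1)])
    then obtain \<omega> M1 where \<omega>: "\<omega> < \<omega>0" "M1 \<ge> 1"
      "\<And>\<tau> \<beta>. \<tau> \<ge> 0 \<Longrightarrow> \<beta> \<in> B \<Longrightarrow> onorm (lift (Sb \<beta> \<tau>) \<circ> F.Qb \<beta>) \<le> M1 * exp (\<omega> * \<tau>) * onorm (F.Qb \<beta>)" by blast
    have "onorm (Sb \<beta> \<tau> \<circ> (\<lambda>x. x - P \<beta> x)) \<le> M1 * exp (\<omega> * \<tau>) * onorm (\<lambda>x. x - P \<beta> x)" if "\<tau> \<ge> 0" "\<beta> \<in> B" for \<tau> \<beta>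
      using \<omega>(3)[OF that] unfolding decay_iff[OF that(2)] .
    then show ?decay using \<omega>(1,2) by blast
  qed
  then show ?thesis unfolding P_def A_def .
qed


end
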